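(* Let $p\ge1$, let $\mathcal M$ be a Riemannian manifold, $f\in C^{p+1}(\mathcal M)$, $R$ a retraction on $\mathcal M$, and $\mathcal V\subseteq\mathcal T\mathcal M$. Then $$\sup_{v\in\mathcal V}\left\|D^{p+1}\hat f_{\pi(v)}(v)\right\|_{op}\le(p+1)!\cdot\|f\|_{p+1,R(\mathcal V)}\cdot\|R\|_{p+1,\mathcal V}\cdot\left(1+\|R\|_{p+1,\mathcal V}\right)^p.$$
   Context: $\pi:\mathcal T\mathcal M\to\mathcal M$ is the projection. A retraction is a smooth map $R:\mathcal T\mathcal M\to\mathcal M$ with $R(0_x)=x$ and $d(R|_{\mathcal T_x\mathcal M})_{0_x}=\mathrm{Id}$. The pullback is $\hat f_x=f\circ R|_{\mathcal T_x\mathcal M}$, and $D^{p+1}\hat f_x(v)$ is its classical derivative on the inner product space $\mathcal T_x\mathcal M$ at $v$. $\|\cdot\|_{op}$ is the operator norm of multilinear maps (supremum of the norm over unit arguments). Covariant derivatives of $R$: $\mathcal T\mathcal M$ carries the Sasaki metric, i.e. the metric for which the vertical and horizontal (with respect to the Levi-Civita connection of $\mathcal M$) subspaces of $\mathcal T_v\mathcal T\mathcal M$ are orthogonal and each canonically isometric to $\mathcal T_{\pi(v)}\mathcal M$. For a smooth map $F:\mathcal A\to\mathcal B$ of Riemannian manifolds, the pullback connection $\nabla^F$ acts on sections of $\mathcal T\mathcal B$ along $F$ and is characterized by $\nabla^F_X(Y\circ F)=(\nabla^{\mathcal B}_{dF(X)}Y)\circ F$; on a $k$-covariant $\mathcal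 T\mathcal B$-valued tensor field $T$ along $F$, $(\nabla^FT)(X_1,\dots,X_{k+1})=\nabla^F_{X_{k+1}}[T(X_1,\dots,X_k)]-\sum_{i=1}^kT(X_1,\dots,\nabla^{\mathcal A}_{X_{k+1}}X_i,\dots,X_k)$, with $\nabla^{\mathcal A},\nabla^{\mathcal B}$ the Levi-Civita connections. The $k$-th covariant derivative of $R$ is $(\nabla^R)^{k-1}dR$ (with $\mathcal A=\mathcal T\mathcal M$, $\mathcal B=\mathcal M$). With $\nabla^if$ the $i$-th covariant derivative of $f$, set $$\|f\|_{k,\mathcal X}=\max_{1\le i\le k}\sup_{x\in\mathcal X}\frac{\|\nabla^if_x\|_{op}}{i!},\qquad\|R\|_{k,\mathcal V}=\max_{1\le i\le k}\sup_{v\in\mathcal V}\frac{\|(\nabla^R)^{i-1}dR_v\|_{op}}{i!}.$$ *)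

theory Defs
  imports "HOL-Analysis.Analysis" "HOL-Library.Function_Algebras"
begin

section \<open>Differentiability on open subsets of Euclidean space\<close>

text \<open>Meant for open \<open>S\<close>.\<close>

primrec Ck_on ::
  "nat \<Rightarrow> 'a::euclidean_space set \<Rightarrow> ('a \<Rightarrow> 'b::real_normed_vector) \<Rightarrow> bool" where
  "Ck_on 0 S h \<longleftrightarrow> continuous_on S h"
| "Ck_on (Suc k) S h \<longleftrightarrow>
     (\<forall>x\<in>S. h differentiable at x) \<and> (\<forall>v. Ck_on k S (\<lambda>x. frechet_derivative h (at x) v))"

definition smooth_on ::
  "'a::euclidean_space set \<Rightarrow> ('a \<Rightarrow> 'b::real_normed_vector) \<Rightarrow> bool" where
  "smooth_on S h \<longleftrightarrow> (\<forall>k. Ck_on k S h)"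


section \<open>Smooth manifolds\<close>

text \<open>A manifold is given by a smooth atlas, a set of charts modelled on \<open>'e\<close>; its underlying
  set is the union of the chart domains, and its topology is the one making all charts
  homeomorphisms onto open subsets of \<open>'e\<close>. Values of the coordinate map of a chart
  outside its domain are irrelevant.\<close>

type_synonym ('m, 'e) chart = "'m set \<times> ('m \<Rightarrow> 'e)"

abbreviation cdom :: "('m, 'e) chart \<Rightarrow> 'm set" where
  "cdom c \<equiv> fst c"

abbreviation crd :: "('m, 'e) chart \<Rightarrow> 'm \<Rightarrow> 'e" where
  "crd c \<equiv> snd c"

abbreviation cinv :: "('m, 'e) chart \<Rightarrow> 'e \<Rightarrow> 'm" where
  "cinv c \<equiv> inv_into (fst c) (snd c)"

definition carrier :: "('m, 'e) chart set \<Rightarrow> 'm set" where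
  "carrier A = (\<Union>c\<in>A. cdom c)"

definition mtopology :: "('m, 'e::euclidean_space) chart set \<Rightarrow> 'm topology" where
  "mtopology A =
     topology (\<lambda>U. U \<subseteq> carrier A \<and> (\<forall>c\<in>A. open (crd c ` (U \<inter> cdom c))))"

definition smooth_atlas :: "('m, 'e::euclidean_space) chart set \<Rightarrow> bool" where
  "smooth_atlas A \<longleftrightarrow>
     (\<forall>c\<in>A. inj_on (crd c) (cdom c)) \<and>
     (\<forall>c\<in>A. \<forall>d\<in>A. open (crd c ` (cdom c \<inter> cdom d)) \<and>
        smooth_on (crd c ` (cdom c \<inter> cdom d)) (crd d \<circ> cinv c))"

definition smooth_manifold :: "('m, 'e::euclidean_space) chart set \<Rightarrow> bool" where
  "smooth_manifold A \<longleftrightarrow>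
     smooth_atlas A \<and> Hausdorff_space (mtopology A) \<and> second_countable (mtopology A)"

text \<open>The predicate inside \<^const>\<open>mtopology\<close> is indeed a topology.\<close>

lemma openin_mtopology:
  assumes "\<And>c. c \<in> A \<Longrightarrow> inj_on (crd c) (cdom c)"
  shows "openin (mtopology A) U \<longleftrightarrow>
    U \<subseteq> carrier A \<and> (\<forall>c\<in>A. open (crd c ` (U \<inter> cdom c)))"
proof -
  let ?P = "\<lambda>U. U \<subseteq> carrier A \<and> (\<forall>c\<in>A. open (crd c ` (U \<inter> cdom c)))"
  have "istopology ?P"
    unfolding istopology_def
  proof (intro conjI allI impI ballI)
    fix S T c assume S: "?P S" and T: "?P T" and c: "c \<in> A"
    have "crd c ` ((S \<inter> T) \<inter> cdom c) = crd c ` (S \<inter> cdom c) \<inter> crd c ` (T \<inter> cdom c)"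
      using assms[OF c] by (auto simp: inj_on_def)
    then show "open (crd c ` ((S \<inter> T) \<inter> cdom c))"
      using S T c by auto
  next
    fix \<K> c assume K: "\<forall>K\<in>\<K>. ?P K" and c: "c \<in> A"
    have "crd c ` (\<Union>\<K> \<inter> cdom c) = (\<Union>K\<in>\<K>. crd c ` (K \<inter> cdom c))"
      by auto
    then show "open (crd c ` (\<Union>\<K> \<inter> cdom c))"
      using K c by auto
  qed auto
  then show ?thesis
    by (simp add: mtopology_def topology_inverse')
qed

definition Ck_fun ::
  "('m, 'e::euclidean_space) chart set \<Rightarrow> nat \<Rightarrow> 'm set \<Rightarrow> ('m \<Rightarrow> real) \<Rightarrow> bool" where
  "Ck_fun A k U h \<longleftrightarrow> (\<forall>c\<in>A. Ck_on k (crd c ` (U \<inter> cdom c)) (h \<circ> cinv c))"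

definition smooth_fun ::
  "('m, 'e::euclidean_space) chart set \<Rightarrow> 'm set \<Rightarrow> ('m \<Rightarrow> real) \<Rightarrow> bool" where
  "smooth_fun A U h \<longleftrightarrow> (\<forall>k. Ck_fun A k U h)"

definition smooth_map ::
  "('a, 'e::euclidean_space) chart set \<Rightarrow> ('b, 'f::euclidean_space) chart set \<Rightarrow>
    ('a \<Rightarrow> 'b) \<Rightarrow> bool" where
  "smooth_map A B F \<longleftrightarrow>
     continuous_map (mtopology A) (mtopology B) F \<and>
     (\<forall>c\<in>A. \<forall>d\<in>B. smooth_on (crd c ` {x \<in> cdom c. F x \<in> cdom d}) (crd d \<circ> F \<circ> cinv c))"


section \<open>Tangent vectors and the tangent bundle\<close>

text \<open>A tangent vector at \<open>x\<close> is the family of its coordinate vectors in the charts around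
  \<open>x\<close>, transforming by the derivatives of the chart transitions; entries at all other charts
  are zero, so that the vector space operations are the pointwise ones.\<close>

type_synonym ('m, 'e) tvec = "('m, 'e) chart \<Rightarrow> 'e"

definition tscale :: "real \<Rightarrow> ('m, 'e::real_vector) tvec \<Rightarrow> ('m, 'e) tvec" where
  "tscale r v = (\<lambda>c. r *\<^sub>R v c)"

definition tspace ::
  "('m, 'e::euclidean_space) chart set \<Rightarrow> 'm \<Rightarrow> ('m, 'e) tvec set" where
  "tspace A x = {v.
     (\<forall>c. \<not> (c \<in> A \<and> x \<in> cdom c) \<longrightarrow> v c = 0) \<and>
     (\<forall>c\<in>A. \<forall>d\<in>A. x \<in> cdom c \<inter> cdom d \<longrightarrow>
        v d = frechet_derivative (crd d \<circ> cinv c) (at (crd c x)) (v c))}"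

text \<open>The tangent bundle is a manifold of pairs \<open>(x, v)\<close>, so the projection is \<^const>\<open>fst\<close>.\<close>

definition tangent_chart ::
  "('m, 'e::euclidean_space) chart set \<Rightarrow> ('m, 'e) chart \<Rightarrow>
    ('m \<times> ('m, 'e) tvec, 'e \<times> 'e) chart" where
  "tangent_chart A c =
     ({(x, v). x \<in> cdom c \<and> v \<in> tspace A x}, \<lambda>(x, v). (crd c x, v c))"

definition tangent_atlas ::
  "('m, 'e::euclidean_space) chart set \<Rightarrow> ('m \<times> ('m, 'e) tvec, 'e \<times> 'e) chart set" where
  "tangent_atlas A = tangent_chart A ` A"

definition tangent_bundle ::
  "('m, 'e::euclidean_space) chart set \<Rightarrow> ('m \<times> ('m, 'e) tvec) set" where
  "tangent_bundle A = {(x, v). x \<in> carrier A \<and> v \<in> tspace A x}"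

definition chart_at :: "('m, 'e) chart set \<Rightarrow> 'm \<Rightarrow> ('m, 'e) chart" where
  "chart_at A x = (SOME c. c \<in> A \<and> x \<in> cdom c)"

text \<open>The derivative \<open>v[h]\<close> of a real function along \<open>v\<close>, and the differential of a map; neither
  depends on the chart used.\<close>

definition dir_deriv ::
  "('m, 'e::euclidean_space) chart set \<Rightarrow> 'm \<Rightarrow> ('m, 'e) tvec \<Rightarrow> ('m \<Rightarrow> real) \<Rightarrow> real" where
  "dir_deriv A x v h =
     (let c = chart_at A x in frechet_derivative (h \<circ> cinv c) (at (crd c x)) (v c))"

definition tmap ::
  "('a, 'e::euclidean_space) chart set \<Rightarrow> ('b, 'f::euclidean_space) chart set \<Rightarrow>
    ('a \<Rightarrow> 'b) \<Rightarrow> 'a \<Rightarrow> ('a, 'e) tvec \<Rightarrow> ('b, 'f) tvec" where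
  "tmap A B F x v = (\<lambda>d. if d \<in> B \<and> F x \<in> cdom d
     then let c = chart_at A x in frechet_derivative (crd d \<circ> F \<circ> cinv c) (at (crd c x)) (v c)
     else 0)"

definition velocity ::
  "('m, 'e::euclidean_space) chart set \<Rightarrow> (real \<Rightarrow> 'm) \<Rightarrow> ('m, 'e) tvec" where
  "velocity A \<gamma> = (\<lambda>c. if c \<in> A \<and> \<gamma> 0 \<in> cdom c
     then vector_derivative (\<lambda>t. crd c (\<gamma> t)) (at 0) else 0)"

text \<open>Smooth sections over \<open>U\<close> of the pullback of the tangent bundle of \<open>B\<close> under \<open>F\<close>.\<close>

definition sections_along ::
  "('a, 'e::euclidean_space) chart set \<Rightarrow> ('b, 'f::euclidean_space) chart set \<Rightarrow>
    ('a \<Rightarrow> 'b) \<Rightarrow> 'a set \<Rightarrow> ('a \<Rightarrow> ('b, 'f) tvec) set" where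
  "sections_along A B F U = {Y.
     (\<forall>x\<in>U. Y x \<in> tspace B (F x)) \<and>
     (\<forall>c\<in>A. \<forall>d\<in>B. smooth_on (crd c ` {x \<in> U \<inter> cdom c. F x \<in> cdom d}) (\<lambda>z. Y (cinv c z) d))}"

definition vector_fields ::
  "('m, 'e::euclidean_space) chart set \<Rightarrow> 'm set \<Rightarrow> ('m \<Rightarrow> ('m, 'e) tvec) set" where
  "vector_fields A U = sections_along A A (\<lambda>x. x) U"


section \<open>Riemannian metrics and connections\<close>

definition riemannian_metric ::
  "('m, 'e::euclidean_space) chart set \<Rightarrow>
    ('m \<Rightarrow> ('m, 'e) tvec \<Rightarrow> ('m, 'e) tvec \<Rightarrow> real) \<Rightarrow> bool" where
  "riemannian_metric A g \<longleftrightarrow>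
     (\<forall>x\<in>carrier A. \<forall>u\<in>tspace A x. \<forall>v\<in>tspace A x. \<forall>w\<in>tspace A x. \<forall>r.
        g x (u + v) w = g x u w + g x v w \<and> g x (tscale r u) w = r * g x u w \<and>
        g x u v = g x v u \<and> (u \<noteq> 0 \<longrightarrow> g x u u > 0)) \<and>
     (\<forall>U. openin (mtopology A) U \<longrightarrow>
        (\<forall>X\<in>vector_fields A U. \<forall>Y\<in>vector_fields A U. smooth_fun A U (\<lambda>x. g x (X x) (Y x))))"

definition riemannian_manifold ::
  "('m, 'e::euclidean_space) chart set \<Rightarrow>
    ('m \<Rightarrow> ('m, 'e) tvec \<Rightarrow> ('m, 'e) tvec \<Rightarrow> real) \<Rightarrow> bool" where
  "riemannian_manifold A g \<longleftrightarrow> smooth_manifold A \<and> riemannian_metric A g"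

definition metric_norm ::
  "('m \<Rightarrow> ('m, 'e) tvec \<Rightarrow> ('m, 'e) tvec \<Rightarrow> real) \<Rightarrow> 'm \<Rightarrow> ('m, 'e) tvec \<Rightarrow> real" where
  "metric_norm g x v = sqrt (g x v v)"

text \<open>A connection on the pullback of the tangent bundle of \<open>B\<close> under \<open>F\<close>. Here
  \<open>D x v Y\<close> stands for \<open>\<nabla>\<^sub>v Y\<close>, where \<open>v\<close> is a tangent vector at \<open>x\<close> and \<open>Y\<close> is a section
  defined near \<open>x\<close>; for a vector field \<open>X\<close>, the section \<open>\<nabla>\<^sub>X Y\<close> is \<open>\<lambda>x. D x (X x) Y\<close>.\<close>

definition connection_along ::
  "('a, 'e::euclidean_space) chart set \<Rightarrow> ('b, 'f::euclidean_space) chart set \<Rightarrow> ('a \<Rightarrow> 'b) \<Rightarrow>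
    ('a \<Rightarrow> ('a, 'e) tvec \<Rightarrow> ('a \<Rightarrow> ('b, 'f) tvec) \<Rightarrow> ('b, 'f) tvec) \<Rightarrow> bool" where
  "connection_along A B F D \<longleftrightarrow>
    (\<forall>U. openin (mtopology A) U \<longrightarrow>
      (\<forall>Y\<in>sections_along A B F U.
        (\<forall>X\<in>vector_fields A U. (\<lambda>x. D x (X x) Y) \<in> sections_along A B F U) \<and>
        (\<forall>x\<in>U. \<forall>u\<in>tspace A x. \<forall>v\<in>tspace A x. \<forall>r.
          D x v Y \<in> tspace B (F x) \<and>
          D x (u + v) Y = D x u Y + D x v Y \<and>
          D x (tscale r v) Y = tscale r (D x v Y) \<and>
          (\<forall>Z\<in>sections_along A B F U. D x v (\<lambda>y. Y y + Z y) = D x v Y + D x v Z) \<and>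
          (\<forall>h. smooth_fun A U h \<longrightarrow>
            D x v (\<lambda>y. tscale (h y) (Y y)) =
              tscale (dir_deriv A x v h) (Y x) + tscale (h x) (D x v Y)) \<and>
          (\<forall>Z. (\<forall>y\<in>U. Z y = Y y) \<longrightarrow> D x v Z = D x v Y))))"

definition torsion_free ::
  "('m, 'e::euclidean_space) chart set \<Rightarrow>
    ('m \<Rightarrow> ('m, 'e) tvec \<Rightarrow> ('m \<Rightarrow> ('m, 'e) tvec) \<Rightarrow> ('m, 'e) tvec) \<Rightarrow> bool" where
  "torsion_free A D \<longleftrightarrow>
    (\<forall>U. openin (mtopology A) U \<longrightarrow>
      (\<forall>X\<in>vector_fields A U. \<forall>Y\<in>vector_fields A U. \<forall>h. smooth_fun A U h \<longrightarrow> (\<forall>x\<in>U.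
        dir_deriv A x (D x (X x) Y - D x (Y x) X) h =
          dir_deriv A x (X x) (\<lambda>y. dir_deriv A y (Y y) h) -
          dir_deriv A x (Y x) (\<lambda>y. dir_deriv A y (X y) h))))"

definition metric_compatible ::
  "('m, 'e::euclidean_space) chart set \<Rightarrow>
    ('m \<Rightarrow> ('m, 'e) tvec \<Rightarrow> ('m, 'e) tvec \<Rightarrow> real) \<Rightarrow>
    ('m \<Rightarrow> ('m, 'e) tvec \<Rightarrow> ('m \<Rightarrow> ('m, 'e) tvec) \<Rightarrow> ('m, 'e) tvec) \<Rightarrow> bool" where
  "metric_compatible A g D \<longleftrightarrow>
    (\<forall>U. openin (mtopology A) U \<longrightarrow>
      (\<forall>Y\<in>vector_fields A U. \<forall>Z\<in>vector_fields A U. \<forall>x\<in>U. \<forall>v\<in>tspace A x.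
        dir_deriv A x v (\<lambda>y. g y (Y y) (Z y)) = g x (D x v Y) (Z x) + g x (Y x) (D x v Z)))"

definition levi_civita ::
  "('m, 'e::euclidean_space) chart set \<Rightarrow>
    ('m \<Rightarrow> ('m, 'e) tvec \<Rightarrow> ('m, 'e) tvec \<Rightarrow> real) \<Rightarrow>
    ('m \<Rightarrow> ('m, 'e) tvec \<Rightarrow> ('m \<Rightarrow> ('m, 'e) tvec) \<Rightarrow> ('m, 'e) tvec) \<Rightarrow> bool" where
  "levi_civita A g D \<longleftrightarrow>
     connection_along A A (\<lambda>x. x) D \<and> torsion_free A D \<and> metric_compatible A g D"

definition pullback_connection ::
  "('a, 'e::euclidean_space) chart set \<Rightarrow> ('b, 'f::euclidean_space) chart set \<Rightarrow> ('a \<Rightarrow> 'b) \<Rightarrow>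
    ('b \<Rightarrow> ('b, 'f) tvec \<Rightarrow> ('b \<Rightarrow> ('b, 'f) tvec) \<Rightarrow> ('b, 'f) tvec) \<Rightarrow>
    ('a \<Rightarrow> ('a, 'e) tvec \<Rightarrow> ('a \<Rightarrow> ('b, 'f) tvec) \<Rightarrow> ('b, 'f) tvec) \<Rightarrow> bool" where
  "pullback_connection A B F DB DF \<longleftrightarrow>
    connection_along A B F DF \<and>
    (\<forall>W. openin (mtopology B) W \<longrightarrow>
      (\<forall>Y\<in>vector_fields B W. \<forall>x\<in>carrier A. F x \<in> W \<longrightarrow> (\<forall>v\<in>tspace A x.
        DF x v (Y \<circ> F) = DB (F x) (tmap A B F x v) Y)))"


section \<open>Covariant derivatives of tensor fields\<close>

text \<open>A \<open>k\<close>-covariant tensor field is a function of a point and a list of \<open>k\<close> tangent vectors.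
  Its values are differentiated by \<open>DF\<close>: this is \<^term>\<open>dir_deriv A\<close> for real-valued tensor
  fields, and a pullback connection for tensor fields with values along a map; \<open>DA\<close> is the
  connection on the domain. The derivative is computed by extending the argument vectors to
  vector fields near the point, the last one being the direction of differentiation; the result
  does not depend on the extension.\<close>

definition cov_deriv ::
  "('a, 'e::euclidean_space) chart set \<Rightarrow>
    ('a \<Rightarrow> ('a, 'e) tvec \<Rightarrow> ('a \<Rightarrow> ('a, 'e) tvec) \<Rightarrow> ('a, 'e) tvec) \<Rightarrow>
    ('a \<Rightarrow> ('a, 'e) tvec \<Rightarrow> ('a \<Rightarrow> 'b::ab_group_add) \<Rightarrow> 'b) \<Rightarrow>
    ('a \<Rightarrow> ('a, 'e) tvec list \<Rightarrow> 'b) \<Rightarrow> 'a \<Rightarrow> ('a, 'e) tvec list \<Rightarrow> 'b" where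
  "cov_deriv A DA DF T x vs = (THE w. \<forall>U Xs.
     openin (mtopology A) U \<and> x \<in> U \<and> set Xs \<subseteq> vector_fields A U \<and> map (\<lambda>X. X x) Xs = vs \<longrightarrow>
     w = DF x (last vs) (\<lambda>y. T y (map (\<lambda>X. X y) (butlast Xs)))
         - (\<Sum>i<length vs - 1. T x ((butlast vs)[i := DA x (last vs) (Xs ! i)])))"

text \<open>\<open>\<nabla>\<^sup>k f\<close>\<close>

definition cov_deriv_fun ::
  "('m, 'e::euclidean_space) chart set \<Rightarrow>
    ('m \<Rightarrow> ('m, 'e) tvec \<Rightarrow> ('m \<Rightarrow> ('m, 'e) tvec) \<Rightarrow> ('m, 'e) tvec) \<Rightarrow>
    ('m \<Rightarrow> real) \<Rightarrow> nat \<Rightarrow> 'm \<Rightarrow> ('m, 'e) tvec list \<Rightarrow> real" where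
  "cov_deriv_fun A D f k = (cov_deriv A D (dir_deriv A) ^^ k) (\<lambda>x vs. f x)"

text \<open>\<open>(\<nabla>\<^sup>F)\<^sup>k\<^sup>-\<^sup>1 dF\<close>, meant for \<open>k \<ge> 1\<close>\<close>

definition cov_deriv_map ::
  "('a, 'e::euclidean_space) chart set \<Rightarrow> ('b, 'f::euclidean_space) chart set \<Rightarrow>
    ('a \<Rightarrow> ('a, 'e) tvec \<Rightarrow> ('a \<Rightarrow> ('a, 'e) tvec) \<Rightarrow> ('a, 'e) tvec) \<Rightarrow>
    ('a \<Rightarrow> ('a, 'e) tvec \<Rightarrow> ('a \<Rightarrow> ('b, 'f) tvec) \<Rightarrow> ('b, 'f) tvec) \<Rightarrow>
    ('a \<Rightarrow> 'b) \<Rightarrow> nat \<Rightarrow> 'a \<Rightarrow> ('a, 'e) tvec list \<Rightarrow> ('b, 'f) tvec" where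
  "cov_deriv_map A B DA DF F k =
     (cov_deriv A DA DF ^^ (k - 1)) (\<lambda>x vs. tmap A B F x (hd vs))"

text \<open>Operator norm of a \<open>k\<close>-linear map on a space \<open>W\<close> with norm \<open>N\<close> into a space with norm \<open>N'\<close>.
  Suprema are taken in \<open>[0, \<infinity>]\<close>.\<close>

definition op_norm ::
  "nat \<Rightarrow> 'v set \<Rightarrow> ('v \<Rightarrow> real) \<Rightarrow> ('w \<Rightarrow> real) \<Rightarrow> ('v list \<Rightarrow> 'w) \<Rightarrow> ennreal" where
  "op_norm k W N N' T =
     (SUP ws\<in>{ws. length ws = k \<and> (\<forall>w\<in>set ws. w \<in> W \<and> N w = 1)}. ennreal (N' (T ws)))"

definition fun_norm ::
  "('m, 'e::euclidean_space) chart set \<Rightarrow>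
    ('m \<Rightarrow> ('m, 'e) tvec \<Rightarrow> ('m, 'e) tvec \<Rightarrow> real) \<Rightarrow>
    ('m \<Rightarrow> ('m, 'e) tvec \<Rightarrow> ('m \<Rightarrow> ('m, 'e) tvec) \<Rightarrow> ('m, 'e) tvec) \<Rightarrow>
    ('m \<Rightarrow> real) \<Rightarrow> nat \<Rightarrow> 'm set \<Rightarrow> ennreal" where
  "fun_norm A g D f k S = (MAX i\<in>{1..k}. SUP x\<in>S.
     op_norm i (tspace A x) (metric_norm g x) abs (cov_deriv_fun A D f i x) / fact i)"

definition map_norm ::
  "('a, 'e::euclidean_space) chart set \<Rightarrow> ('b, 'f::euclidean_space) chart set \<Rightarrow>
    ('a \<Rightarrow> ('a, 'e) tvec \<Rightarrow> ('a, 'e) tvec \<Rightarrow> real) \<Rightarrow>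
    ('b \<Rightarrow> ('b, 'f) tvec \<Rightarrow> ('b, 'f) tvec \<Rightarrow> real) \<Rightarrow>
    ('a \<Rightarrow> ('a, 'e) tvec \<Rightarrow> ('a \<Rightarrow> ('a, 'e) tvec) \<Rightarrow> ('a, 'e) tvec) \<Rightarrow>
    ('a \<Rightarrow> ('a, 'e) tvec \<Rightarrow> ('a \<Rightarrow> ('b, 'f) tvec) \<Rightarrow> ('b, 'f) tvec) \<Rightarrow>
    ('a \<Rightarrow> 'b) \<Rightarrow> nat \<Rightarrow> 'a set \<Rightarrow> ennreal" where
  "map_norm A B gA gB DA DF F k S = (MAX i\<in>{1..k}. SUP x\<in>S.
     op_norm i (tspace A x) (metric_norm gA x) (metric_norm gB (F x))
       (cov_deriv_map A B DA DF F i x) / fact i)"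


section \<open>The Sasaki metric and retractions\<close>

definition vertical ::
  "('m, 'e::euclidean_space) chart set \<Rightarrow> 'm \<times> ('m, 'e) tvec \<Rightarrow>
    ('m \<times> ('m, 'e) tvec, 'e \<times> 'e) tvec set" where
  "vertical A p = {\<xi> \<in> tspace (tangent_atlas A) p. tmap (tangent_atlas A) A fst p \<xi> = 0}"

text \<open>The canonical isomorphism from the tangent space at \<open>fst p\<close> onto the vertical space at \<open>p\<close>.\<close>

definition vertical_lift ::
  "('m, 'e::euclidean_space) chart set \<Rightarrow> 'm \<times> ('m, 'e) tvec \<Rightarrow> ('m, 'e) tvec \<Rightarrow>
    ('m \<times> ('m, 'e) tvec, 'e \<times> 'e) tvec" where
  "vertical_lift A p w = velocity (tangent_atlas A) (\<lambda>t. (fst p, snd p + tscale t w))"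

text \<open>The horizontal space at \<open>p = (x, v)\<close> consists of the vectors \<open>dY\<^sub>x(u)\<close>, where \<open>Y\<close> is a vector
  field near \<open>x\<close> with \<open>Y(x) = v\<close> that is parallel at \<open>x\<close> in the direction \<open>u\<close>.\<close>

definition horizontal ::
  "('m, 'e::euclidean_space) chart set \<Rightarrow>
    ('m \<Rightarrow> ('m, 'e) tvec \<Rightarrow> ('m \<Rightarrow> ('m, 'e) tvec) \<Rightarrow> ('m, 'e) tvec) \<Rightarrow>
    'm \<times> ('m, 'e) tvec \<Rightarrow> ('m \<times> ('m, 'e) tvec, 'e \<times> 'e) tvec set" where
  "horizontal A D p =
     {tmap A (tangent_atlas A) (\<lambda>y. (y, Y y)) (fst p) u | U Y u.
        openin (mtopology A) U \<and> fst p \<in> U \<and> Y \<in> vector_fields A U \<and> Y (fst p) = snd p \<and>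
        u \<in> tspace A (fst p) \<and> D (fst p) u Y = 0}"

definition sasaki_metric ::
  "('m, 'e::euclidean_space) chart set \<Rightarrow>
    ('m \<Rightarrow> ('m, 'e) tvec \<Rightarrow> ('m, 'e) tvec \<Rightarrow> real) \<Rightarrow>
    ('m \<Rightarrow> ('m, 'e) tvec \<Rightarrow> ('m \<Rightarrow> ('m, 'e) tvec) \<Rightarrow> ('m, 'e) tvec) \<Rightarrow>
    ('m \<times> ('m, 'e) tvec \<Rightarrow> ('m \<times> ('m, 'e) tvec, 'e \<times> 'e) tvec \<Rightarrow>
      ('m \<times> ('m, 'e) tvec, 'e \<times> 'e) tvec \<Rightarrow> real) \<Rightarrow> bool" where
  "sasaki_metric A g D G \<longleftrightarrow>
    riemannian_metric (tangent_atlas A) G \<and>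
    (\<forall>p\<in>tangent_bundle A.
      (\<forall>\<xi>\<in>vertical A p. \<forall>\<eta>\<in>horizontal A D p. G p \<xi> \<eta> = 0) \<and>
      (\<forall>u\<in>tspace A (fst p). \<forall>w\<in>tspace A (fst p).
        G p (vertical_lift A p u) (vertical_lift A p w) = g (fst p) u w) \<and>
      (\<forall>\<xi>\<in>horizontal A D p. \<forall>\<eta>\<in>horizontal A D p.
        G p \<xi> \<eta> =
          g (fst p) (tmap (tangent_atlas A) A fst p \<xi>) (tmap (tangent_atlas A) A fst p \<eta>)))"

text \<open>The last condition says that \<open>d(R|T\<^sub>x)\<close> at \<open>0\<^sub>x\<close> is the identity, the differential being
  evaluated on the straight lines \<open>t \<mapsto> t w\<close> in the tangent space at \<open>x\<close>.\<close>

definition manifold_retraction ::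
  "('m, 'e::euclidean_space) chart set \<Rightarrow> ('m \<times> ('m, 'e) tvec \<Rightarrow> 'm) \<Rightarrow> bool" where
  "manifold_retraction A R \<longleftrightarrow>
     smooth_map (tangent_atlas A) A R \<and>
     (\<forall>x\<in>carrier A. R (x, 0) = x \<and>
        (\<forall>w\<in>tspace A x. velocity A (\<lambda>t. R (x, tscale t w)) = w))"


section \<open>Derivatives on a tangent space\<close>

definition pullback_fun ::
  "('m \<Rightarrow> real) \<Rightarrow> ('m \<times> ('m, 'e) tvec \<Rightarrow> 'm) \<Rightarrow> 'm \<Rightarrow> ('m, 'e) tvec \<Rightarrow> real" where
  "pullback_fun f R x = (\<lambda>v. f (R (x, v)))"

text \<open>Frechet derivatives on a finite-dimensional space \<open>W\<close> of tangent vectors with norm \<open>N\<close>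
  (which is not a type, so that \<^const>\<open>has_derivative\<close> does not apply).\<close>

definition has_space_deriv ::
  "('m, 'e::euclidean_space) tvec set \<Rightarrow> (('m, 'e) tvec \<Rightarrow> real) \<Rightarrow>
    (('m, 'e) tvec \<Rightarrow> real) \<Rightarrow> ('m, 'e) tvec \<Rightarrow> (('m, 'e) tvec \<Rightarrow> real) \<Rightarrow> bool" where
  "has_space_deriv W N h v L \<longleftrightarrow>
     (\<forall>u\<in>W. \<forall>w\<in>W. L (u + w) = L u + L w) \<and>
     (\<forall>w\<in>W. \<forall>r. L (tscale r w) = r * L w) \<and>
     (\<forall>\<epsilon>>0. \<exists>\<delta>>0. \<forall>w\<in>W. N w < \<delta> \<longrightarrow> \<bar>h (v + w) - h v - L w\<bar> \<le> \<epsilon> * N w)"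

definition space_deriv ::
  "('m, 'e::euclidean_space) tvec set \<Rightarrow> (('m, 'e) tvec \<Rightarrow> real) \<Rightarrow>
    (('m, 'e) tvec \<Rightarrow> real) \<Rightarrow> ('m, 'e) tvec \<Rightarrow> ('m, 'e) tvec \<Rightarrow> real" where
  "space_deriv W N h v = (SOME L. has_space_deriv W N h v L)"

text \<open>\<open>D\<^sup>k h(v)\<close>, applied to the list of its \<open>k\<close> arguments: the value of \<open>D\<^sup>k\<^sup>+\<^sup>1 h(v)\<close> at
  \<open>w\<^sub>1, \<dots>, w\<^sub>k\<^sub>+\<^sub>1\<close> is the derivative at \<open>v\<close> along \<open>w\<^sub>k\<^sub>+\<^sub>1\<close> of \<open>u \<mapsto> D\<^sup>k h(u)(w\<^sub>1, \<dots>, w\<^sub>k)\<close>.\<close>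

primrec space_nderiv ::
  "('m, 'e::euclidean_space) tvec set \<Rightarrow> (('m, 'e) tvec \<Rightarrow> real) \<Rightarrow> nat \<Rightarrow>
    (('m, 'e) tvec \<Rightarrow> real) \<Rightarrow> ('m, 'e) tvec \<Rightarrow> ('m, 'e) tvec list \<Rightarrow> real" where
  "space_nderiv W N 0 h v ws = h v"
| "space_nderiv W N (Suc k) h v ws =
     space_deriv W N (\<lambda>u. space_nderiv W N k h u (butlast ws)) v (last ws)"

end

theory Submission
  imports Defs
begin

text \<open>
  The fibres of the tangent bundle are flat and totally geodesic for the Sasaki metric: by the
  Koszul formula, the Christoffel symbols of \<open>T\<M>\<close> vanish on pairs of vertical vectors.
  Hence, along a fibre, the derivatives of \<open>f \<circ> R\<close> can be computed by a chain rule in which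
  differentiating \<open>\<nabla>\<^sup>m f\<close> applied to covariant derivatives of \<open>R\<close> on vertical lifts
  produces only terms of the same form. This gives \<open>D\<^sup>p\<^sup>+\<^sup>1\<close> of the pullback as a sum over
  partitions of the arguments, where a partition into blocks \<open>B\<^sub>1, \<dots>, B\<^sub>m\<close> contributes at most
  \<open>m! \<Prod>\<bar>B\<^sub>i\<bar>!\<close> times \<open>\<parallel>f\<parallel> \<parallel>R\<parallel>\<^sup>m\<close>. The partitions with \<open>m\<close> blocks have total weight
  \<open>(p+1)! (p choose m-1)\<close>, and the binomial theorem concludes.
\<close>


section \<open>Calculus of \<open>C\<^sup>k\<close> functions\<close>

text \<open>Tangent spaces are sets, not types, and \<open>cov_deriv\<close> is a definite
  description over all extensions of its arguments to vector fields. To be differentiated, tensors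
  are therefore replaced by their components in charts: a connection becomes a derivative plus a
  Christoffel term, and iterated covariant derivatives become iterates of
  \<open>cov_deriv_coord\<close>. The Koszul step works because, in a chart, the Sasaki product of
  the vertical vector \<open>(0, a)\<close> with \<open>(b, e)\<close> at the point
  \<open>(z, v)\<close> is the product in \<open>g\<close> of \<open>a\<close> with
  \<open>e + \<Gamma>(b, v)\<close>. It is affine in \<open>v\<close>, and does not depend on
  \<open>v\<close> if \<open>b = 0\<close>. The chain rule closes up because the Christoffel terms
  that the derivatives of \<open>f\<close> subtract at the image point are those that the pullback
  connection adds to the derivatives of \<open>R\<close>. The norms may be infinite, so the final
  estimate stays in \<open>ennreal\<close> and uses only sums, products and monotonicity.\<close>

lemma Ck_on_subset: "Ck_on k S h \<Longrightarrow> T \<subseteq> S \<Longrightarrow> Ck_on k T h"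
  by (induction k arbitrary: h) (auto intro: continuous_on_subset)

lemma frechet_derivative_cong_open:
  assumes "open S" "x \<in> S" "\<And>y. y \<in> S \<Longrightarrow> h y = h' y"
  shows "frechet_derivative h (at x) = frechet_derivative h' (at x)"
    and "h differentiable at x \<longleftrightarrow> h' differentiable at x"
proof -
  have *: "(h has_derivative L) (at x) \<longleftrightarrow> (h' has_derivative L) (at x)" for L
    using assms by (metis has_derivative_transform_within_open)
  then show "frechet_derivative h (at x) = frechet_derivative h' (at x)"
    by (simp add: frechet_derivative_def)
  show "h differentiable at x \<longleftrightarrow> h' differentiable at x"
    using * by (simp add: differentiable_def)
qed

lemma Ck_on_cong:
  assumes "open S" "\<And>y. y \<in> S \<Longrightarrow> h y = h' y"
  shows "Ck_on k S h \<longleftrightarrow> Ck_on k S h'"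
  using assms(2)
proof (induction k arbitrary: h h')
  case 0
  then show ?case by (auto cong: continuous_on_cong)
next
  case (Suc k)
  have "frechet_derivative h (at x) = frechet_derivative h' (at x)" if "x \<in> S" for x
    using frechet_derivative_cong_open(1)[OF assms(1) that] Suc.prems by blast
  then have "Ck_on k S (\<lambda>x. frechet_derivative h (at x) v) \<longleftrightarrow>
      Ck_on k S (\<lambda>x. frechet_derivative h' (at x) v)" for v
    by (intro Suc.IH) auto
  moreover have "(\<forall>x\<in>S. h differentiable at x) \<longleftrightarrow> (\<forall>x\<in>S. h' differentiable at x)"
    using frechet_derivative_cong_open(2)[OF assms(1)] Suc.prems by blast
  ultimately show ?case by simp
qed

lemma Ck_on_Suc_imp: "Ck_on (Suc k) S h \<Longrightarrow> Ck_on k S h"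
proof (induction k arbitrary: h)
  case 0
  then show ?case
    by (auto intro!: continuous_at_imp_continuous_on differentiable_imp_continuous_within)
next
  case (Suc k)
  from Suc.prems show ?case by (auto intro: Suc.IH simp del: Ck_on.simps(2) simp: Ck_on.simps(2)[of k] Ck_on.simps(2)[of "Suc k"])
qed

lemma Ck_on_le: "Ck_on k S h \<Longrightarrow> j \<le> k \<Longrightarrow> Ck_on j S h"
  by (induction k) (auto simp: le_Suc_eq dest: Ck_on_Suc_imp simp del: Ck_on.simps)

lemma Ck_on_Suc_D:
  assumes "Ck_on (Suc k) S h" "x \<in> S"
  shows "h differentiable at x" "(h has_derivative frechet_derivative h (at x)) (at x)"
    "linear (frechet_derivative h (at x))"
  using assms by (auto simp: frechet_derivative_works[symmetric] linear_frechet_derivative)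

lemma Ck_on_const [simp]: "Ck_on k S (\<lambda>x. a)"
  by (induction k arbitrary: a) (auto simp: frechet_derivative_const)

lemma Ck_on_add:
  assumes "open S" "Ck_on k S h" "Ck_on k S h'"
  shows "Ck_on k S (\<lambda>x. h x + h' x)"
  using assms(2,3)
proof (induction k arbitrary: h h')
  case 0 then show ?case by (auto intro: continuous_intros)
next
  case (Suc k)
  have d: "((\<lambda>x. h x + h' x) has_derivative
      (\<lambda>v. frechet_derivative h (at x) v + frechet_derivative h' (at x) v)) (at x)"
    if "x \<in> S" for x
    using has_derivative_add[OF Ck_on_Suc_D(2)[OF Suc.prems(1) that] Ck_on_Suc_D(2)[OF Suc.prems(2) that]] .
  have "Ck_on k S (\<lambda>x. frechet_derivative (\<lambda>x. h x + h' x) (at x) v) \<longleftrightarrow>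
    Ck_on k S (\<lambda>x. frechet_derivative h (at x) v + frechet_derivative h' (at x) v)" for v
    by (rule Ck_on_cong[OF assms(1)]) (simp add: frechet_derivative_at[OF d, symmetric])
  moreover have "Ck_on k S (\<lambda>x. frechet_derivative h (at x) v + frechet_derivative h' (at x) v)" for v
    using Suc.prems by (intro Suc.IH) auto
  ultimately show ?case
    using d by (auto simp: differentiable_def)
qed

lemma Ck_on_sum:
  assumes "open S" "\<And>i. i \<in> I \<Longrightarrow> Ck_on k S (h i)"
  shows "Ck_on k S (\<lambda>x. \<Sum>i\<in>I. h i x)"
  using assms(2) by (induction I rule: infinite_finite_induct) (auto intro: Ck_on_add[OF assms(1)])

lemma Ck_on_bounded_bilinear:
  assumes "bounded_bilinear bop" "open S" "Ck_on k S h" "Ck_on k S h'"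
  shows "Ck_on k S (\<lambda>x. bop (h x) (h' x))"
  using assms(3,4)
proof (induction k arbitrary: h h')
  case 0 then show ?case
    by (auto intro: bounded_bilinear.continuous_on[OF assms(1)])
next
  case (Suc k)
  have d: "((\<lambda>x. bop (h x) (h' x)) has_derivative
      (\<lambda>v. bop (h x) (frechet_derivative h' (at x) v) + bop (frechet_derivative h (at x) v) (h' x))) (at x)"
    if "x \<in> S" for x
    using bounded_bilinear.FDERIV[OF assms(1)] Ck_on_Suc_D(2)[OF Suc.prems(1) that]
      Ck_on_Suc_D(2)[OF Suc.prems(2) that] by blast
  have "Ck_on k S (\<lambda>x. frechet_derivative (\<lambda>x. bop (h x) (h' x)) (at x) v) \<longleftrightarrow>
    Ck_on k S (\<lambda>x. bop (h x) (frechet_derivative h' (at x) v) + bop (frechet_derivative h (at x) v) (h' x))" for v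
    by (rule Ck_on_cong[OF assms(2)]) (simp add: frechet_derivative_at[OF d, symmetric])
  moreover have "Ck_on k S (\<lambda>x. bop (h x) (frechet_derivative h' (at x) v) + bop (frechet_derivative h (at x) v) (h' x))" for v
    using Suc.prems Ck_on_Suc_imp[OF Suc.prems(1)] Ck_on_Suc_imp[OF Suc.prems(2)]
    by (intro Ck_on_add[OF assms(2)] Suc.IH) auto
  ultimately show ?case
    using d by (auto simp: differentiable_def)
qed

lemmas Ck_on_scaleR = Ck_on_bounded_bilinear[OF bounded_bilinear_scaleR]

lemma Ck_on_linear_comp:
  assumes "bounded_linear L" "open S" "Ck_on k S h"
  shows "Ck_on k S (\<lambda>x. L (h x))"
proof -
  \<comment> \<open>Composition with \<open>L\<close> is the bilinear map
    \<open>r *\<^sub>R L x\<close> at the constant \<open>r = 1\<close>, so the bilinear product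
    rule applies without another induction.\<close>
  have "bounded_bilinear (\<lambda>(r::real) x. r *\<^sub>R L x)"
    using bounded_bilinear.comp[OF bounded_bilinear_scaleR bounded_linear_ident assms(1)] .
  from Ck_on_bounded_bilinear[OF this assms(2) _ assms(3), of "\<lambda>_. 1"]
  show ?thesis by simp
qed

lemma Ck_on_ident: "Ck_on k S (\<lambda>x. x)"
  by (cases k) (auto intro: continuous_intros simp: frechet_derivative_ident)

lemma Ck_on_bounded_linear:
  assumes "bounded_linear L" "open S"
  shows "Ck_on k S L"
  using Ck_on_linear_comp[OF assms Ck_on_ident] by simp

lemma Ck_on_minus:
  assumes "open S" "Ck_on k S h" "Ck_on k S h'"
  shows "Ck_on k S (\<lambda>x. h x - h' x)"
  using Ck_on_add[OF assms(1,2) Ck_on_linear_comp[OF bounded_linear_minus[OF bounded_linear_ident] assms(1,3)]]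
  by simp

lemma linear_euclidean_expand:
  fixes L :: "'a::euclidean_space \<Rightarrow> 'b::real_vector"
  assumes "linear L"
  shows "L a = (\<Sum>b\<in>Basis. (a \<bullet> b) *\<^sub>R L b)"
  by (subst euclidean_representation[of a, symmetric])
    (simp add: linear_sum[OF assms] linear_scale[OF assms])

text \<open>\<open>Ck_on\<close> tests derivatives in fixed directions, whereas the chain rule
  evaluates the derivative of \<open>h'\<close> in a moving one. Expanding that direction in the
  basis leaves fixed directions with variable coefficients, to which the induction hypothesis and
  the product rule apply.\<close>

lemma Ck_on_compose:
  fixes h :: "'a::euclidean_space \<Rightarrow> 'b::euclidean_space" and h' :: "'b \<Rightarrow> 'c::real_normed_vector"
  assumes "open S" "open T" "h ` S \<subseteq> T" "Ck_on k S h" "Ck_on k T h'"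
  shows "Ck_on k S (\<lambda>x. h' (h x))"
  using assms(4,5)
proof (induction k arbitrary: h')
  case 0 then show ?case using assms(3) by (auto intro: continuous_on_compose2)
next
  case (Suc k)
  have T: "h x \<in> T" if "x \<in> S" for x using that assms(3) by auto
  have d: "((\<lambda>x. h' (h x)) has_derivative (\<lambda>v. frechet_derivative h' (at (h x)) (frechet_derivative h (at x) v))) (at x)"
    if "x \<in> S" for x
    using diff_chain_at[OF Ck_on_Suc_D(2)[OF Suc.prems(1) that] Ck_on_Suc_D(2)[OF Suc.prems(2) T[OF that]]]
    by (simp add: o_def)
  have "Ck_on k S (\<lambda>x. frechet_derivative (\<lambda>x. h' (h x)) (at x) v) \<longleftrightarrow>
    Ck_on k S (\<lambda>x. \<Sum>b\<in>Basis. (frechet_derivative h (at x) v \<bullet> b) *\<^sub>R frechet_derivative h' (at (h x)) b)" for v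
    by (rule Ck_on_cong[OF assms(1)])
     (simp add: frechet_derivative_at[OF d, symmetric] linear_euclidean_expand[OF Ck_on_Suc_D(3)[OF Suc.prems(2) T], symmetric])
  moreover have "Ck_on k S (\<lambda>x. \<Sum>b\<in>Basis. (frechet_derivative h (at x) v \<bullet> b) *\<^sub>R frechet_derivative h' (at (h x)) b)" for v
    using Suc.prems Ck_on_Suc_imp[OF Suc.prems(1)]
    by (intro Ck_on_sum Ck_on_scaleR Ck_on_linear_comp[OF bounded_linear_inner_left] assms Suc.IH) auto
  ultimately show ?case
    using d by (auto simp: differentiable_def)
qed

lemma smooth_on_Ck: "smooth_on S h \<Longrightarrow> Ck_on k S h" by (simp add: smooth_on_def)

lemma smooth_on_subset: "smooth_on S h \<Longrightarrow> T \<subseteq> S \<Longrightarrow> smooth_on T h"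
  by (auto simp: smooth_on_def intro: Ck_on_subset)

lemma smooth_on_cong: "open S \<Longrightarrow> (\<And>y. y \<in> S \<Longrightarrow> h y = h' y) \<Longrightarrow> smooth_on S h \<longleftrightarrow> smooth_on S h'"
  unfolding smooth_on_def using Ck_on_cong by blast

lemma smooth_on_diff:
  assumes "smooth_on S h" "x \<in> S"
  shows "h differentiable at x" "(h has_derivative frechet_derivative h (at x)) (at x)"
    "linear (frechet_derivative h (at x))"
  using Ck_on_Suc_D[OF smooth_on_Ck[OF assms(1)] assms(2)] by auto

section \<open>Tangent vectors in charts\<close>

declare split_paired_All [simp del] split_paired_Ex [simp del]

lemma fun_sum_apply: "(\<Sum>i\<in>I. f i) x = (\<Sum>i\<in>I. f i x)"
  by (induction I rule: infinite_finite_induct) auto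

text \<open>For \<open>x\<close> in the domain of \<open>c\<close>, this inverts the evaluation
  \<open>v \<mapsto> v c\<close> on \<open>tspace A x\<close>. With \<open>a\<close> fixed and
  \<open>x\<close> moving it is a coordinate field of \<open>c\<close>.\<close>

definition tvec_of ::
  "('m, 'e::euclidean_space) chart set \<Rightarrow> ('m, 'e) chart \<Rightarrow> 'm \<Rightarrow> 'e \<Rightarrow> ('m, 'e) tvec" where
  "tvec_of A c x a = (\<lambda>d. if d \<in> A \<and> x \<in> cdom d
     then frechet_derivative (crd d \<circ> cinv c) (at (crd c x)) a else 0)"

lemma tspaceI:
  assumes "\<And>c. \<not> (c \<in> A \<and> x \<in> cdom c) \<Longrightarrow> v c = 0"
    and "\<And>c d. c \<in> A \<Longrightarrow> x \<in> cdom c \<Longrightarrow> d \<in> A \<Longrightarrow> x \<in> cdom d \<Longrightarrow>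
      v d = frechet_derivative (crd d \<circ> cinv c) (at (crd c x)) (v c)"
  shows "v \<in> tspace A x"
  unfolding tspace_def using assms by blast

lemma tspace_zero: "v \<in> tspace A x \<Longrightarrow> \<not> (c \<in> A \<and> x \<in> cdom c) \<Longrightarrow> v c = 0"
  unfolding tspace_def by blast

context
  fixes A :: "('m, 'e::euclidean_space) chart set"
  assumes sa: "smooth_atlas A"
begin

lemma atlas_inj: "c \<in> A \<Longrightarrow> inj_on (crd c) (cdom c)"
  using sa by (auto simp: smooth_atlas_def)

lemma cinv_crd [simp]: "c \<in> A \<Longrightarrow> x \<in> cdom c \<Longrightarrow> cinv c (crd c x) = x"
  using atlas_inj by (simp add: inv_into_f_f)

lemma atlas_openin:
  "openin (mtopology A) U \<longleftrightarrow> U \<subseteq> carrier A \<and> (\<forall>c\<in>A. open (crd c ` (U \<inter> cdom c)))"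
  by (rule openin_mtopology) (rule atlas_inj)

lemma atlas_open_overlap: "c \<in> A \<Longrightarrow> d \<in> A \<Longrightarrow> open (crd c ` (cdom c \<inter> cdom d))"
  using sa by (auto simp: smooth_atlas_def)

lemma atlas_open_dom: "c \<in> A \<Longrightarrow> open (crd c ` cdom c)"
  using atlas_open_overlap[of c c] by simp

lemma atlas_smooth: "c \<in> A \<Longrightarrow> d \<in> A \<Longrightarrow> smooth_on (crd c ` (cdom c \<inter> cdom d)) (crd d \<circ> cinv c)"
  using sa by (auto simp: smooth_atlas_def)

lemma openin_cdom: "c \<in> A \<Longrightarrow> openin (mtopology A) (cdom c)"
  using atlas_open_overlap by (auto simp: atlas_openin carrier_def Int_commute)

lemma topspace_mtopology: "topspace (mtopology A) = carrier A"
proof -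
  have "openin (mtopology A) (carrier A)"
    using atlas_open_dom by (auto simp: atlas_openin carrier_def Int_absorb1 SUP_upper)
  moreover have "topspace (mtopology A) \<subseteq> carrier A"
    using atlas_openin openin_topspace by blast
  ultimately show ?thesis using openin_subset by blast
qed

lemma openin_image: "openin (mtopology A) U \<Longrightarrow> c \<in> A \<Longrightarrow> open (crd c ` (U \<inter> cdom c))"
  by (simp add: atlas_openin)

lemma trans_has_derivative:
  assumes "c \<in> A" "d \<in> A" "x \<in> cdom c" "x \<in> cdom d"
  shows "((crd d \<circ> cinv c) has_derivative frechet_derivative (crd d \<circ> cinv c) (at (crd c x))) (at (crd c x))"
    and "linear (frechet_derivative (crd d \<circ> cinv c) (at (crd c x)))"
  using smooth_on_diff[OF atlas_smooth[OF assms(1,2)], of "crd c x"] assms by auto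

lemma rep_change:
  assumes "c \<in> A" "d \<in> A" "x \<in> cdom c" "x \<in> cdom d"
    and "((\<lambda>z. h (cinv c z)) has_derivative L) (at (crd c x))"
  shows "((\<lambda>z. h (cinv d z)) has_derivative
    (\<lambda>a. L (frechet_derivative (crd c \<circ> cinv d) (at (crd d x)) a))) (at (crd d x))"
proof -
  have e: "(crd c \<circ> cinv d) (crd d x) = crd c x" using assms by simp
  have "((\<lambda>z. h (cinv c ((crd c \<circ> cinv d) z))) has_derivative
    (\<lambda>a. L (frechet_derivative (crd c \<circ> cinv d) (at (crd d x)) a))) (at (crd d x))"
    using diff_chain_at[OF trans_has_derivative(1)[OF assms(2,1,4,3)], of "\<lambda>z. h (cinv c z)" L] assms(5)
    unfolding e by (simp add: o_def)
  then show ?thesis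
    by (rule has_derivative_transform_within_open[OF _ atlas_open_overlap[OF assms(2,1)]])
      (use assms in auto)
qed

text \<open>The cocycle rule, obtained from \<open>rep_change\<close> for the function
  \<open>crd e\<close>; it is what makes \<open>tvec_of\<close> obey the transformation law of
  tangent vectors.\<close>

lemma trans_compose:
  assumes "c \<in> A" "d \<in> A" "e \<in> A" "x \<in> cdom c" "x \<in> cdom d" "x \<in> cdom e"
  shows "frechet_derivative (crd e \<circ> cinv d) (at (crd d x)) a =
    frechet_derivative (crd e \<circ> cinv c) (at (crd c x))
      (frechet_derivative (crd c \<circ> cinv d) (at (crd d x)) a)"
proof -
  have "((\<lambda>z. crd e (cinv c z)) has_derivative frechet_derivative (crd e \<circ> cinv c) (at (crd c x))) (at (crd c x))"
    using trans_has_derivative(1)[OF assms(1,3,4,6)] by (simp add: o_def)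
  from frechet_derivative_at[OF rep_change[OF assms(1,2,4,5) this]]
  show ?thesis by (simp add: o_def fun_eq_iff)
qed

lemma trans_id:
  assumes "c \<in> A" "x \<in> cdom c"
  shows "frechet_derivative (crd c \<circ> cinv c) (at (crd c x)) a = a"
proof -
  have "((crd c \<circ> cinv c) has_derivative (\<lambda>a. a)) (at (crd c x))"
    by (rule has_derivative_transform_within_open[OF has_derivative_ident atlas_open_dom[OF assms(1)]])
      (use assms in auto)
  from frechet_derivative_at[OF this] show ?thesis by metis
qed

lemma tvec_of_self [simp]: "c \<in> A \<Longrightarrow> x \<in> cdom c \<Longrightarrow> tvec_of A c x a c = a"
  by (simp add: tvec_of_def trans_id)

lemma tvec_of_tspace: "c \<in> A \<Longrightarrow> x \<in> cdom c \<Longrightarrow> tvec_of A c x a \<in> tspace A x"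
  by (rule tspaceI) (auto simp: tvec_of_def intro: trans_compose)

lemma tspace_trans:
  "v \<in> tspace A x \<Longrightarrow> c \<in> A \<Longrightarrow> d \<in> A \<Longrightarrow> x \<in> cdom c \<Longrightarrow> x \<in> cdom d \<Longrightarrow>
    v d = frechet_derivative (crd d \<circ> cinv c) (at (crd c x)) (v c)"
  unfolding tspace_def by blast

lemma tspace_eq_tvec_of:
  assumes "v \<in> tspace A x" "c \<in> A" "x \<in> cdom c"
  shows "tvec_of A c x (v c) = v"
proof
  fix d
  show "tvec_of A c x (v c) d = v d"
    using tspace_trans[OF assms(1,2) _ assms(3), of d] tspace_zero[OF assms(1), of d]
    by (auto simp: tvec_of_def)
qed

lemma tspace_eqI:
  "v \<in> tspace A x \<Longrightarrow> w \<in> tspace A x \<Longrightarrow> c \<in> A \<Longrightarrow> x \<in> cdom c \<Longrightarrow> v c = w c \<Longrightarrow> v = w"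
  by (metis tspace_eq_tvec_of)

lemma tvec_of_linear:
  assumes "c \<in> A" "x \<in> cdom c"
  shows "tvec_of A c x (a + b) = tvec_of A c x a + tvec_of A c x b"
    "tvec_of A c x (r *\<^sub>R a) = tscale r (tvec_of A c x a)"
    "tvec_of A c x 0 = 0"
  using trans_has_derivative(2)[OF assms(1) _ assms(2)]
  by (auto simp: tvec_of_def tscale_def linear_add linear_scale linear_0 intro!: ext)

lemma tspace_add: "u \<in> tspace A x \<Longrightarrow> v \<in> tspace A x \<Longrightarrow> u + v \<in> tspace A x"
  by (rule tspaceI)
    (simp_all add: tspace_zero linear_add[OF trans_has_derivative(2)] tspace_trans[symmetric])

lemma tspace_diff: "u \<in> tspace A x \<Longrightarrow> v \<in> tspace A x \<Longrightarrow> u - v \<in> tspace A x"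
  by (rule tspaceI)
    (simp_all add: tspace_zero linear_diff[OF trans_has_derivative(2)] tspace_trans[symmetric])

lemma tspace_scale: "u \<in> tspace A x \<Longrightarrow> tscale r u \<in> tspace A x"
  unfolding tscale_def
  by (rule tspaceI)
    (simp_all add: tspace_zero linear_scale[OF trans_has_derivative(2)] tspace_trans[symmetric])

lemma tspace_0: "0 \<in> tspace A x"
  by (rule tspaceI) (simp_all add: linear_0[OF trans_has_derivative(2)])

lemma tspace_sum: "(\<And>i. i \<in> I \<Longrightarrow> f i \<in> tspace A x) \<Longrightarrow> (\<Sum>i\<in>I. f i) \<in> tspace A x"
  by (induction I rule: infinite_finite_induct) (auto intro: tspace_add tspace_0)

lemma chart_at_props:
  assumes "c \<in> A" "x \<in> cdom c"
  shows "chart_at A x \<in> A" "x \<in> cdom (chart_at A x)"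
  using someI[of "\<lambda>c. c \<in> A \<and> x \<in> cdom c" c] assms by (auto simp: chart_at_def)

text \<open>\<open>dir_deriv\<close> and \<open>tmap\<close> are defined through the chart picked by
  \<open>chart_at\<close>. The transformation law of \<open>v\<close> absorbs the change to any
  other chart, so that choice never has to be inspected again.\<close>

lemma chart_at_deriv:
  assumes "c \<in> A" "x \<in> cdom c" "v \<in> tspace A x"
    and "((\<lambda>z. h (cinv c z)) has_derivative L) (at (crd c x))"
  shows "frechet_derivative (h \<circ> cinv (chart_at A x)) (at (crd (chart_at A x) x)) (v (chart_at A x)) = L (v c)"
proof -
  note p = chart_at_props[OF assms(1,2)]
  from frechet_derivative_at[OF rep_change[OF assms(1) p(1) assms(2) p(2) assms(4)]]
  show ?thesis using tspace_trans[OF assms(3) p(1) assms(1) p(2) assms(2)]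
    by (simp add: o_def fun_eq_iff)
qed

lemma dir_deriv_eq:
  assumes "c \<in> A" "x \<in> cdom c" "v \<in> tspace A x"
    and "((\<lambda>z. h (cinv c z)) has_derivative L) (at (crd c x))"
  shows "dir_deriv A x v h = L (v c)"
  using chart_at_deriv[OF assms] by (simp add: dir_deriv_def Let_def)

lemma tmap_eq:
  assumes "c \<in> A" "x \<in> cdom c" "v \<in> tspace A x" "d \<in> B" "F x \<in> cdom d"
    and "((\<lambda>z. crd d (F (cinv c z))) has_derivative L) (at (crd c x))"
  shows "tmap A B F x v d = L (v c)"
  using chart_at_deriv[OF assms(1-3), of "crd d \<circ> F"] assms
  by (simp add: tmap_def Let_def o_def)

lemma carrierE: assumes "x \<in> carrier A" obtains c where "c \<in> A" "x \<in> cdom c"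
  using assms by (auto simp: carrier_def)

end

section \<open>Smooth maps\<close>

context
  fixes A :: "('a, 'e::euclidean_space) chart set" and B :: "('b, 'f::euclidean_space) chart set"
    and F :: "'a \<Rightarrow> 'b"
  assumes saA: "smooth_atlas A" and saB: "smooth_atlas B" and sm: "smooth_map A B F"
begin

lemma smooth_map_carrier: "c \<in> A \<Longrightarrow> x \<in> cdom c \<Longrightarrow> F x \<in> carrier B"
proof -
  assume *: "c \<in> A" "x \<in> cdom c"
  have "F \<in> topspace (mtopology A) \<rightarrow> topspace (mtopology B)"
    using sm by (auto simp: smooth_map_def continuous_map)
  then show ?thesis
    using * by (auto simp: topspace_mtopology[OF saA] topspace_mtopology[OF saB] carrier_def)
qed

lemma openin_preimage:
  assumes "openin (mtopology A) U" "d \<in> B"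
  shows "openin (mtopology A) {x \<in> U. F x \<in> cdom d}"
proof -
  have "openin (mtopology A) {x \<in> topspace (mtopology A). F x \<in> cdom d}"
    using sm openin_cdom[OF saB assms(2)] by (auto simp: smooth_map_def continuous_map)
  then have "openin (mtopology A) (U \<inter> {x \<in> topspace (mtopology A). F x \<in> cdom d})"
    using assms(1) by blast
  moreover have "U \<inter> {x \<in> topspace (mtopology A). F x \<in> cdom d} = {x \<in> U. F x \<in> cdom d}"
    using openin_subset[OF assms(1)] by auto
  ultimately show ?thesis by simp
qed

lemma open_preimage:
  assumes "openin (mtopology A) U" "c \<in> A" "d \<in> B"
  shows "open (crd c ` {x \<in> U \<inter> cdom c. F x \<in> cdom d})"
proof -
  have "{x \<in> U \<inter> cdom c. F x \<in> cdom d} = {x \<in> U. F x \<in> cdom d} \<inter> cdom c" by auto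
  then show ?thesis
    using openin_image[OF saA openin_preimage[OF assms(1,3)] assms(2)] by simp
qed

lemma open_preimage_dom:
  assumes "c \<in> A" "d \<in> B"
  shows "open (crd c ` {x \<in> cdom c. F x \<in> cdom d})"
  using open_preimage[OF openin_cdom[OF saA assms(1)] assms] by simp

lemma smooth_map_rep:
  assumes "c \<in> A" "d \<in> B"
  shows "smooth_on (crd c ` {x \<in> cdom c. F x \<in> cdom d}) (\<lambda>z. crd d (F (cinv c z)))"
  using sm assms by (simp add: smooth_map_def o_def)

lemma smooth_map_has_derivative:
  assumes "c \<in> A" "d \<in> B" "x \<in> cdom c" "F x \<in> cdom d"
  shows "((\<lambda>z. crd d (F (cinv c z))) has_derivative
      frechet_derivative (\<lambda>z. crd d (F (cinv c z))) (at (crd c x))) (at (crd c x))"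
    and "linear (frechet_derivative (\<lambda>z. crd d (F (cinv c z))) (at (crd c x)))"
  using smooth_on_diff[OF smooth_map_rep[OF assms(1,2)], of "crd c x"] assms by auto

lemma tmap_coord:
  assumes "c \<in> A" "d \<in> B" "x \<in> cdom c" "F x \<in> cdom d" "v \<in> tspace A x"
  shows "tmap A B F x v d = frechet_derivative (\<lambda>z. crd d (F (cinv c z))) (at (crd c x)) (v c)"
  using tmap_eq[OF saA assms(1,3,5,2,4) smooth_map_has_derivative(1)[OF assms(1-4)]] .

lemma tmap_tspace:
  assumes "c \<in> A" "x \<in> cdom c" "v \<in> tspace A x"
  shows "tmap A B F x v \<in> tspace B (F x)"
proof -
  have "tmap A B F x v e = frechet_derivative (crd e \<circ> cinv d) (at (crd d (F x))) (tmap A B F x v d)"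
    if d: "d \<in> B" "F x \<in> cdom d" and e: "e \<in> B" "F x \<in> cdom e" for d e
  proof -
    let ?L = "frechet_derivative (\<lambda>z. crd d (F (cinv c z))) (at (crd c x))"
    have "((\<lambda>z. (crd e \<circ> cinv d) (crd d (F (cinv c z)))) has_derivative
      (\<lambda>a. frechet_derivative (crd e \<circ> cinv d) (at (crd d (F x))) (?L a))) (at (crd c x))"
      using diff_chain_at[OF smooth_map_has_derivative(1)[OF assms(1) d(1) assms(2) d(2)],
        of "crd e \<circ> cinv d" "frechet_derivative (crd e \<circ> cinv d) (at (crd d (F x)))"]
        trans_has_derivative(1)[OF saB d(1) e(1) d(2) e(2)] cinv_crd[OF saA assms(1,2)]
      by (simp add: o_def)
    then have "((\<lambda>z. crd e (F (cinv c z))) has_derivative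
      (\<lambda>a. frechet_derivative (crd e \<circ> cinv d) (at (crd d (F x))) (?L a))) (at (crd c x))"
      by (rule has_derivative_transform_within_open[OF _ open_preimage_dom[OF assms(1) d(1)]])
        (use assms d e cinv_crd[OF saA] cinv_crd[OF saB] in auto)
    from tmap_eq[OF saA assms e(1,2) this] show ?thesis
      using tmap_coord[OF assms(1) d(1) assms(2) d(2) assms(3)] by simp
  qed
  then show ?thesis by (intro tspaceI) (simp add: tmap_def, blast)
qed

end

lemma smooth_map_ident:
  assumes "smooth_atlas A"
  shows "smooth_map A A (\<lambda>x. x)"
  using assms continuous_map_id[of "mtopology A"]
  by (auto simp: smooth_map_def smooth_atlas_def id_def Int_def o_def)

section \<open>Connections in coordinates\<close>

lemma tscale_apply [simp]: "tscale r v c = r *\<^sub>R v c"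
  by (simp add: tscale_def)

lemma Ck_on_frechet_comp:
  fixes m :: "'a::euclidean_space \<Rightarrow> 'b::euclidean_space" and h :: "'b \<Rightarrow> 'c::real_normed_vector"
  assumes "open S" "open T" "m ` S \<subseteq> T" "Ck_on k S m" "Ck_on (Suc k) T h" "Ck_on k S w"
  shows "Ck_on k S (\<lambda>z. frechet_derivative h (at (m z)) (w z))"
proof -
  have "Ck_on k S (\<lambda>z. \<Sum>b\<in>Basis. (w z \<bullet> b) *\<^sub>R frechet_derivative h (at (m z)) b)"
    using assms(5)
    by (intro Ck_on_sum Ck_on_scaleR Ck_on_linear_comp[OF bounded_linear_inner_left]
        Ck_on_compose[OF assms(1-4)] assms) auto
  moreover have "(\<Sum>b\<in>Basis. (w z \<bullet> b) *\<^sub>R frechet_derivative h (at (m z)) b) =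
      frechet_derivative h (at (m z)) (w z)" if "z \<in> S" for z
    using linear_euclidean_expand[OF Ck_on_Suc_D(3)[OF assms(5)], of "m z" "w z"] that assms(3) by auto
  ultimately show ?thesis
    using Ck_on_cong[OF assms(1)] by (metis (no_types, lifting))
qed

lemma smooth_on_compose:
  fixes h :: "'a::euclidean_space \<Rightarrow> 'b::euclidean_space" and h' :: "'b \<Rightarrow> 'c::real_normed_vector"
  assumes "open S" "open T" "h ` S \<subseteq> T" "smooth_on S h" "smooth_on T h'"
  shows "smooth_on S (\<lambda>x. h' (h x))"
  using Ck_on_compose[OF assms(1-3)] assms(4,5) by (auto simp: smooth_on_def)

lemma sections_along_tspace: "Y \<in> sections_along A B F U \<Longrightarrow> x \<in> U \<Longrightarrow> Y x \<in> tspace B (F x)"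
  unfolding sections_along_def by blast

lemma sections_along_smooth:
  assumes "Y \<in> sections_along A B F U" "c \<in> A" "d \<in> B"
  shows "smooth_on (crd c ` {x \<in> U \<inter> cdom c. F x \<in> cdom d}) (\<lambda>z. Y (cinv c z) d)"
  using assms unfolding sections_along_def by blast

lemma sections_alongI:
  assumes "\<And>x. x \<in> U \<Longrightarrow> Y x \<in> tspace B (F x)"
    and "\<And>c d. c \<in> A \<Longrightarrow> d \<in> B \<Longrightarrow>
      smooth_on (crd c ` {x \<in> U \<inter> cdom c. F x \<in> cdom d}) (\<lambda>z. Y (cinv c z) d)"
  shows "Y \<in> sections_along A B F U"
  unfolding sections_along_def by (intro CollectI conjI ballI; rule assms; assumption)

lemma sections_along_subset:
  assumes "Y \<in> sections_along A B F U" "U' \<subseteq> U"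
  shows "Y \<in> sections_along A B F U'"
proof (rule sections_alongI)
  show "Y x \<in> tspace B (F x)" if "x \<in> U'" for x
    using sections_along_tspace[OF assms(1)] assms(2) that by auto
  show "smooth_on (crd c ` {x \<in> U' \<inter> cdom c. F x \<in> cdom d}) (\<lambda>z. Y (cinv c z) d)"
    if "c \<in> A" "d \<in> B" for c d
    by (rule smooth_on_subset[OF sections_along_smooth[OF assms(1) that]]) (use assms(2) in auto)
qed

text \<open>The connection matrix of the bundle pulled back along \<open>F\<close>, in the frame
  \<open>tvec_of B d (F y) b\<close>: \<open>a\<close> is the direction, and linearity in the vector
  \<open>w\<close> is built in. For \<open>F\<close> the identity and \<open>d = c\<close> these are
  the classical Christoffel symbols.\<close>

definition christoffel ::
  "('a, 'e::euclidean_space) chart set \<Rightarrow> ('b, 'f::euclidean_space) chart set \<Rightarrow> ('a \<Rightarrow> 'b) \<Rightarrow>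
    ('a \<Rightarrow> ('a, 'e) tvec \<Rightarrow> ('a \<Rightarrow> ('b, 'f) tvec) \<Rightarrow> ('b, 'f) tvec) \<Rightarrow>
    ('a, 'e) chart \<Rightarrow> ('b, 'f) chart \<Rightarrow> 'e \<Rightarrow> 'e \<Rightarrow> 'f \<Rightarrow> 'f" where
  "christoffel A B F DF c d z a w =
     (\<Sum>b\<in>Basis. (w \<bullet> b) *\<^sub>R
        DF (cinv c z) (tvec_of A c (cinv c z) a) (\<lambda>y. tvec_of B d (F y) b) d)"

context
  fixes A :: "('a, 'e::euclidean_space) chart set" and B :: "('b, 'f::euclidean_space) chart set"
    and F :: "'a \<Rightarrow> 'b"
  assumes saA: "smooth_atlas A" and saB: "smooth_atlas B" and sm: "smooth_map A B F"
begin

text \<open>Produces sections with prescribed coordinates \<open>W\<close>: the frame sections, and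
  later the non-constant field that realises a horizontal vector. In any other pair of charts the
  coordinates are a transition derivative applied to \<open>W\<close>, hence smooth.\<close>

lemma section_of_coord:
  assumes c: "c \<in> A" and d: "d \<in> B" and U: "openin (mtopology A) U" "U \<subseteq> cdom c"
    and Fd: "\<And>x. x \<in> U \<Longrightarrow> F x \<in> cdom d" and W: "smooth_on (crd c ` U) W"
  shows "(\<lambda>y. tvec_of B d (F y) (W (crd c y))) \<in> sections_along A B F U"
proof (rule sections_alongI)
  show "tvec_of B d (F x) (W (crd c x)) \<in> tspace B (F x)" if "x \<in> U" for x
    using tvec_of_tspace[OF saB d Fd[OF that]] .
next
  fix c' d' assume c': "c' \<in> A" and d': "d' \<in> B"
  let ?S = "crd c' ` {x \<in> U \<inter> cdom c'. F x \<in> cdom d'}"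
  let ?T = "crd d ` (cdom d \<inter> cdom d')"
  have S: "open ?S" by (rule open_preimage[OF saA saB sm U(1) c' d'])
  have UU: "crd c ` (U \<inter> cdom c) = crd c ` U" using U(2) by (simp add: Int_absorb2)
  have oU: "open (crd c ` U)" using openin_image[OF saA U(1) c] UU by simp
  have m: "smooth_on ?S (\<lambda>z. crd d (F (cinv c' z)))"
    by (rule smooth_on_subset[OF smooth_map_rep[OF saA saB sm c' d]]) (use Fd in auto)
  have mT: "(\<lambda>z. crd d (F (cinv c' z))) ` ?S \<subseteq> ?T"
    using Fd cinv_crd[OF saA c'] by auto
  have t: "smooth_on ?S (\<lambda>z. crd c (cinv c' z))"
    using smooth_on_subset[OF atlas_smooth[OF saA c' c], of ?S] U(2) by (auto simp: o_def)
  have W': "smooth_on ?S (\<lambda>z. W (crd c (cinv c' z)))"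
    by (rule smooth_on_compose[OF S oU _ t W]) (use cinv_crd[OF saA c'] in auto)
  have "Ck_on k ?S (\<lambda>z. frechet_derivative (crd d' \<circ> cinv d) (at (crd d (F (cinv c' z))))
      (W (crd c (cinv c' z))))" for k
    by (rule Ck_on_frechet_comp[OF S atlas_open_overlap[OF saB d d'] mT])
      (rule smooth_on_Ck, rule m atlas_smooth[OF saB d d'] W')+
  then have "smooth_on ?S (\<lambda>z. frechet_derivative (crd d' \<circ> cinv d) (at (crd d (F (cinv c' z))))
      (W (crd c (cinv c' z))))"
    by (simp add: smooth_on_def)
  moreover have "tvec_of B d (F (cinv c' z)) (W (crd c (cinv c' z))) d' =
      frechet_derivative (crd d' \<circ> cinv d) (at (crd d (F (cinv c' z)))) (W (crd c (cinv c' z)))"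
    if "z \<in> ?S" for z
    using that cinv_crd[OF saA c'] d' by (auto simp: tvec_of_def)
  ultimately show "smooth_on ?S (\<lambda>z. tvec_of B d (F (cinv c' z)) (W (crd c (cinv c' z))) d')"
    using smooth_on_cong[OF S] by (metis (no_types, lifting))
qed

lemma frame_section:
  assumes "c \<in> A" "d \<in> B" "openin (mtopology A) U" "U \<subseteq> cdom c" "\<And>x. x \<in> U \<Longrightarrow> F x \<in> cdom d"
  shows "(\<lambda>y. tvec_of B d (F y) b) \<in> sections_along A B F U"
  using section_of_coord[OF assms, of "\<lambda>_. b"] by (simp add: smooth_on_def)

lemma sections_along_zero: "(\<lambda>y. 0) \<in> sections_along A B F U"
  by (rule sections_alongI) (auto simp: smooth_on_def tspace_0[OF saB])

lemma sections_along_add: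
  assumes "openin (mtopology A) U" "Y \<in> sections_along A B F U" "Z \<in> sections_along A B F U"
  shows "(\<lambda>y. Y y + Z y) \<in> sections_along A B F U"
proof (rule sections_alongI)
  show "Y x + Z x \<in> tspace B (F x)" if "x \<in> U" for x
    using tspace_add[OF saB sections_along_tspace[OF assms(2) that] sections_along_tspace[OF assms(3) that]] .
  show "smooth_on (crd c ` {x \<in> U \<inter> cdom c. F x \<in> cdom d}) (\<lambda>z. (Y (cinv c z) + Z (cinv c z)) d)"
    if "c \<in> A" "d \<in> B" for c d
    using sections_along_smooth[OF assms(2) that] sections_along_smooth[OF assms(3) that]
      Ck_on_add[OF open_preimage[OF saA saB sm assms(1) that]]
    unfolding smooth_on_def plus_fun_apply by blast
qed

lemma sections_along_scale:
  assumes "openin (mtopology A) U" "Y \<in> sections_along A B F U" "smooth_fun A U h"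
  shows "(\<lambda>y. tscale (h y) (Y y)) \<in> sections_along A B F U"
proof (rule sections_alongI)
  show "tscale (h x) (Y x) \<in> tspace B (F x)" if "x \<in> U" for x
    using tspace_scale[OF saB sections_along_tspace[OF assms(2) that]] .
  show "smooth_on (crd c ` {x \<in> U \<inter> cdom c. F x \<in> cdom d}) (\<lambda>z. tscale (h (cinv c z)) (Y (cinv c z)) d)"
    if "c \<in> A" "d \<in> B" for c d
  proof -
    have "crd c ` {x \<in> U \<inter> cdom c. F x \<in> cdom d} \<subseteq> crd c ` (U \<inter> cdom c)" by auto
    then have "Ck_on k (crd c ` {x \<in> U \<inter> cdom c. F x \<in> cdom d}) (\<lambda>z. h (cinv c z))" for k
      using assms(3) that(1) Ck_on_subset unfolding smooth_fun_def Ck_fun_def o_def by blast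
    then show ?thesis
      using sections_along_smooth[OF assms(2) that]
        Ck_on_scaleR[OF open_preimage[OF saA saB sm assms(1) that]]
      unfolding smooth_on_def tscale_def by blast
  qed
qed

lemma sections_along_sum:
  assumes "openin (mtopology A) U" "\<And>i. i \<in> I \<Longrightarrow> Z i \<in> sections_along A B F U"
  shows "(\<lambda>y. \<Sum>i\<in>I. Z i y) \<in> sections_along A B F U"
  using assms(2)
  by (induction I rule: infinite_finite_induct)
    (auto intro: sections_along_add[OF assms(1)] sections_along_zero)

end

lemma coord_field:
  assumes "smooth_atlas A" "c \<in> A" "openin (mtopology A) U" "U \<subseteq> cdom c" "smooth_on (crd c ` U) W"
  shows "(\<lambda>y. tvec_of A c y (W (crd c y))) \<in> vector_fields A U"
  unfolding vector_fields_def
  by (rule section_of_coord[OF assms(1,1) smooth_map_ident[OF assms(1)] assms(2,2,3,4)])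
    (use assms in auto)

lemma const_field:
  assumes "smooth_atlas A" "c \<in> A" "openin (mtopology A) U" "U \<subseteq> cdom c"
  shows "(\<lambda>y. tvec_of A c y a) \<in> vector_fields A U"
  using coord_field[OF assms, of "\<lambda>_. a"] by (simp add: smooth_on_def)

context
  fixes A :: "('a, 'e::euclidean_space) chart set" and B :: "('b, 'f::euclidean_space) chart set"
    and F :: "'a \<Rightarrow> 'b" and DF
  assumes saA: "smooth_atlas A" and saB: "smooth_atlas B" and sm: "smooth_map A B F"
    and conn: "connection_along A B F DF"
begin

context
  fixes U Y
  assumes U: "openin (mtopology A) U" and Y: "Y \<in> sections_along A B F U"
begin

lemmas conn_unfold = bspec[OF mp[OF spec[OF conn[unfolded connection_along_def]] U] Y]

lemma conn_section: "X \<in> vector_fields A U \<Longrightarrow> (\<lambda>x. DF x (X x) Y) \<in> sections_along A B F U"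
  by (rule bspec[OF conjunct1[OF conn_unfold]])

context
  fixes x
  assumes x: "x \<in> U"
begin

lemmas conn_unfold_at = spec[OF bspec[OF bspec[OF bspec[OF conjunct2[OF conn_unfold] x]]]]

lemma conn_tspace: "v \<in> tspace A x \<Longrightarrow> DF x v Y \<in> tspace B (F x)"
  by (rule conjunct1[OF conn_unfold_at]) assumption+

lemma conn_add_dir:
  assumes "u \<in> tspace A x" "v \<in> tspace A x"
  shows "DF x (u + v) Y = DF x u Y + DF x v Y"
  using conn_unfold_at[OF assms, of 0] by (elim conjE)

lemma conn_scale_dir:
  assumes "v \<in> tspace A x"
  shows "DF x (tscale r v) Y = tscale r (DF x v Y)"
  using conn_unfold_at[OF assms assms, of r] by (elim conjE)

lemma conn_add:
  assumes "v \<in> tspace A x" "Z \<in> sections_along A B F U"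
  shows "DF x v (\<lambda>y. Y y + Z y) = DF x v Y + DF x v Z"
  using conn_unfold_at[OF assms(1,1), of 0] assms(2) by (elim conjE) (erule bspec)

lemma conn_leibniz:
  assumes "v \<in> tspace A x" "smooth_fun A U h"
  shows "DF x v (\<lambda>y. tscale (h y) (Y y)) = tscale (dir_deriv A x v h) (Y x) + tscale (h x) (DF x v Y)"
  using conn_unfold_at[OF assms(1,1), of 0] assms(2) by (elim conjE allE[of _ h] impE)

lemma conn_local:
  assumes "v \<in> tspace A x" "\<And>y. y \<in> U \<Longrightarrow> Z y = Y y"
  shows "DF x v Z = DF x v Y"
proof -
  have "\<forall>y\<in>U. Z y = Y y" using assms(2) by (intro ballI)
  then show ?thesis
    using conn_unfold_at[OF assms(1,1), of 0] by (elim conjE allE[of _ Z] impE)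
qed

end

end

lemma conn_sum:
  assumes "openin (mtopology A) U" "x \<in> U" "v \<in> tspace A x"
    and "\<And>i. i \<in> I \<Longrightarrow> Z i \<in> sections_along A B F U" and "finite I"
  shows "DF x v (\<lambda>y. \<Sum>i\<in>I. Z i y) = (\<Sum>i\<in>I. DF x v (Z i))"
  using assms(5,4)
proof (induction I)
  case empty
  \<comment> \<open>Additivity at \<open>0 + 0\<close> forces the derivative of the zero section to
    vanish.\<close>
  have "DF x v (\<lambda>y. 0 + 0) = DF x v (\<lambda>y. 0) + DF x v (\<lambda>y. 0)"
    by (rule conn_add[OF assms(1) sections_along_zero[OF saA saB sm] assms(2,3) sections_along_zero[OF saA saB sm]])
  then show ?case by (simp only: add_0_left sum.empty add_cancel_right_left)
next
  case (insert i I)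
  have "DF x v (\<lambda>y. Z i y + (\<Sum>i\<in>I. Z i y)) = DF x v (Z i) + DF x v (\<lambda>y. \<Sum>i\<in>I. Z i y)"
    using insert.prems
    by (intro conn_add[OF assms(1) _ assms(2,3)] sections_along_sum[OF saA saB sm assms(1)]) auto
  moreover have "DF x v (\<lambda>y. \<Sum>i\<in>I. Z i y) = (\<Sum>i\<in>I. DF x v (Z i))"
    using insert by blast
  ultimately show ?case using insert.hyps by (simp only: sum.insert not_False_eq_True)
qed

text \<open>Near \<open>x\<close> the section is a combination of frame sections whose coefficients
  are its coordinates. The Leibniz rule splits the derivative into that of the coefficients and that
  of the frame, and the latter is the Christoffel term.\<close>

lemma conn_coord:
  assumes U: "openin (mtopology A) U" and Y: "Y \<in> sections_along A B F U" and x: "x \<in> U"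
    and c: "c \<in> A" "x \<in> cdom c" and d: "d \<in> B" "F x \<in> cdom d" and v: "v \<in> tspace A x"
  shows "DF x v Y d = frechet_derivative (\<lambda>z. Y (cinv c z) d) (at (crd c x)) (v c) +
    christoffel A B F DF c d (crd c x) (v c) (Y x d)"
proof -
  \<comment> \<open>The frame exists only where both charts are available; locality of the
    connection allows the restriction.\<close>
  define U' where "U' = {y \<in> U \<inter> cdom c. F y \<in> cdom d}"
  have U': "openin (mtopology A) U'" "U' \<subseteq> U" "U' \<subseteq> cdom c" "x \<in> U'"
    using openin_preimage[OF saA saB sm openin_Int[OF U openin_cdom[OF saA c(1)]] d(1)] x c d
    by (auto simp: U'_def)
  have Fd: "F y \<in> cdom d" if "y \<in> U'" for y using that by (simp add: U'_def)
  have Y': "Y \<in> sections_along A B F U'" by (rule sections_along_subset[OF Y U'(2)])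
  let ?E = "\<lambda>b y. tvec_of B d (F y) b"
  let ?h = "\<lambda>b y. Y y d \<bullet> b"
  have E: "?E b \<in> sections_along A B F U'" for b
    by (rule frame_section[OF saA saB sm c(1) d(1) U'(1,3) Fd])
  have h: "smooth_fun A U' (?h b)" for b
    unfolding smooth_fun_def Ck_fun_def
  proof (intro allI ballI)
    fix k c' assume c': "c' \<in> A"
    have e: "crd c' ` {x \<in> U' \<inter> cdom c'. F x \<in> cdom d} = crd c' ` (U' \<inter> cdom c')"
      using Fd by (auto intro!: image_cong)
    show "Ck_on k (crd c' ` (U' \<inter> cdom c')) (?h b \<circ> cinv c')"
      using Ck_on_linear_comp[OF bounded_linear_inner_left openin_image[OF saA U'(1) c']]
        sections_along_smooth[OF Y' c' d(1)]
      unfolding e smooth_on_def o_def by blast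
  qed
  have rep: "Y y = (\<Sum>b\<in>Basis. tscale (?h b y) (?E b y))" if "y \<in> U'" for y
  proof (rule tspace_eqI[OF saB sections_along_tspace[OF Y' that] _ d(1) Fd[OF that]])
    show "(\<Sum>b\<in>Basis. tscale (?h b y) (?E b y)) \<in> tspace B (F y)"
      using tvec_of_tspace[OF saB d(1) Fd[OF that]]
      by (intro tspace_sum[OF saB] tspace_scale[OF saB])
    show "Y y d = (\<Sum>b\<in>Basis. tscale (?h b y) (?E b y)) d"
      by (simp add: fun_sum_apply tscale_def tvec_of_self[OF saB d(1) Fd[OF that]] euclidean_representation)
  qed
  let ?Y = "\<lambda>y. \<Sum>b\<in>Basis. tscale (?h b y) (?E b y)"
  have Z: "(\<lambda>y. tscale (?h b y) (?E b y)) \<in> sections_along A B F U'" for b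
    by (rule sections_along_scale[OF saA saB sm U'(1) E h])
  have diff: "((\<lambda>z. Y (cinv c z) d) has_derivative
      frechet_derivative (\<lambda>z. Y (cinv c z) d) (at (crd c x))) (at (crd c x))"
    by (rule smooth_on_diff(2)[OF sections_along_smooth[OF Y' c(1) d(1)]])
      (use U'(3,4) Fd in auto)
  have dd: "dir_deriv A x v (?h b) = frechet_derivative (\<lambda>z. Y (cinv c z) d) (at (crd c x)) (v c) \<bullet> b" for b
    by (rule dir_deriv_eq[OF saA c v]) (rule has_derivative_inner_left[OF diff])
  have "DF x v Y = DF x v ?Y"
    by (rule conn_local[OF U'(1) sections_along_sum[OF saA saB sm U'(1) Z] U'(4) v]) (rule rep)
  also have "\<dots> = (\<Sum>b\<in>Basis. DF x v (\<lambda>y. tscale (?h b y) (?E b y)))"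
    by (rule conn_sum[OF U'(1,4) v Z]) simp
  also have "\<dots> = (\<Sum>b\<in>Basis. tscale (dir_deriv A x v (?h b)) (?E b x) + tscale (?h b x) (DF x v (?E b)))"
    by (rule sum.cong[OF refl]) (rule conn_leibniz[OF U'(1) E U'(4) v h])
  finally have "DF x v Y d = \<dots> d" by simp
  then show ?thesis
    by (simp add: fun_sum_apply tscale_def tvec_of_self[OF saB d] dd sum.distrib
        euclidean_representation christoffel_def cinv_crd[OF saA c] tspace_eq_tvec_of[OF saA v c])
qed

lemma christoffel_linear_right: "linear (christoffel A B F DF c d z a)"
  by (rule linearI)
    (simp_all add: christoffel_def inner_add_left scaleR_add_left sum.distrib scaleR_sum_right)

lemma christoffel_linear_left:
  assumes "c \<in> A" "d \<in> B" "x \<in> cdom c" "F x \<in> cdom d"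
  shows "linear (\<lambda>a. christoffel A B F DF c d (crd c x) a w)"
proof -
  define U where "U = {y \<in> cdom c. F y \<in> cdom d}"
  have U: "openin (mtopology A) U" "U \<subseteq> cdom c" "x \<in> U"
    using openin_preimage[OF saA saB sm openin_cdom[OF saA assms(1)] assms(2)] assms
    by (auto simp: U_def)
  have E: "(\<lambda>y. tvec_of B d (F y) b) \<in> sections_along A B F U" for b
    by (rule frame_section[OF saA saB sm assms(1,2) U(1,2)]) (simp add: U_def)
  note t = tvec_of_tspace[OF saA assms(1,3)]
  show ?thesis
    by (rule linearI)
      (simp_all add: christoffel_def cinv_crd[OF saA assms(1,3)] tvec_of_linear[OF saA assms(1,3)]
        conn_add_dir[OF U(1) E U(3) t t] conn_scale_dir[OF U(1) E U(3) t]
        scaleR_add_right sum.distrib scaleR_sum_right mult.commute)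
qed

lemma christoffel_smooth:
  assumes "c \<in> A" "d \<in> B"
  shows "smooth_on (crd c ` {x \<in> cdom c. F x \<in> cdom d}) (\<lambda>z. christoffel A B F DF c d z a w)"
proof -
  define U where "U = {y \<in> cdom c. F y \<in> cdom d}"
  have U: "openin (mtopology A) U" "U \<subseteq> cdom c"
    using openin_preimage[OF saA saB sm openin_cdom[OF saA assms(1)] assms(2)] assms
    by (auto simp: U_def)
  have E: "(\<lambda>y. tvec_of B d (F y) b) \<in> sections_along A B F U" for b
    by (rule frame_section[OF saA saB sm assms(1,2) U(1,2)]) (simp add: U_def)
  have X: "(\<lambda>y. tvec_of A c y a) \<in> vector_fields A U"
    by (rule const_field[OF saA assms(1) U])
  have e: "crd c ` {x \<in> U \<inter> cdom c. F x \<in> cdom d} = crd c ` {x \<in> cdom c. F x \<in> cdom d}"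
    by (auto simp: U_def)
  have "Ck_on k (crd c ` {x \<in> cdom c. F x \<in> cdom d})
      (\<lambda>z. DF (cinv c z) (tvec_of A c (cinv c z) a) (\<lambda>y. tvec_of B d (F y) b) d)" for k b
    using sections_along_smooth[OF conn_section[OF U(1) E X] assms] unfolding e smooth_on_def by blast
  then show ?thesis
    unfolding smooth_on_def christoffel_def
    by (intro allI Ck_on_sum Ck_on_scaleR Ck_on_const open_preimage_dom[OF saA saB sm assms])
qed

end

section \<open>Tensor fields in coordinates\<close>

definition multilinear :: "nat \<Rightarrow> ('e::real_vector list \<Rightarrow> 'b::real_vector) \<Rightarrow> bool" where
  "multilinear n T \<longleftrightarrow> (\<forall>us i. length us = n \<longrightarrow> i < n \<longrightarrow> linear (\<lambda>a. T (us[i := a])))"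

lemma multilinearD: "multilinear n T \<Longrightarrow> length us = n \<Longrightarrow> i < n \<Longrightarrow> linear (\<lambda>a. T (us[i := a]))"
  by (simp add: multilinear_def)

lemma multilinear_expand:
  fixes T :: "'e::euclidean_space list \<Rightarrow> 'b::real_vector"
  assumes "multilinear n T" "length us = n" "i < n"
  shows "T (us[i := a]) = (\<Sum>b\<in>Basis. (a \<bullet> b) *\<^sub>R T (us[i := b]))"
  using linear_euclidean_expand[OF multilinearD[OF assms]] .

text \<open>Regularity is required for constant arguments only. Multilinear expansion extends it to
  variable ones, see \<open>tensor_fields_Ck\<close>.\<close>

definition tensor_on ::
  "nat \<Rightarrow> nat \<Rightarrow> 'a::euclidean_space set \<Rightarrow> ('a \<Rightarrow> 'e::euclidean_space list \<Rightarrow> 'b::real_normed_vector) \<Rightarrow> bool" where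
  "tensor_on k n S T \<longleftrightarrow> (\<forall>z\<in>S. multilinear n (T z)) \<and> (\<forall>us. length us = n \<longrightarrow> Ck_on k S (\<lambda>z. T z us))"

lemma tensor_onD:
  assumes "tensor_on k n S T"
  shows "z \<in> S \<Longrightarrow> multilinear n (T z)" "length us = n \<Longrightarrow> Ck_on k S (\<lambda>z. T z us)"
  using assms by (auto simp: tensor_on_def)

lemma tensor_on_le: "tensor_on k n S T \<Longrightarrow> j \<le> k \<Longrightarrow> tensor_on j n S T"
  by (auto simp: tensor_on_def intro: Ck_on_le)

text \<open>The product rules for tensors applied to fields are proved by making one argument after the
  other variable.\<close>

definition mixed :: "nat \<Rightarrow> nat \<Rightarrow> (nat \<Rightarrow> 'a \<Rightarrow> 'e) \<Rightarrow> 'e list \<Rightarrow> 'a \<Rightarrow> 'e list" where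
  "mixed n j X us z = map (\<lambda>i. if i < j then X i z else us ! i) [0..<n]"

lemma length_mixed [simp]: "length (mixed n j X us z) = n"
  by (simp add: mixed_def)

lemma mixed_0: "length us = n \<Longrightarrow> mixed n 0 X us z = us"
  by (auto simp: mixed_def intro: nth_equalityI)

lemma mixed_update: "length us = n \<Longrightarrow> j < n \<Longrightarrow> mixed n j X (us[j := b]) z = (mixed n j X us z)[j := b]"
  by (auto simp: mixed_def nth_list_update intro!: nth_equalityI)

lemma mixed_Suc: "j < n \<Longrightarrow> mixed n (Suc j) X us z = (mixed n j X us z)[j := X j z]"
  by (auto simp: mixed_def nth_list_update intro!: nth_equalityI)

lemma mixed_full: "mixed n n X us z = map (\<lambda>i. X i z) [0..<n]"
  by (auto simp: mixed_def)

lemma tensor_fields_Ck: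
  fixes T :: "'a::euclidean_space \<Rightarrow> 'e::euclidean_space list \<Rightarrow> 'b::real_normed_vector"
  assumes S: "open S" and T: "tensor_on k n S T" and X: "\<And>i. i < n \<Longrightarrow> Ck_on k S (X i)"
  shows "Ck_on k S (\<lambda>z. T z (map (\<lambda>i. X i z) [0..<n]))"
proof -
  have "Ck_on k S (\<lambda>z. T z (mixed n j X us z))" if "j \<le> n" "length us = n" for j us
    using that
  proof (induction j arbitrary: us)
    case 0
    then show ?case using tensor_onD(2)[OF T] by (simp add: mixed_0)
  next
    case (Suc j)
    have "Ck_on k S (\<lambda>z. \<Sum>b\<in>Basis. (X j z \<bullet> b) *\<^sub>R T z (mixed n j X (us[j := b]) z))"
      using Suc.prems
      by (intro Ck_on_sum[OF S] Ck_on_scaleR[OF S] Ck_on_linear_comp[OF bounded_linear_inner_left S] X Suc.IH) auto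
    then show ?case
      by (rule Ck_on_cong[OF S, THEN iffD2, rotated])
        (use Suc.prems in \<open>simp add: mixed_Suc mixed_update multilinear_expand[OF tensor_onD(1)[OF T], of _ _ j "X j _"]\<close>)
  qed
  \<comment> \<open>At \<open>j = n\<close> every entry has been replaced, so any list of length
    \<open>n\<close> serves as the start.\<close>
  from this[of n "replicate n 0"] show ?thesis by (simp add: mixed_full)
qed

lemma tensor_fields_has_derivative:
  fixes T :: "'a::real_normed_vector \<Rightarrow> 'e::euclidean_space list \<Rightarrow> 'b::real_normed_vector"
  assumes S: "open S" "z0 \<in> S" and T: "\<And>z. z \<in> S \<Longrightarrow> multilinear n (T z)"
    and T': "\<And>us. length us = n \<Longrightarrow> ((\<lambda>z. T z us) has_derivative T' us) (at z0)"
    and X: "\<And>i. i < n \<Longrightarrow> (X i has_derivative X' i) (at z0)"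
  defines "us0 \<equiv> map (\<lambda>i. X i z0) [0..<n]"
  shows "((\<lambda>z. T z (map (\<lambda>i. X i z) [0..<n])) has_derivative
    (\<lambda>u. T' us0 u + (\<Sum>i<n. T z0 (us0[i := X' i u])))) (at z0)"
proof -
  \<comment> \<open>Nothing is assumed about how \<open>T'\<close> depends on its list; linearity in
    each slot is inherited from \<open>T\<close> by uniqueness of derivatives.\<close>
  have T'_expand: "T' (us[i := a]) u = (\<Sum>b\<in>Basis. (a \<bullet> b) *\<^sub>R T' (us[i := b]) u)"
    if "length us = n" "i < n" for us i a u
  proof -
    have "((\<lambda>z. \<Sum>b\<in>Basis. (a \<bullet> b) *\<^sub>R T z (us[i := b])) has_derivative
        (\<lambda>u. \<Sum>b\<in>Basis. (a \<bullet> b) *\<^sub>R T' (us[i := b]) u)) (at z0)"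
      using that by (intro has_derivative_sum has_derivative_scaleR_right T') auto
    then have "((\<lambda>z. T z (us[i := a])) has_derivative
        (\<lambda>u. \<Sum>b\<in>Basis. (a \<bullet> b) *\<^sub>R T' (us[i := b]) u)) (at z0)"
      by (rule has_derivative_transform_within_open[OF _ S]) (use multilinear_expand[OF T that] in simp)
    from has_derivative_unique[OF this T'] that show ?thesis by (simp add: fun_eq_iff)
  qed
  have "((\<lambda>z. T z (mixed n j X us z)) has_derivative
    (\<lambda>u. T' (mixed n j X us z0) u + (\<Sum>i<j. T z0 ((mixed n j X us z0)[i := X' i u])))) (at z0)"
    if "j \<le> n" "length us = n" for j us
    using that
  proof (induction j arbitrary: us)
    case 0
    then show ?case using T' by (simp add: mixed_0)
  next
    case (Suc j)
    then have j: "j < n" "length us = n" by auto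
    let ?M = "mixed n j X us z0"
    have "((\<lambda>z. \<Sum>b\<in>Basis. (X j z \<bullet> b) *\<^sub>R T z (mixed n j X (us[j := b]) z)) has_derivative
       (\<lambda>u. \<Sum>b\<in>Basis. (X j z0 \<bullet> b) *\<^sub>R (T' (mixed n j X (us[j := b]) z0) u
           + (\<Sum>i<j. T z0 ((mixed n j X (us[j := b]) z0)[i := X' i u])))
         + (X' j u \<bullet> b) *\<^sub>R T z0 (mixed n j X (us[j := b]) z0))) (at z0)"
      using Suc.prems
      by (intro has_derivative_sum has_derivative_scaleR has_derivative_inner_left X Suc.IH) auto
    then have "((\<lambda>z. T z (mixed n (Suc j) X us z)) has_derivative
       (\<lambda>u. \<Sum>b\<in>Basis. (X j z0 \<bullet> b) *\<^sub>R (T' (mixed n j X (us[j := b]) z0) u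
           + (\<Sum>i<j. T z0 ((mixed n j X (us[j := b]) z0)[i := X' i u])))
         + (X' j u \<bullet> b) *\<^sub>R T z0 (mixed n j X (us[j := b]) z0))) (at z0)"
      by (rule has_derivative_transform_within_open[OF _ S])
        (use j in \<open>simp add: mixed_Suc mixed_update multilinear_expand[OF T, of _ _ j "X j _"]\<close>)
    moreover have "(\<Sum>b\<in>Basis. (X j z0 \<bullet> b) *\<^sub>R (T' (mixed n j X (us[j := b]) z0) u
           + (\<Sum>i<j. T z0 ((mixed n j X (us[j := b]) z0)[i := X' i u])))
         + (X' j u \<bullet> b) *\<^sub>R T z0 (mixed n j X (us[j := b]) z0)) =
       T' (mixed n (Suc j) X us z0) u + (\<Sum>i<Suc j. T z0 ((mixed n (Suc j) X us z0)[i := X' i u]))" for u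
    proof -
      \<comment> \<open>For \<open>i < j\<close> the two updates touch different slots, so they
        commute and the basis expansion in slot \<open>j\<close> folds back.\<close>
      have "(\<Sum>b\<in>Basis. (X j z0 \<bullet> b) *\<^sub>R T z0 (?M[j := b, i := X' i u])) =
          T z0 (?M[j := X j z0, i := X' i u])" if "i < j" for i
        using multilinear_expand[OF T[OF S(2)], of "?M[i := X' i u]" j "X j z0"] that j
        by (simp add: list_update_swap)
      then have "(\<Sum>b\<in>Basis. (X j z0 \<bullet> b) *\<^sub>R (\<Sum>i<j. T z0 (?M[j := b, i := X' i u]))) =
          (\<Sum>i<j. T z0 (?M[j := X j z0, i := X' i u]))"
        unfolding scaleR_sum_right by (subst sum.swap) simp
      moreover have "T z0 (?M[j := X' j u]) = (\<Sum>b\<in>Basis. (X' j u \<bullet> b) *\<^sub>R T z0 (?M[j := b]))"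
        by (rule multilinear_expand[OF T[OF S(2)]]) (use j in simp_all)
      moreover have "T' (?M[j := X j z0]) u = (\<Sum>b\<in>Basis. (X j z0 \<bullet> b) *\<^sub>R T' (?M[j := b]) u)"
        by (rule T'_expand) (use j in simp_all)
      ultimately show ?thesis
        using j by (simp add: mixed_Suc mixed_update sum.distrib scaleR_add_right)
    qed
    ultimately show ?case by simp
  qed
  from this[of n "replicate n 0"] show ?thesis by (simp add: mixed_full us0_def)
qed

text \<open>The classical component formula for a covariant derivative: \<open>\<Lambda>\<close> is
  the connection on the values (zero for real tensors), \<open>\<Gamma>\<close> the one on the
  arguments, and the last entry of the list is the direction.\<close>

definition cov_deriv_coord ::
  "('a::euclidean_space \<Rightarrow> 'a \<Rightarrow> 'a \<Rightarrow> 'a) \<Rightarrow> ('a \<Rightarrow> 'a \<Rightarrow> 'b \<Rightarrow> 'b) \<Rightarrow> ('a \<Rightarrow> 'a list \<Rightarrow> 'b) \<Rightarrow>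
    'a \<Rightarrow> 'a list \<Rightarrow> 'b::euclidean_space" where
  "cov_deriv_coord \<Gamma> \<Lambda> T z us =
     frechet_derivative (\<lambda>z. T z (butlast us)) (at z) (last us)
     + \<Lambda> z (last us) (T z (butlast us))
     - (\<Sum>i<length us - 1. T z ((butlast us)[i := \<Gamma> z (last us) (us ! i)]))"

lemma cov_deriv_coord_snoc:
  "cov_deriv_coord \<Gamma> \<Lambda> T z (us @ [u]) =
     frechet_derivative (\<lambda>z. T z us) (at z) u + \<Lambda> z u (T z us)
     - (\<Sum>i<length us. T z (us[i := \<Gamma> z u (us ! i)]))"
  by (simp add: cov_deriv_coord_def nth_append)

definition symbol_on ::
  "nat \<Rightarrow> 'a::euclidean_space set \<Rightarrow> ('a \<Rightarrow> 'a \<Rightarrow> 'b::euclidean_space \<Rightarrow> 'b) \<Rightarrow> bool" where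
  "symbol_on k S \<Lambda> \<longleftrightarrow> (\<forall>a w. Ck_on k S (\<lambda>z. \<Lambda> z a w)) \<and>
     (\<forall>z\<in>S. (\<forall>a. linear (\<Lambda> z a)) \<and> (\<forall>w. linear (\<lambda>a. \<Lambda> z a w)))"

lemma symbol_onD:
  assumes "symbol_on k S \<Lambda>"
  shows "Ck_on k S (\<lambda>z. \<Lambda> z a w)" "z \<in> S \<Longrightarrow> linear (\<Lambda> z a)" "z \<in> S \<Longrightarrow> linear (\<lambda>a. \<Lambda> z a w)"
  using assms by (auto simp: symbol_on_def)

text \<open>This is why the extension of the arguments does not matter: the product rule creates a
  term with \<open>X' i u\<close> in each slot, and the subtracted covariant derivatives contain the
  same term. What remains depends on the fields only through their values at
  \<open>z\<close>.\<close>

lemma cov_deriv_coord_fields: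
  fixes T :: "'a::euclidean_space \<Rightarrow> 'a list \<Rightarrow> 'b::euclidean_space"
  assumes S: "open S" "z \<in> S" and T: "tensor_on (Suc 0) n S T"
    and X: "\<And>i. i < n \<Longrightarrow> (X i has_derivative X' i) (at z)"
  defines "us \<equiv> map (\<lambda>i. X i z) [0..<n]"
  shows "frechet_derivative (\<lambda>z. T z (map (\<lambda>i. X i z) [0..<n])) (at z) u + \<Lambda> z u (T z us)
      - (\<Sum>i<n. T z (us[i := X' i u + \<Gamma> z u (us ! i)])) = cov_deriv_coord \<Gamma> \<Lambda> T z (us @ [u])"
proof -
  have l: "length us = n" by (simp add: us_def)
  have d: "((\<lambda>z. T z us') has_derivative frechet_derivative (\<lambda>z. T z us') (at z)) (at z)"
    if "length us' = n" for us'
    using Ck_on_Suc_D(2)[OF tensor_onD(2)[OF T that] S(2)] .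
  have "((\<lambda>z. T z (map (\<lambda>i. X i z) [0..<n])) has_derivative
      (\<lambda>u. frechet_derivative (\<lambda>z. T z us) (at z) u + (\<Sum>i<n. T z (us[i := X' i u])))) (at z)"
    unfolding us_def
    by (rule tensor_fields_has_derivative[OF S tensor_onD(1)[OF T] d X])
  then have "frechet_derivative (\<lambda>z. T z (map (\<lambda>i. X i z) [0..<n])) (at z) =
      (\<lambda>u. frechet_derivative (\<lambda>z. T z us) (at z) u + (\<Sum>i<n. T z (us[i := X' i u])))"
    by (rule frechet_derivative_at[symmetric])
  moreover have "T z (us[i := X' i u + \<Gamma> z u (us ! i)]) = T z (us[i := X' i u]) + T z (us[i := \<Gamma> z u (us ! i)])"
    if "i < n" for i
    using linear_add[OF multilinearD[OF tensor_onD(1)[OF T S(2)] l that]] .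
  ultimately show ?thesis
    by (simp add: cov_deriv_coord_snoc l sum.distrib)
qed

lemma linear_cong: "linear f \<Longrightarrow> (\<And>a. g a = f a) \<Longrightarrow> linear g"
  by presburger

text \<open>One order of differentiability is spent on \<open>T\<close>; the symbols need only the
  order that is left. Multilinearity has two cases, an argument of \<open>T\<close> and the new
  direction slot.\<close>

lemma cov_deriv_coord_tensor:
  fixes T :: "'a::euclidean_space \<Rightarrow> 'a list \<Rightarrow> 'b::euclidean_space"
  assumes S: "open S" and T: "tensor_on (Suc k) n S T"
    and \<Gamma>: "symbol_on k S \<Gamma>" and \<Lambda>: "symbol_on k S \<Lambda>"
  shows "tensor_on k (Suc n) S (cov_deriv_coord \<Gamma> \<Lambda> T)"
  unfolding tensor_on_def
proof (intro conjI ballI allI impI)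
  note Tm = tensor_onD(1)[OF T] and Tk = tensor_onD(2)[OF T]
  have Tk': "length us = n \<Longrightarrow> Ck_on k S (\<lambda>z. T z us)" for us
    using Ck_on_Suc_imp[OF Tk] .
  show "multilinear (Suc n) (cov_deriv_coord \<Gamma> \<Lambda> T z)" if z: "z \<in> S" for z
    unfolding multilinear_def
  proof (intro allI impI)
    fix vs :: "'a list" and i assume "length vs = Suc n" and i: "i < Suc n"
    then obtain us u where vs: "vs = us @ [u]" and us: "length us = n"
      by (metis length_Suc_conv_rev)
    have d: "((\<lambda>z. T z us') has_derivative frechet_derivative (\<lambda>z. T z us') (at z)) (at z)"
      if "length us' = n" for us'
      using Ck_on_Suc_D(2)[OF Tk[OF that] z] .
    show "linear (\<lambda>a. cov_deriv_coord \<Gamma> \<Lambda> T z (vs[i := a]))"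
    proof (cases "i < n")
      case True
      have upd: "vs[i := a] = us[i := a] @ [u]" for a
        using True us by (simp add: vs list_update_append)
      \<comment> \<open>Linearity in the slot passes from \<open>T\<close> to its derivative because
        derivatives are unique.\<close>
      have 1: "linear (\<lambda>a. frechet_derivative (\<lambda>z. T z (us[i := a])) (at z) u)"
      proof (rule linearI)
        fix a b :: 'a and r :: real
        have "((\<lambda>z. T z (us[i := a]) + T z (us[i := b])) has_derivative
            (\<lambda>u. frechet_derivative (\<lambda>z. T z (us[i := a])) (at z) u +
                 frechet_derivative (\<lambda>z. T z (us[i := b])) (at z) u)) (at z)"
          using us by (intro has_derivative_add d) auto
        then have "((\<lambda>z. T z (us[i := a + b])) has_derivative
            (\<lambda>u. frechet_derivative (\<lambda>z. T z (us[i := a])) (at z) u +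
                 frechet_derivative (\<lambda>z. T z (us[i := b])) (at z) u)) (at z)"
          by (rule has_derivative_transform_within_open[OF _ S z])
            (simp add: linear_add[OF multilinearD[OF Tm us True]])
        from frechet_derivative_at[OF this]
        show "frechet_derivative (\<lambda>z. T z (us[i := a + b])) (at z) u =
          frechet_derivative (\<lambda>z. T z (us[i := a])) (at z) u +
          frechet_derivative (\<lambda>z. T z (us[i := b])) (at z) u"
          by metis
        have "((\<lambda>z. r *\<^sub>R T z (us[i := a])) has_derivative
            (\<lambda>u. r *\<^sub>R frechet_derivative (\<lambda>z. T z (us[i := a])) (at z) u)) (at z)"
          using us by (intro has_derivative_scaleR_right d) auto
        then have "((\<lambda>z. T z (us[i := r *\<^sub>R a])) has_derivative
            (\<lambda>u. r *\<^sub>R frechet_derivative (\<lambda>z. T z (us[i := a])) (at z) u)) (at z)"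
          by (rule has_derivative_transform_within_open[OF _ S z])
            (simp add: linear_scale[OF multilinearD[OF Tm us True]])
        from frechet_derivative_at[OF this]
        show "frechet_derivative (\<lambda>z. T z (us[i := r *\<^sub>R a])) (at z) u =
          r *\<^sub>R frechet_derivative (\<lambda>z. T z (us[i := a])) (at z) u"
          by metis
      qed
      have 2: "linear (\<lambda>a. \<Lambda> z u (T z (us[i := a])))"
        using linear_compose[OF multilinearD[OF Tm[OF z] us True] symbol_onD(2)[OF \<Lambda> z]] by (simp add: o_def)
      have 3: "linear (\<lambda>a. T z (us[i := a, j := \<Gamma> z u (us[i := a] ! j)]))" if j: "j < n" for j
      \<comment> \<open>The correction in slot \<open>j\<close> either acts on the varied entry,
        giving a composition of linear maps, or on another slot, where the two updates
        commute.\<close>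
      proof (cases "j = i")
        case True
        then show ?thesis
          using linear_compose[OF symbol_onD(2)[OF \<Gamma> z, of u] multilinearD[OF Tm[OF z] us j]] us j
          by (simp add: o_def)
      next
        case False
        then show ?thesis
          using multilinearD[OF Tm[OF z], of "us[j := \<Gamma> z u (us ! j)]" i] us \<open>i < n\<close>
          by (simp add: list_update_swap)
      qed
      have "linear (\<lambda>a. \<Sum>j<n. T z (us[i := a, j := \<Gamma> z u (us[i := a] ! j)]))"
        by (rule linear_compose_sum) (use 3 in auto)
      from linear_compose_sub[OF linear_compose_add[OF 1 2] this]
      show ?thesis by (simp add: upd cov_deriv_coord_snoc us)
    next
      case False
      then have upd: "vs[i := a] = us @ [a]" for a
        using i us by (auto simp: vs less_Suc_eq)
      have 1: "linear (frechet_derivative (\<lambda>z. T z us) (at z))"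
        using Ck_on_Suc_D(3)[OF Tk[OF us] z] .
      have 2: "linear (\<lambda>a. T z (us[j := \<Gamma> z a (us ! j)]))" if "j < n" for j
        using linear_compose[OF symbol_onD(3)[OF \<Gamma> z, of "us ! j"] multilinearD[OF Tm[OF z] us that]]
        by (simp add: o_def)
      have "linear (\<lambda>a. \<Sum>j<n. T z (us[j := \<Gamma> z a (us ! j)]))"
        by (rule linear_compose_sum) (use 2 in auto)
      from linear_compose_sub[OF linear_compose_add[OF 1 symbol_onD(3)[OF \<Lambda> z]] this]
      show ?thesis by (simp add: upd cov_deriv_coord_snoc us)
    qed
  qed
  show "Ck_on k S (\<lambda>z. cov_deriv_coord \<Gamma> \<Lambda> T z vs)" if "length vs = Suc n" for vs
  proof -
    from that obtain us u where vs: "vs = us @ [u]" and us: "length us = n"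
      by (metis length_Suc_conv_rev)
    have 1: "Ck_on k S (\<lambda>z. frechet_derivative (\<lambda>z. T z us) (at z) u)"
      using Tk[OF us] by simp
    have "Ck_on k S (\<lambda>z. \<Sum>b\<in>Basis. (T z us \<bullet> b) *\<^sub>R \<Lambda> z u b)"
      using us
      by (intro Ck_on_sum[OF S] Ck_on_scaleR[OF S] Ck_on_linear_comp[OF bounded_linear_inner_left S]
          Tk' symbol_onD(1)[OF \<Lambda>])
    then have 2: "Ck_on k S (\<lambda>z. \<Lambda> z u (T z us))"
      by (rule Ck_on_cong[OF S, THEN iffD2, rotated])
        (rule linear_euclidean_expand[OF symbol_onD(2)[OF \<Lambda>]])
    have 3: "Ck_on k S (\<lambda>z. T z (us[j := \<Gamma> z u (us ! j)]))" if j: "j < n" for j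
    proof -
      have "Ck_on k S (\<lambda>z. \<Sum>b\<in>Basis. (\<Gamma> z u (us ! j) \<bullet> b) *\<^sub>R T z (us[j := b]))"
        using us
        by (intro Ck_on_sum[OF S] Ck_on_scaleR[OF S] Ck_on_linear_comp[OF bounded_linear_inner_left S]
            Tk' symbol_onD(1)[OF \<Gamma>]) simp
      then show ?thesis
        by (rule Ck_on_cong[OF S, THEN iffD2, rotated]) (rule multilinear_expand[OF Tm us j])
    qed
    have 4: "Ck_on k S (\<lambda>z. \<Sum>j<n. T z (us[j := \<Gamma> z u (us ! j)]))"
      by (rule Ck_on_sum[OF S]) (use 3 in auto)
    show ?thesis
      using Ck_on_minus[OF S Ck_on_add[OF S 1 2] 4] by (simp add: vs us cov_deriv_coord_snoc)
  qed
qed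

section \<open>Covariant derivatives of functions and maps in charts\<close>

lemma christoffel_symbol:
  assumes "smooth_atlas A" "smooth_atlas B" "smooth_map A B F" "connection_along A B F DF"
    and "c \<in> A" "d \<in> B"
  shows "symbol_on k (crd c ` {x \<in> cdom c. F x \<in> cdom d}) (christoffel A B F DF c d)"
  unfolding symbol_on_def
  using smooth_on_Ck[OF christoffel_smooth[OF assms]] christoffel_linear_right[OF assms(1-4)]
    christoffel_linear_left[OF assms]
  by auto

lemma symbol_on_subset: "symbol_on k S \<Lambda> \<Longrightarrow> S' \<subseteq> S \<Longrightarrow> symbol_on k S' \<Lambda>"
  by (auto simp: symbol_on_def intro: Ck_on_subset)

lemma symbol_on_zero: "symbol_on k S (\<lambda>_ _ _. 0)"
  by (simp add: symbol_on_def linear_zero)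

lemma tensor_on_subset: "tensor_on k n S T \<Longrightarrow> S' \<subseteq> S \<Longrightarrow> tensor_on k n S' T"
  by (auto simp: tensor_on_def intro: Ck_on_subset)

text \<open>For the description to be unique, at least one extension must exist, since otherwise
  every value would satisfy it. Coordinate fields of \<open>c\<close> through the given vectors
  provide one.\<close>

lemma cov_deriv_eqI:
  assumes sa: "smooth_atlas A" and c: "c \<in> A" "x \<in> cdom c" and vs: "set vs \<subseteq> tspace A x"
    and eq: "\<And>U Xs. openin (mtopology A) U \<Longrightarrow> x \<in> U \<Longrightarrow> set Xs \<subseteq> vector_fields A U \<Longrightarrow>
      map (\<lambda>X. X x) Xs = vs \<Longrightarrow>
      w = DF x (last vs) (\<lambda>y. T y (map (\<lambda>X. X y) (butlast Xs)))
         - (\<Sum>i<length vs - 1. T x ((butlast vs)[i := DA x (last vs) (Xs ! i)]))"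
  shows "cov_deriv A DA DF T x vs = w"
  unfolding cov_deriv_def
proof (rule the_equality)
  show "\<forall>U Xs. openin (mtopology A) U \<and> x \<in> U \<and> set Xs \<subseteq> vector_fields A U \<and> map (\<lambda>X. X x) Xs = vs \<longrightarrow>
     w = DF x (last vs) (\<lambda>y. T y (map (\<lambda>X. X y) (butlast Xs)))
         - (\<Sum>i<length vs - 1. T x ((butlast vs)[i := DA x (last vs) (Xs ! i)]))"
    by (intro allI impI, elim conjE, rule eq)
next
  fix w'
  let ?Xs = "map (\<lambda>v y. tvec_of A c y (v c)) vs"
  assume w': "\<forall>U Xs. openin (mtopology A) U \<and> x \<in> U \<and> set Xs \<subseteq> vector_fields A U \<and> map (\<lambda>X. X x) Xs = vs \<longrightarrow>
     w' = DF x (last vs) (\<lambda>y. T y (map (\<lambda>X. X y) (butlast Xs)))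
         - (\<Sum>i<length vs - 1. T x ((butlast vs)[i := DA x (last vs) (Xs ! i)]))"
  have "set ?Xs \<subseteq> vector_fields A (cdom c)"
    using const_field[OF sa c(1) openin_cdom[OF sa c(1)]] by auto
  moreover have "map (\<lambda>X. X x) ?Xs = vs"
    using tspace_eq_tvec_of[OF sa _ c] vs by (auto intro!: map_idI)
  ultimately show "w' = w"
    using w'[THEN spec, THEN spec, THEN mp, OF conjI[OF openin_cdom[OF sa c(1)] conjI[OF c(2) conjI]], of ?Xs]
      eq[OF openin_cdom[OF sa c(1)] c(2), of ?Xs] by simp
qed

context
  fixes A :: "('a, 'e::euclidean_space) chart set" and DA
  assumes saA: "smooth_atlas A" and connA: "connection_along A A (\<lambda>x. x) DA"
begin

lemma field_coord:
  assumes U: "openin (mtopology A) U" "x \<in> U" and X: "X \<in> vector_fields A U" and c: "c \<in> A" "x \<in> cdom c"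
  shows "X x \<in> tspace A x"
    and "((\<lambda>z. X (cinv c z) c) has_derivative frechet_derivative (\<lambda>z. X (cinv c z) c) (at (crd c x))) (at (crd c x))"
    and "v \<in> tspace A x \<Longrightarrow> DA x v X c = frechet_derivative (\<lambda>z. X (cinv c z) c) (at (crd c x)) (v c)
      + christoffel A A (\<lambda>x. x) DA c c (crd c x) (v c) (X x c)"
    and "v \<in> tspace A x \<Longrightarrow> DA x v X \<in> tspace A x"
proof -
  note X' = X[unfolded vector_fields_def] and sm = smooth_map_ident[OF saA]
  show "X x \<in> tspace A x" using sections_along_tspace[OF X' U(2)] .
  show "((\<lambda>z. X (cinv c z) c) has_derivative frechet_derivative (\<lambda>z. X (cinv c z) c) (at (crd c x))) (at (crd c x))"
    by (rule smooth_on_diff(2)[OF sections_along_smooth[OF X' c(1) c(1)]]) (use U c in auto)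
  show "DA x v X c = frechet_derivative (\<lambda>z. X (cinv c z) c) (at (crd c x)) (v c)
      + christoffel A A (\<lambda>x. x) DA c c (crd c x) (v c) (X x c)" if "v \<in> tspace A x"
    using conn_coord[OF saA saA sm connA U(1) X' U(2) c c that] .
  show "DA x v X \<in> tspace A x" if "v \<in> tspace A x"
    using conn_tspace[OF saA saA sm connA U(1) X' U(2) that] .
qed

text \<open>\<open>Xs\<close> has one entry more than \<open>T\<close> has arguments, because the
  last field only extends the direction of differentiation.\<close>

lemma extension_rep:
  fixes T :: "'a \<Rightarrow> ('a, 'e) tvec list \<Rightarrow> 'r"
  assumes c: "c \<in> A"
    and rep: "\<forall>y\<in>W \<inter> cdom c. \<forall>vs. length vs = n \<longrightarrow> set vs \<subseteq> tspace A y \<longrightarrow>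
      T y vs = Tc (crd c y) (map (\<lambda>v. v c) vs)"
    and U: "openin (mtopology A) U" and Xs: "set Xs \<subseteq> vector_fields A U" "length Xs = Suc n"
    and y: "y \<in> U" "y \<in> W" "y \<in> cdom c"
  shows "T y (map (\<lambda>X. X y) (butlast Xs)) =
    Tc (crd c y) (map (\<lambda>i. (Xs ! i) (cinv c (crd c y)) c) [0..<n])"
proof -
  have "T y (map (\<lambda>X. X y) (butlast Xs)) = Tc (crd c y) (map (\<lambda>v. v c) (map (\<lambda>X. X y) (butlast Xs)))"
  proof (rule rep[rule_format])
    show "set (map (\<lambda>X. X y) (butlast Xs)) \<subseteq> tspace A y"
      using Xs(1) field_coord(1)[OF U y(1) _ c y(3)] by (auto dest!: in_set_butlastD)
  qed (use Xs y in auto)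
  also have "map (\<lambda>v. v c) (map (\<lambda>X. X y) (butlast Xs)) = map (\<lambda>i. (Xs ! i) (cinv c (crd c y)) c) [0..<n]"
    using y Xs cinv_crd[OF saA c] by (auto simp: nth_butlast intro!: nth_equalityI)
  finally show ?thesis .
qed

text \<open>The computation shared by functions and maps. The components of a map in a target chart
  exist only where it lands in that chart, hence the open set \<open>W\<close>;
  \<open>\<Lambda>\<close> stays arbitrary so that both kinds of values are covered.\<close>

lemma extension_deriv:
  fixes T :: "'a \<Rightarrow> ('a, 'e) tvec list \<Rightarrow> 'r::euclidean_space"
  assumes c: "c \<in> A" "x \<in> cdom c" and W: "openin (mtopology A) W" "x \<in> W"
    and T: "tensor_on (Suc 0) n (crd c ` (W \<inter> cdom c)) Tc"
    and rep: "\<forall>y\<in>W \<inter> cdom c. \<forall>vs. length vs = n \<longrightarrow> set vs \<subseteq> tspace A y \<longrightarrow>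
      T y vs = Tc (crd c y) (map (\<lambda>v. v c) vs)"
    and vs: "length vs = Suc n" "set vs \<subseteq> tspace A x"
    and U: "openin (mtopology A) U" "x \<in> U" and Xs: "set Xs \<subseteq> vector_fields A U"
    and Xx: "map (\<lambda>X. X x) Xs = vs"
  defines "G \<equiv> \<lambda>z. T (cinv c z) (map (\<lambda>X. X (cinv c z)) (butlast Xs))"
  shows "(G has_derivative frechet_derivative G (at (crd c x))) (at (crd c x))" (is ?A)
    and "frechet_derivative G (at (crd c x)) (last vs c) + \<Lambda> (crd c x) (last vs c) (T x (butlast vs))
       - (\<Sum>i<n. T x ((butlast vs)[i := DA x (last vs) (Xs ! i)])) =
       cov_deriv_coord (christoffel A A (\<lambda>x. x) DA c c) \<Lambda> Tc (crd c x) (map (\<lambda>v. v c) vs)" (is ?B)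
proof -
  let ?z = "crd c x"
  let ?v = "last vs"
  let ?S = "crd c ` (U \<inter> W \<inter> cdom c)"
  let ?X = "\<lambda>i z. (Xs ! i) (cinv c z) c"
  let ?X' = "\<lambda>i. frechet_derivative (?X i) (at ?z)"
  let ?\<Gamma> = "christoffel A A (\<lambda>x. x) DA c c"
  let ?H = "\<lambda>z. Tc z (map (\<lambda>i. ?X i z) [0..<n])"
  have S: "open ?S" "?z \<in> ?S" using openin_image[OF saA openin_Int[OF U(1) W(1)] c(1)] U(2) W(2) c by auto
  have l: "length Xs = Suc n" using Xx vs by auto
  have Xi: "Xs ! i \<in> vector_fields A U" if "i < Suc n" for i using that Xs l nth_mem[of i Xs] by auto
  have v: "?v \<in> tspace A x" using vs by (cases vs rule: rev_cases) auto
  have vi: "vs ! i = (Xs ! i) x" if "i < Suc n" for i using Xx l that by (metis nth_map)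
  have TS: "tensor_on (Suc 0) n ?S Tc" by (rule tensor_on_subset[OF T]) auto
  define us where "us = map (\<lambda>i. ?X i ?z) [0..<n]"
  have us: "us = map (\<lambda>v. v c) (butlast vs)"
    using vs(1) vi cinv_crd[OF saA c] by (auto simp: us_def nth_butlast intro!: nth_equalityI)
  have usv: "map (\<lambda>v. v c) vs = us @ [?v c]"
    unfolding us using vs by (cases vs rule: rev_cases) auto
  have GH: "?H z = G z" if "z \<in> ?S" for z
    using that extension_rep[OF c(1) rep U(1) Xs l] cinv_crd[OF saA c(1)] by (auto simp: G_def)
  have d1: "((\<lambda>z. Tc z us') has_derivative frechet_derivative (\<lambda>z. Tc z us') (at ?z)) (at ?z)"
    if "length us' = n" for us'
    using Ck_on_Suc_D(2)[OF tensor_onD(2)[OF TS that] S(2)] .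
  have d2: "(?X i has_derivative ?X' i) (at ?z)" if "i < n" for i
    using field_coord(2)[OF U Xi c, of i] that by simp
  have "?H differentiable (at ?z)"
    by (rule differentiableI) (rule tensor_fields_has_derivative[OF S tensor_onD(1)[OF TS] d1 d2])
  then have dG: "G differentiable (at ?z)" and fG: "frechet_derivative ?H (at ?z) = frechet_derivative G (at ?z)"
    using frechet_derivative_cong_open[OF S GH] by auto
  then show ?A by (simp add: frechet_derivative_works)
  have 2: "T x ((butlast vs)[i := DA x ?v (Xs ! i)]) = Tc ?z (us[i := ?X' i (?v c) + ?\<Gamma> ?z (?v c) (us ! i)])"
    if i: "i < n" for i
  proof -
    have "T x ((butlast vs)[i := DA x ?v (Xs ! i)]) = Tc ?z (map (\<lambda>v. v c) ((butlast vs)[i := DA x ?v (Xs ! i)]))"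
    proof (rule rep[rule_format])
      show "set ((butlast vs)[i := DA x ?v (Xs ! i)]) \<subseteq> tspace A x"
        using vs(2) field_coord(4)[OF U Xi[OF less_SucI[OF i]] c v]
        by (auto dest!: in_set_butlastD subsetD[OF set_update_subset_insert])
    qed (use vs W c in auto)
    also have "map (\<lambda>v. v c) ((butlast vs)[i := DA x ?v (Xs ! i)]) = us[i := DA x ?v (Xs ! i) c]"
      by (simp add: us map_update)
    also have "DA x ?v (Xs ! i) c = ?X' i (?v c) + ?\<Gamma> ?z (?v c) (us ! i)"
      using field_coord(3)[OF U Xi[OF less_SucI[OF i]] c v] i by (simp add: us_def cinv_crd[OF saA c])
    finally show ?thesis .
  qed
  have "T x (butlast vs) = Tc ?z us"
    unfolding us by (rule rep[rule_format]) (use vs W c in \<open>auto dest!: in_set_butlastD\<close>)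
  moreover have "frechet_derivative ?H (at ?z) (?v c) + \<Lambda> ?z (?v c) (Tc ?z us)
      - (\<Sum>i<n. Tc ?z (us[i := ?X' i (?v c) + ?\<Gamma> ?z (?v c) (us ! i)])) = cov_deriv_coord ?\<Gamma> \<Lambda> Tc ?z (us @ [?v c])"
    unfolding us_def by (rule cov_deriv_coord_fields[OF S TS d2])
  ultimately show ?B
    using 2 by (simp add: usv fG)
qed

lemma cov_deriv_real_coord:
  fixes T :: "'a \<Rightarrow> ('a, 'e) tvec list \<Rightarrow> real"
  assumes c: "c \<in> A" "x \<in> cdom c" and T: "tensor_on (Suc 0) n (crd c ` cdom c) Tc"
    and rep: "\<And>y vs. y \<in> cdom c \<Longrightarrow> length vs = n \<Longrightarrow> set vs \<subseteq> tspace A y \<Longrightarrow>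
      T y vs = Tc (crd c y) (map (\<lambda>v. v c) vs)"
    and vs: "length vs = Suc n" "set vs \<subseteq> tspace A x"
  shows "cov_deriv A DA (dir_deriv A) T x vs =
    cov_deriv_coord (christoffel A A (\<lambda>x. x) DA c c) (\<lambda>_ _ _. 0) Tc (crd c x) (map (\<lambda>v. v c) vs)"
proof (rule cov_deriv_eqI[OF saA c vs(2)])
  fix U Xs assume U: "openin (mtopology A) U" "x \<in> U" and Xs: "set Xs \<subseteq> vector_fields A U"
    and Xx: "map (\<lambda>X. X x) Xs = vs"
  have v: "last vs \<in> tspace A x" using vs by (cases vs rule: rev_cases) auto
  have T': "tensor_on (Suc 0) n (crd c ` (cdom c \<inter> cdom c)) Tc" using T by simp
  have rep': "\<forall>y\<in>cdom c \<inter> cdom c. \<forall>vs. length vs = n \<longrightarrow> set vs \<subseteq> tspace A y \<longrightarrow>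
      T y vs = Tc (crd c y) (map (\<lambda>v. v c) vs)"
    using rep by auto
  note e = extension_deriv[OF c openin_cdom[OF saA c(1)] c(2) T' rep' vs U Xs Xx]
  show "cov_deriv_coord (christoffel A A (\<lambda>x. x) DA c c) (\<lambda>_ _ _. 0) Tc (crd c x) (map (\<lambda>v. v c) vs) =
      dir_deriv A x (last vs) (\<lambda>y. T y (map (\<lambda>X. X y) (butlast Xs))) -
      (\<Sum>i<length vs - 1. T x ((butlast vs)[i := DA x (last vs) (Xs ! i)]))"
    using e(2)[of "\<lambda>_ _ _. 0"] dir_deriv_eq[OF saA c v e(1)] vs(1) by simp
qed

definition fun_coord :: "('a \<Rightarrow> real) \<Rightarrow> ('a, 'e) chart \<Rightarrow> nat \<Rightarrow> 'e \<Rightarrow> 'e list \<Rightarrow> real" where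
  "fun_coord f c k = (cov_deriv_coord (christoffel A A (\<lambda>x. x) DA c c) (\<lambda>_ _ _. 0) ^^ k) (\<lambda>z us. f (cinv c z))"

lemma christoffel_symbol_self: "c \<in> A \<Longrightarrow> symbol_on k (crd c ` cdom c) (christoffel A A (\<lambda>x. x) DA c c)"
  using christoffel_symbol[OF saA saA smooth_map_ident[OF saA] connA, of c c k] by simp

lemma fun_coord_tensor:
  assumes f: "Ck_fun A K (carrier A) f" and c: "c \<in> A"
  shows "j \<le> K \<Longrightarrow> tensor_on (K - j) j (crd c ` cdom c) (fun_coord f c j)"
proof (induction j)
  case 0
  have "carrier A \<inter> cdom c = cdom c" using c by (auto simp: carrier_def)
  then show ?case using f c by (auto simp: tensor_on_def multilinear_def fun_coord_def Ck_fun_def o_def)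
next
  case (Suc j)
  then have "tensor_on (Suc (K - Suc j)) j (crd c ` cdom c) (fun_coord f c j)"
    by (simp add: Suc_diff_Suc)
  from cov_deriv_coord_tensor[OF atlas_open_dom[OF saA c] this christoffel_symbol_self[OF c] symbol_on_zero]
  show ?case by (simp add: fun_coord_def)
qed

lemma cov_deriv_fun_coord:
  assumes f: "Ck_fun A K (carrier A) f" and c: "c \<in> A"
  shows "j \<le> K \<Longrightarrow> x \<in> cdom c \<Longrightarrow> length vs = j \<Longrightarrow> set vs \<subseteq> tspace A x \<Longrightarrow>
    cov_deriv_fun A DA f j x vs = fun_coord f c j (crd c x) (map (\<lambda>v. v c) vs)"
proof (induction j arbitrary: x vs)
  case 0
  then show ?case using cinv_crd[OF saA c] by (simp add: cov_deriv_fun_def fun_coord_def)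
next
  case (Suc j)
  have T: "tensor_on (Suc 0) j (crd c ` cdom c) (fun_coord f c j)"
    by (rule tensor_on_le[OF fun_coord_tensor[OF f c]]) (use Suc.prems in auto)
  have "cov_deriv_fun A DA f (Suc j) x vs = cov_deriv A DA (dir_deriv A) (cov_deriv_fun A DA f j) x vs"
    by (simp add: cov_deriv_fun_def)
  also have "\<dots> = cov_deriv_coord (christoffel A A (\<lambda>x. x) DA c c) (\<lambda>_ _ _. 0) (fun_coord f c j) (crd c x) (map (\<lambda>v. v c) vs)"
    by (rule cov_deriv_real_coord[OF c Suc.prems(2) T _ Suc.prems(3,4)]) (use Suc in auto)
  also have "\<dots> = fun_coord f c (Suc j) (crd c x) (map (\<lambda>v. v c) vs)"
    by (simp add: fun_coord_def)
  finally show ?case .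
qed

context
  fixes B :: "('b, 'f::euclidean_space) chart set" and F :: "'a \<Rightarrow> 'b" and DF
  assumes saB: "smooth_atlas B" and sm: "smooth_map A B F" and connF: "connection_along A B F DF"
begin

text \<open>The invariant of the iteration. Values must be tangent vectors at \<open>F x\<close> so
  that one chart determines them. All orders \<open>k\<close> are demanded at once: the map is
  smooth, so differentiating costs nothing.\<close>

definition map_rep ::
  "nat \<Rightarrow> ('a \<Rightarrow> ('a, 'e) tvec list \<Rightarrow> ('b, 'f) tvec) \<Rightarrow>
    (('a, 'e) chart \<Rightarrow> ('b, 'f) chart \<Rightarrow> 'e \<Rightarrow> 'e list \<Rightarrow> 'f) \<Rightarrow> bool" where
  "map_rep n T Tc \<longleftrightarrow>
    (\<forall>x\<in>carrier A. \<forall>vs. length vs = n \<longrightarrow> set vs \<subseteq> tspace A x \<longrightarrow> T x vs \<in> tspace B (F x)) \<and>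
    (\<forall>c\<in>A. \<forall>d\<in>B. (\<forall>k. tensor_on k n (crd c ` {x \<in> cdom c. F x \<in> cdom d}) (Tc c d)) \<and>
      (\<forall>x vs. x \<in> cdom c \<longrightarrow> F x \<in> cdom d \<longrightarrow> length vs = n \<longrightarrow> set vs \<subseteq> tspace A x \<longrightarrow>
        T x vs d = Tc c d (crd c x) (map (\<lambda>v. v c) vs)))"

lemma map_repD:
  assumes "map_rep n T Tc"
  shows "c \<in> A \<Longrightarrow> x \<in> cdom c \<Longrightarrow> length vs = n \<Longrightarrow> set vs \<subseteq> tspace A x \<Longrightarrow> T x vs \<in> tspace B (F x)"
    and "c \<in> A \<Longrightarrow> d \<in> B \<Longrightarrow> tensor_on k n (crd c ` {x \<in> cdom c. F x \<in> cdom d}) (Tc c d)"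
    and "c \<in> A \<Longrightarrow> d \<in> B \<Longrightarrow> x \<in> cdom c \<Longrightarrow> F x \<in> cdom d \<Longrightarrow> length vs = n \<Longrightarrow> set vs \<subseteq> tspace A x \<Longrightarrow>
      T x vs d = Tc c d (crd c x) (map (\<lambda>v. v c) vs)"
  using assms by (auto simp: map_rep_def carrier_def)

lemma cov_deriv_map_rep:
  assumes T: "map_rep n T Tc"
  shows "map_rep (Suc n) (cov_deriv A DA DF T)
    (\<lambda>c d. cov_deriv_coord (christoffel A A (\<lambda>x. x) DA c c) (christoffel A B F DF c d) (Tc c d))"
    (is "map_rep _ _ ?Tc'")
proof -
  let ?R = "\<lambda>x vs Xs. DF x (last vs) (\<lambda>y. T y (map (\<lambda>X. X y) (butlast Xs)))
         - (\<Sum>i<length vs - 1. T x ((butlast vs)[i := DA x (last vs) (Xs ! i)]))"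
  have main: "?R x vs Xs \<in> tspace B (F x)" (is ?th1)
    "\<lbrakk>c \<in> A; x \<in> cdom c; d \<in> B; F x \<in> cdom d\<rbrakk> \<Longrightarrow> ?R x vs Xs d = ?Tc' c d (crd c x) (map (\<lambda>v. v c) vs)"
    if x: "x \<in> carrier A" and vs: "length vs = Suc n" "set vs \<subseteq> tspace A x"
      and U: "openin (mtopology A) U" "x \<in> U" and Xs: "set Xs \<subseteq> vector_fields A U"
      and Xx: "map (\<lambda>X. X x) Xs = vs" for x vs U Xs c d
  proof -
    let ?Y = "\<lambda>y. T y (map (\<lambda>X. X y) (butlast Xs))"
    have v: "last vs \<in> tspace A x" using vs by (cases vs rule: rev_cases) auto
    have l: "length Xs = Suc n" using Xx vs by auto
    have bu: "butlast vs = map (\<lambda>X. X x) (butlast Xs)" using Xx by (metis map_butlast)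
    \<comment> \<open>A connection acts on sections only, so the tensor evaluated on the extension
      must first be shown to be a smooth one.\<close>
    have Y: "?Y \<in> sections_along A B F U"
    proof (rule sections_alongI)
      fix y assume y: "y \<in> U"
      then have "y \<in> carrier A" using U(1) atlas_openin[OF saA] by blast
      then obtain c where c: "c \<in> A" "y \<in> cdom c" by (rule carrierE[OF saA])
      show "?Y y \<in> tspace B (F y)"
        by (rule map_repD(1)[OF T c])
          (use Xs l field_coord(1)[OF U(1) y _ c] in \<open>auto dest!: in_set_butlastD\<close>)
    next
      fix c d assume c: "c \<in> A" and d: "d \<in> B"
      let ?S = "crd c ` {x \<in> U \<inter> cdom c. F x \<in> cdom d}"
      have S: "open ?S" by (rule open_preimage[OF saA saB sm U(1) c d])
      have Xi: "Xs ! i \<in> sections_along A A (\<lambda>x. x) U" if "i < n" for i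
        using that Xs l nth_mem[of i Xs] by (auto simp: vector_fields_def)
      have XC: "Ck_on k ?S (\<lambda>z. (Xs ! i) (cinv c z) c)" if "i < n" for i k
        by (rule Ck_on_subset[OF smooth_on_Ck[OF sections_along_smooth[OF Xi[OF that] c c]]]) auto
      have "Ck_on k ?S (\<lambda>z. Tc c d z (map (\<lambda>i. (Xs ! i) (cinv c z) c) [0..<n]))" for k
        by (rule tensor_fields_Ck[OF S tensor_on_subset[OF map_repD(2)[OF T c d]] XC]) auto
      moreover have "\<forall>y\<in>{x \<in> U. F x \<in> cdom d} \<inter> cdom c. \<forall>vs. length vs = n \<longrightarrow> set vs \<subseteq> tspace A y \<longrightarrow>
          T y vs d = Tc c d (crd c y) (map (\<lambda>v. v c) vs)"
        using map_repD(3)[OF T c d] by auto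
      from extension_rep[OF c this U(1) Xs l]
      have "Tc c d z (map (\<lambda>i. (Xs ! i) (cinv c z) c) [0..<n]) = ?Y (cinv c z) d" if "z \<in> ?S" for z
        using that cinv_crd[OF saA c] by auto
      ultimately show "smooth_on ?S (\<lambda>z. ?Y (cinv c z) d)"
        unfolding smooth_on_def using Ck_on_cong[OF S] by (metis (no_types, lifting))
    qed
    obtain c0 where c0: "c0 \<in> A" "x \<in> cdom c0" using x by (rule carrierE[OF saA])
    have Ti: "T x ((butlast vs)[i := DA x (last vs) (Xs ! i)]) \<in> tspace B (F x)" if "i < n" for i
    proof (rule map_repD(1)[OF T c0])
      have "Xs ! i \<in> vector_fields A U" using that Xs l nth_mem[of i Xs] by auto
      then show "set ((butlast vs)[i := DA x (last vs) (Xs ! i)]) \<subseteq> tspace A x"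
        using vs(2) field_coord(4)[OF U _ c0 v]
        by (auto dest!: in_set_butlastD subsetD[OF set_update_subset_insert])
    qed (use vs in auto)
    show ?th1
      using conn_tspace[OF saA saB sm connF U(1) Y U(2) v] Ti vs(1)
      by (intro tspace_diff[OF saB] tspace_sum[OF saB]) auto
    show "?R x vs Xs d = ?Tc' c d (crd c x) (map (\<lambda>v. v c) vs)"
      if c: "c \<in> A" "x \<in> cdom c" and d: "d \<in> B" "F x \<in> cdom d"
    proof -
      let ?W = "{y \<in> cdom c. F y \<in> cdom d}"
      have W: "openin (mtopology A) ?W" "x \<in> ?W"
        using openin_preimage[OF saA saB sm openin_cdom[OF saA c(1)] d(1)] c d by auto
      have "?W \<inter> cdom c = ?W" by auto
      then have T': "tensor_on (Suc 0) n (crd c ` (?W \<inter> cdom c)) (Tc c d)"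
        using map_repD(2)[OF T c(1) d(1)] by simp
      have rep: "\<forall>y\<in>?W \<inter> cdom c. \<forall>us. length us = n \<longrightarrow> set us \<subseteq> tspace A y \<longrightarrow>
          T y us d = Tc c d (crd c y) (map (\<lambda>v. v c) us)"
        using map_repD(3)[OF T c(1) d(1)] by auto
      note e = extension_deriv(2)[OF c W T' rep vs U Xs Xx, of "christoffel A B F DF c d"]
      show ?thesis
        using conn_coord[OF saA saB sm connF U(1) Y U(2) c d v] e vs(1) bu by (simp add: fun_sum_apply)
    qed
  qed
  have cd: "cov_deriv A DA DF T x vs \<in> tspace B (F x)"
    "\<lbrakk>c \<in> A; x \<in> cdom c; d \<in> B; F x \<in> cdom d\<rbrakk> \<Longrightarrow>
      cov_deriv A DA DF T x vs d = ?Tc' c d (crd c x) (map (\<lambda>v. v c) vs)"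
    if x: "x \<in> carrier A" and vs: "length vs = Suc n" "set vs \<subseteq> tspace A x" for x vs c d
  proof -
    obtain c0 where c0: "c0 \<in> A" "x \<in> cdom c0" using x by (rule carrierE[OF saA])
    obtain d0 where d0: "d0 \<in> B" "F x \<in> cdom d0"
      using smooth_map_carrier[OF saA saB sm c0] by (rule carrierE[OF saB])
    let ?Xs = "map (\<lambda>v y. tvec_of A c0 y (v c0)) vs"
    let ?w = "?R x vs ?Xs"
    have U: "openin (mtopology A) (cdom c0)" using openin_cdom[OF saA c0(1)] .
    have Xs: "set ?Xs \<subseteq> vector_fields A (cdom c0)"
      using const_field[OF saA c0(1) openin_cdom[OF saA c0(1)]] by auto
    have Xx: "map (\<lambda>X. X x) ?Xs = vs"
      using tspace_eq_tvec_of[OF saA _ c0] vs by (auto intro!: map_idI)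
    note m0 = main[OF x vs U c0(2) Xs Xx]
    \<comment> \<open>Any two extensions yield tangent vectors at \<open>F x\<close> with the same
      entry at \<open>d0\<close>, hence the same vector.\<close>
    have eq: "cov_deriv A DA DF T x vs = ?w"
    proof (rule cov_deriv_eqI[OF saA c0 vs(2)])
      fix U' Xs' assume *: "openin (mtopology A) U'" "x \<in> U'" "set Xs' \<subseteq> vector_fields A U'"
        "map (\<lambda>X. X x) Xs' = vs"
      note m1 = main[OF x vs *]
      show "?w = ?R x vs Xs'"
        by (rule tspace_eqI[OF saB m0(1) m1(1) d0]) (simp only: m0(2)[OF c0 d0] m1(2)[OF c0 d0])
    qed
    show "cov_deriv A DA DF T x vs \<in> tspace B (F x)" unfolding eq by (rule m0(1))
    show "cov_deriv A DA DF T x vs d = ?Tc' c d (crd c x) (map (\<lambda>v. v c) vs)"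
      if "c \<in> A" "x \<in> cdom c" "d \<in> B" "F x \<in> cdom d"
      unfolding eq by (rule m0(2)[OF that])
  qed
  have t: "tensor_on k (Suc n) (crd c ` {x \<in> cdom c. F x \<in> cdom d}) (?Tc' c d)" if "c \<in> A" "d \<in> B" for c d k
    by (rule cov_deriv_coord_tensor[OF open_preimage_dom[OF saA saB sm that] map_repD(2)[OF T that]
        symbol_on_subset[OF christoffel_symbol_self[OF that(1)]] christoffel_symbol[OF saA saB sm connF that]])
      auto
  have ca: "x \<in> carrier A" if "c \<in> A" "x \<in> cdom c" for c x
    using that by (auto simp: carrier_def)
  show ?thesis
    unfolding map_rep_def
    by (intro conjI ballI allI impI) (rule cd(1) t cd(2)[OF ca]; assumption)+
qed

definition map_coord :: "nat \<Rightarrow> ('a, 'e) chart \<Rightarrow> ('b, 'f) chart \<Rightarrow> 'e \<Rightarrow> 'e list \<Rightarrow> 'f" where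
  "map_coord k c d =
    (cov_deriv_coord (christoffel A A (\<lambda>x. x) DA c c) (christoffel A B F DF c d) ^^ (k - 1))
      (\<lambda>z us. frechet_derivative (\<lambda>z. crd d (F (cinv c z))) (at z) (hd us))"

lemma cov_deriv_map_coord: "map_rep (Suc k) (cov_deriv_map A B DA DF F (Suc k)) (map_coord (Suc k))"
proof (induction k)
  case 0
  have t: "tensor_on k 1 (crd c ` {x \<in> cdom c. F x \<in> cdom d})
      (\<lambda>z us. frechet_derivative (\<lambda>z. crd d (F (cinv c z))) (at z) (hd us))"
    if "c \<in> A" "d \<in> B" for c d k
  proof -
    note r = smooth_map_rep[OF saA saB sm that]
    have "linear (\<lambda>a. frechet_derivative (\<lambda>z. crd d (F (cinv c z))) (at z) (hd (us[0 := a])))"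
      if "z \<in> crd c ` {x \<in> cdom c. F x \<in> cdom d}" "length us = 1" for z and us :: "'e list"
      using smooth_on_diff(3)[OF r that(1)] that(2) by (cases us) auto
    then show ?thesis
      using smooth_on_Ck[OF r, of "Suc k"] by (auto simp: tensor_on_def multilinear_def)
  qed
  show ?case
    unfolding map_rep_def
  proof (intro conjI ballI allI impI)
    fix x and vs :: "('a, 'e) tvec list"
    assume x: "x \<in> carrier A" and vs: "length vs = Suc 0" "set vs \<subseteq> tspace A x"
    then have "hd vs \<in> tspace A x" by (cases vs) auto
    then show "cov_deriv_map A B DA DF F (Suc 0) x vs \<in> tspace B (F x)"
      using tmap_tspace[OF saA saB sm] x by (auto simp: cov_deriv_map_def elim!: carrierE[OF saA])
  next
    fix c d k assume "c \<in> A" "d \<in> B"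
    then show "tensor_on k (Suc 0) (crd c ` {x \<in> cdom c. F x \<in> cdom d}) (map_coord (Suc 0) c d)"
      using t by (simp add: map_coord_def)
  next
    fix c d x and vs :: "('a, 'e) tvec list"
    assume *: "c \<in> A" "d \<in> B" "x \<in> cdom c" "F x \<in> cdom d" and vs: "length vs = Suc 0" "set vs \<subseteq> tspace A x"
    then have "hd vs \<in> tspace A x" and "hd (map (\<lambda>v. v c) vs) = hd vs c" by (cases vs; auto)+
    then show "cov_deriv_map A B DA DF F (Suc 0) x vs d = map_coord (Suc 0) c d (crd c x) (map (\<lambda>v. v c) vs)"
      using tmap_coord[OF saA saB sm *] by (simp add: cov_deriv_map_def map_coord_def)
  qed
next
  case (Suc k)
  from cov_deriv_map_rep[OF Suc] show ?case
    by (simp add: cov_deriv_map_def map_coord_def[abs_def])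
qed

end

end

section \<open>Levi-Civita connections in coordinates\<close>

definition metric_coord ::
  "('m, 'e::euclidean_space) chart set \<Rightarrow> ('m \<Rightarrow> ('m, 'e) tvec \<Rightarrow> ('m, 'e) tvec \<Rightarrow> real) \<Rightarrow>
    ('m, 'e) chart \<Rightarrow> 'e \<Rightarrow> 'e \<Rightarrow> 'e \<Rightarrow> real" where
  "metric_coord A g c z a b = g (cinv c z) (tvec_of A c (cinv c z) a) (tvec_of A c (cinv c z) b)"

context
  fixes A :: "('m, 'e::euclidean_space) chart set" and g
  assumes saA: "smooth_atlas A" and g: "riemannian_metric A g"
begin

lemma metric_at:
  assumes "x \<in> carrier A" "u \<in> tspace A x" "v \<in> tspace A x" "w \<in> tspace A x"
  shows "g x (u + v) w = g x u w + g x v w" "g x (tscale r u) w = r * g x u w"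
    "g x u v = g x v u" "u \<noteq> 0 \<Longrightarrow> g x u u > 0"
  using bspec[OF bspec[OF bspec[OF bspec[OF conjunct1[OF g[unfolded riemannian_metric_def]] assms(1)] assms(2)] assms(3)] assms(4)]
  by blast+

lemma metric_smooth:
  assumes "openin (mtopology A) U" "X \<in> vector_fields A U" "Y \<in> vector_fields A U"
  shows "smooth_fun A U (\<lambda>x. g x (X x) (Y x))"
  using bspec[OF bspec[OF mp[OF spec[OF conjunct2[OF g[unfolded riemannian_metric_def]]] assms(1)] assms(2)] assms(3)] .

lemma metric_coord_bilinear:
  assumes c: "c \<in> A" "z \<in> crd c ` cdom c"
  shows "metric_coord A g c z (a + b) w = metric_coord A g c z a w + metric_coord A g c z b w"
    "metric_coord A g c z (r *\<^sub>R a) w = r * metric_coord A g c z a w"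
    "metric_coord A g c z a b = metric_coord A g c z b a"
    "a \<noteq> 0 \<Longrightarrow> metric_coord A g c z a a > 0"
proof -
  have x: "cinv c z \<in> cdom c" "cinv c z \<in> carrier A"
    using c cinv_crd[OF saA c(1)] by (auto simp: carrier_def)
  note t = tvec_of_tspace[OF saA c(1) x(1)] and l = tvec_of_linear[OF saA c(1) x(1)]
  show "metric_coord A g c z (a + b) w = metric_coord A g c z a w + metric_coord A g c z b w"
    unfolding metric_coord_def l by (rule metric_at(1)[OF x(2) t t t])
  show "metric_coord A g c z (r *\<^sub>R a) w = r * metric_coord A g c z a w"
    unfolding metric_coord_def l by (rule metric_at(2)[OF x(2) t t t])
  show "metric_coord A g c z a b = metric_coord A g c z b a"
    unfolding metric_coord_def by (rule metric_at(3)[OF x(2) t t t])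
  show "metric_coord A g c z a a > 0" if "a \<noteq> 0"
  proof -
    have "tvec_of A c (cinv c z) a c \<noteq> 0 c"
      using that tvec_of_self[OF saA c(1) x(1)] by simp
    then have "tvec_of A c (cinv c z) a \<noteq> 0" by metis
    then show ?thesis
      unfolding metric_coord_def by (rule metric_at(4)[OF x(2) t t t])
  qed
qed

lemma metric_coord_linear:
  assumes c: "c \<in> A" "z \<in> crd c ` cdom c"
  shows "linear (metric_coord A g c z a)" "linear (\<lambda>a. metric_coord A g c z a w)"
proof -
  show "linear (\<lambda>a. metric_coord A g c z a w)" for w
    by (rule linearI) (simp_all add: metric_coord_bilinear(1,2)[OF c])
  from linear_cong[OF this[of a], of "metric_coord A g c z a"]
  show "linear (metric_coord A g c z a)"
    using metric_coord_bilinear(3)[OF c] by blast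
qed

context
  fixes D
  assumes lc: "levi_civita A g D"
begin

lemma lc_conn: "connection_along A A (\<lambda>x. x) D"
  using lc by (simp add: levi_civita_def)

text \<open>The coordinates of a coordinate field are constant, so only the Christoffel term
  survives.\<close>

lemma conn_const_field:
  assumes c: "c \<in> A" "x \<in> cdom c"
  shows "D x (tvec_of A c x a) (\<lambda>y. tvec_of A c y b) = 
     tvec_of A c x (christoffel A A (\<lambda>x. x) D c c (crd c x) a b)"
proof (rule tspace_eqI[OF saA _ _ c])
  note U = openin_cdom[OF saA c(1)] and t = tvec_of_tspace[OF saA c]
  have X: "(\<lambda>y. tvec_of A c y b) \<in> vector_fields A (cdom c)"
    by (rule const_field[OF saA c(1) U subset_refl])
  note f = field_coord[OF saA lc_conn U c(2) X c]
  show "D x (tvec_of A c x a) (\<lambda>y. tvec_of A c y b) \<in> tspace A x" by (rule f(4)[OF t])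
  have "((\<lambda>z. tvec_of A c (cinv c z) b c) has_derivative (\<lambda>_. 0)) (at (crd c x))"
    by (rule has_derivative_transform_within_open[OF has_derivative_const atlas_open_dom[OF saA c(1)]])
      (use c cinv_crd[OF saA c(1)] tvec_of_self[OF saA c(1)] in auto)
  then show "D x (tvec_of A c x a) (\<lambda>y. tvec_of A c y b) c =
      tvec_of A c x (christoffel A A (\<lambda>x. x) D c c (crd c x) a b) c"
    using f(3)[OF t, of a] frechet_derivative_at[of "\<lambda>z. tvec_of A c (cinv c z) b c"]
    by (simp add: tvec_of_self[OF saA c])
  show "tvec_of A c x (christoffel A A (\<lambda>x. x) D c c (crd c x) a b) \<in> tspace A x" by (rule t)
qed

text \<open>Torsion-freeness is tested on coordinate functions of \<open>c\<close> and on coordinate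
  fields, whose bracket vanishes.\<close>

lemma christoffel_symmetric:
  assumes c: "c \<in> A" "x \<in> cdom c"
  shows "christoffel A A (\<lambda>x. x) D c c (crd c x) a b = christoffel A A (\<lambda>x. x) D c c (crd c x) b a"
proof (rule euclidean_eqI)
  fix i :: 'e assume "i \<in> Basis"
  let ?\<Gamma> = "christoffel A A (\<lambda>x. x) D c c (crd c x)"
  let ?h = "\<lambda>y. crd c y \<bullet> i"
  let ?X = "\<lambda>a y. tvec_of A c y a"
  note U = openin_cdom[OF saA c(1)]
  have h: "smooth_fun A (cdom c) ?h"
    unfolding smooth_fun_def Ck_fun_def
  proof (intro allI ballI)
    fix k d assume d: "d \<in> A"
    show "Ck_on k (crd d ` (cdom c \<inter> cdom d)) (?h \<circ> cinv d)"
      using Ck_on_linear_comp[OF bounded_linear_inner_left atlas_open_overlap[OF saA d c(1)] smooth_on_Ck[OF atlas_smooth[OF saA d c(1)]]]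
      by (simp add: o_def Int_commute)
  qed
  have hd: "dir_deriv A y v ?h = v c \<bullet> i" if "y \<in> cdom c" "v \<in> tspace A y" for y v
  proof (rule dir_deriv_eq[OF saA c(1) that])
    show "((\<lambda>z. ?h (cinv c z)) has_derivative (\<lambda>a. a \<bullet> i)) (at (crd c y))"
      by (rule has_derivative_transform_within_open[OF has_derivative_inner_left[OF has_derivative_ident] atlas_open_dom[OF saA c(1)]])
        (use that cinv_crd[OF saA c(1)] in auto)
  qed
  \<comment> \<open>The inner derivative is the constant \<open>b \<bullet> i\<close>, so each term
    of the bracket is zero.\<close>
  have hh: "dir_deriv A x v (\<lambda>y. dir_deriv A y (?X b y) ?h) = 0" if "v \<in> tspace A x" for v b
  proof -
    have "((\<lambda>z. dir_deriv A (cinv c z) (?X b (cinv c z)) ?h) has_derivative (\<lambda>_. 0)) (at (crd c x))"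
      by (rule has_derivative_transform_within_open[OF has_derivative_const[of "b \<bullet> i"] atlas_open_dom[OF saA c(1)]])
        (use c cinv_crd[OF saA c(1)] hd tvec_of_tspace[OF saA c(1)] tvec_of_self[OF saA c(1)] in auto)
    from dir_deriv_eq[OF saA c that this] show ?thesis .
  qed
  note X = const_field[OF saA c(1) U subset_refl] and t = tvec_of_tspace[OF saA c]
  have "torsion_free A D" using lc by (simp add: levi_civita_def)
  from mp[OF spec[OF bspec[OF bspec[OF mp[OF spec[OF this[unfolded torsion_free_def]] U] X] X]] h, THEN bspec, OF c(2), of a b]
  have "dir_deriv A x (tvec_of A c x (?\<Gamma> a b) - tvec_of A c x (?\<Gamma> b a)) ?h = 0"
    using hh[OF t] conn_const_field[OF c] by simp
  then show "?\<Gamma> a b \<bullet> i = ?\<Gamma> b a \<bullet> i"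
    using hd[OF c(2) tspace_diff[OF saA t t]] by (simp add: tvec_of_self[OF saA c] inner_diff_left)
qed

text \<open>Metric compatibility written for coordinate fields; that the derivative exists comes
  from the smoothness of \<open>g\<close> on vector fields.\<close>

lemma metric_coord_has_derivative:
  assumes c: "c \<in> A" "x \<in> cdom c"
  shows "((\<lambda>z. metric_coord A g c z a b) has_derivative
    (\<lambda>e. metric_coord A g c (crd c x) (christoffel A A (\<lambda>x. x) D c c (crd c x) e a) b +
         metric_coord A g c (crd c x) a (christoffel A A (\<lambda>x. x) D c c (crd c x) e b))) (at (crd c x))"
    (is "(?m has_derivative ?L) _")
proof -
  note U = openin_cdom[OF saA c(1)]
  note X = const_field[OF saA c(1) U subset_refl] and t = tvec_of_tspace[OF saA c]
  have "Ck_on (Suc 0) (crd c ` cdom c) ((\<lambda>x. g x (tvec_of A c x a) (tvec_of A c x b)) \<circ> cinv c)"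
    using bspec[OF spec[OF metric_smooth[OF U X X, of a b, unfolded smooth_fun_def Ck_fun_def], of "Suc 0"] c(1)]
    by (simp only: Int_absorb)
  from Ck_on_Suc_D(2)[OF this, of "crd c x"]
  have d: "(?m has_derivative frechet_derivative ?m (at (crd c x))) (at (crd c x))"
    using c by (simp add: metric_coord_def o_def)
  have "frechet_derivative ?m (at (crd c x)) e = ?L e" for e
  proof -
    have "metric_compatible A g D" using lc by (simp add: levi_civita_def)
    from bspec[OF bspec[OF bspec[OF bspec[OF mp[OF spec[OF this[unfolded metric_compatible_def]] U] X] X] c(2)] t, of e a b]
    have "dir_deriv A x (tvec_of A c x e) (\<lambda>y. g y (tvec_of A c y a) (tvec_of A c y b)) = ?L e"
      by (simp add: conn_const_field[OF c] metric_coord_def cinv_crd[OF saA c])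
    then show ?thesis
      using dir_deriv_eq[OF saA c t d[unfolded metric_coord_def]]
      by (simp add: tvec_of_self[OF saA c] metric_coord_def)
  qed
  then have "frechet_derivative ?m (at (crd c x)) = ?L" by (rule ext)
  with d show ?thesis by simp
qed

end
end

section \<open>The tangent bundle\<close>

lemma Ck_on_Pair:
  assumes "open S" "Ck_on k S f" "Ck_on k S h"
  shows "Ck_on k S (\<lambda>x. (f x, h x))"
proof -
  have "bounded_linear (\<lambda>x::'b. (x, 0::'c))" "bounded_linear (\<lambda>x::'c. (0::'b, x))"
    by (auto intro!: bounded_linear_Pair bounded_linear_ident bounded_linear_zero)
  from Ck_on_add[OF assms(1) Ck_on_linear_comp[OF this(1) assms(1,2)] Ck_on_linear_comp[OF this(2) assms(1,3)]]
  show ?thesis by simp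
qed

lemma cdom_tangent_chart: "p \<in> cdom (tangent_chart A c) \<longleftrightarrow> fst p \<in> cdom c \<and> snd p \<in> tspace A (fst p)"
  by (cases p) (simp add: tangent_chart_def)

lemma crd_tangent_chart: "crd (tangent_chart A c) p = (crd c (fst p), snd p c)"
  by (cases p) (simp add: tangent_chart_def)

context
  fixes A :: "('m, 'e::euclidean_space) chart set"
  assumes saA: "smooth_atlas A"
begin

lemma tangent_chart_inj: "c \<in> A \<Longrightarrow> inj_on (crd (tangent_chart A c)) (cdom (tangent_chart A c))"
proof (rule inj_onI)
  fix p q assume c: "c \<in> A" and pq: "p \<in> cdom (tangent_chart A c)" "q \<in> cdom (tangent_chart A c)"
    and e: "crd (tangent_chart A c) p = crd (tangent_chart A c) q"
  have "fst p = fst q"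
    using e pq cinv_crd[OF saA c] by (simp add: crd_tangent_chart cdom_tangent_chart) metis
  moreover have "snd p = snd q"
    by (rule tspace_eqI[OF saA _ _ c, of _ "fst p"])
      (use e pq \<open>fst p = fst q\<close> in \<open>auto simp: crd_tangent_chart cdom_tangent_chart\<close>)
  ultimately show "p = q" by (simp add: prod_eq_iff)
qed

lemma cinv_tangent_chart:
  assumes "c \<in> A" "z \<in> crd c ` cdom c"
  shows "cinv (tangent_chart A c) (z, a) = (cinv c z, tvec_of A c (cinv c z) a)"
proof -
  let ?p = "(cinv c z, tvec_of A c (cinv c z) a)"
  have x: "cinv c z \<in> cdom c" "crd c (cinv c z) = z"
    using assms cinv_crd[OF saA assms(1)] by auto
  have "?p \<in> cdom (tangent_chart A c)" "crd (tangent_chart A c) ?p = (z, a)"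
    using x tvec_of_tspace[OF saA assms(1) x(1)] tvec_of_self[OF saA assms(1) x(1)]
    by (auto simp: cdom_tangent_chart crd_tangent_chart)
  then show ?thesis
    using inv_into_f_f[OF tangent_chart_inj[OF assms(1)]] by metis
qed

lemma tangent_chart_image:
  assumes "c \<in> A"
  shows "crd (tangent_chart A c) ` (cdom (tangent_chart A c) \<inter> cdom (tangent_chart A d)) =
    (crd c ` (cdom c \<inter> cdom d)) \<times> UNIV"
proof (intro equalityI subsetI)
  fix q assume "q \<in> crd (tangent_chart A c) ` (cdom (tangent_chart A c) \<inter> cdom (tangent_chart A d))"
  then show "q \<in> (crd c ` (cdom c \<inter> cdom d)) \<times> UNIV"
    by (auto simp: cdom_tangent_chart crd_tangent_chart simp del: split_paired_All)
next
  fix q assume "q \<in> (crd c ` (cdom c \<inter> cdom d)) \<times> (UNIV :: 'e set)"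
  then obtain x a where x: "x \<in> cdom c" "x \<in> cdom d" and q: "q = (crd c x, a)" by auto
  have "q = crd (tangent_chart A c) (x, tvec_of A c x a)"
    using tvec_of_self[OF saA assms x(1)] by (simp add: q crd_tangent_chart)
  moreover have "(x, tvec_of A c x a) \<in> cdom (tangent_chart A c) \<inter> cdom (tangent_chart A d)"
    using x tvec_of_tspace[OF saA assms x(1)] by (simp add: cdom_tangent_chart)
  ultimately show "q \<in> crd (tangent_chart A c) ` (cdom (tangent_chart A c) \<inter> cdom (tangent_chart A d))"
    by blast
qed

lemma tangent_trans:
  assumes "c \<in> A" "d \<in> A" "z \<in> crd c ` (cdom c \<inter> cdom d)"
  shows "(crd (tangent_chart A d) \<circ> cinv (tangent_chart A c)) (z, a) =
    ((crd d \<circ> cinv c) z, frechet_derivative (crd d \<circ> cinv c) (at z) a)"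
proof -
  from assms(3) obtain x where x: "x \<in> cdom c" "x \<in> cdom d" "z = crd c x" by auto
  have "cinv (tangent_chart A c) (z, a) = (x, tvec_of A c x a)"
    using cinv_tangent_chart[OF assms(1), of z a] x cinv_crd[OF saA assms(1)] by auto
  then show ?thesis
    using x assms(2) cinv_crd[OF saA assms(1) x(1)] by (simp add: crd_tangent_chart tvec_of_def)
qed

text \<open>A transition has the form \<open>(z, a) \<mapsto> (\<tau> z, d\<tau> z a)\<close>, so
  its second component uses the smoothness of \<open>\<tau>\<close> one order higher.\<close>

lemma smooth_tangent_atlas: "smooth_atlas (tangent_atlas A)"
proof -
  have o: "open (crd (tangent_chart A c) ` (cdom (tangent_chart A c) \<inter> cdom (tangent_chart A d)))"
    if "c \<in> A" "d \<in> A" for c d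
    unfolding tangent_chart_image[OF that(1)] by (rule open_Times[OF atlas_open_overlap[OF saA that] open_UNIV])
  have s: "smooth_on (crd (tangent_chart A c) ` (cdom (tangent_chart A c) \<inter> cdom (tangent_chart A d)))
      (crd (tangent_chart A d) \<circ> cinv (tangent_chart A c))" if cd: "c \<in> A" "d \<in> A" for c d
  proof -
    let ?T = "crd c ` (cdom c \<inter> cdom d)"
    let ?S = "?T \<times> (UNIV :: 'e set)"
    let ?\<tau> = "crd d \<circ> cinv c"
    have S: "open ?S" "open ?T" using open_Times[OF atlas_open_overlap[OF saA that] open_UNIV] atlas_open_overlap[OF saA that] by auto
    have \<tau>: "Ck_on k ?T ?\<tau>" for k using smooth_on_Ck[OF atlas_smooth[OF saA cd]] .
    have f: "Ck_on k ?S fst" and sn: "Ck_on k ?S snd" for k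
      using Ck_on_bounded_linear[OF _ S(1)] bounded_linear_fst bounded_linear_snd by auto
    have i: "fst ` ?S \<subseteq> ?T" by auto
    have "Ck_on k ?S (\<lambda>q. (?\<tau> (fst q), frechet_derivative ?\<tau> (at (fst q)) (snd q)))" for k
      by (rule Ck_on_Pair[OF S(1) Ck_on_compose[OF S i f \<tau>] Ck_on_frechet_comp[OF S i f \<tau> sn]])
    moreover have "(?\<tau> (fst q), frechet_derivative ?\<tau> (at (fst q)) (snd q)) =
        (crd (tangent_chart A d) \<circ> cinv (tangent_chart A c)) q" if "q \<in> ?S" for q
      using tangent_trans[OF cd, of "fst q" "snd q"] that by (metis mem_Times_iff prod.collapse)
    ultimately show ?thesis
      unfolding smooth_on_def tangent_chart_image[OF cd(1)] using Ck_on_cong[OF S(1)] by (metis (no_types, lifting))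
  qed
  show ?thesis
    unfolding smooth_atlas_def tangent_atlas_def using tangent_chart_inj o s by blast
qed

end

section \<open>Vertical and horizontal vectors in charts\<close>

context
  fixes A :: "('m, 'e::euclidean_space) chart set"
  assumes saA: "smooth_atlas A"
begin

lemma tangent_chart_in: "c \<in> A \<Longrightarrow> tangent_chart A c \<in> tangent_atlas A"
  by (simp add: tangent_atlas_def)

lemma in_cdom_tangent_chart: "(x, v) \<in> cdom (tangent_chart A c) \<longleftrightarrow> x \<in> cdom c \<and> v \<in> tspace A x"
  by (simp add: cdom_tangent_chart)

lemma tangent_chart_image_dom:
  "c \<in> A \<Longrightarrow> crd (tangent_chart A c) ` cdom (tangent_chart A c) = (crd c ` cdom c) \<times> UNIV"
  using tangent_chart_image[OF saA, of c c] by simp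

text \<open>Over a fixed base point a transition of the bundle is constant in the base component and
  linear in the fibre variable. Uniqueness of the derivative along the fibre then identifies its
  value on \<open>(0, b)\<close>.\<close>

lemma tangent_trans_vertical:
  assumes "c \<in> A" "d \<in> A" "x \<in> cdom c" "x \<in> cdom d"
  shows "frechet_derivative (crd (tangent_chart A d) \<circ> cinv (tangent_chart A c)) (at (crd c x, a)) (0, b) =
    (0, frechet_derivative (crd d \<circ> cinv c) (at (crd c x)) b)"
proof -
  let ?\<tau> = "crd (tangent_chart A d) \<circ> cinv (tangent_chart A c)"
  let ?L = "frechet_derivative (crd d \<circ> cinv c) (at (crd c x))"
  have "(?\<tau> has_derivative frechet_derivative ?\<tau> (at (crd c x, a))) (at (crd c x, a))"
    by (rule smooth_on_diff(2)[OF atlas_smooth[OF smooth_tangent_atlas[OF saA] tangent_chart_in tangent_chart_in]])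
      (use assms in \<open>auto simp: tangent_chart_image[OF saA assms(1)]\<close>)
  moreover have "((\<lambda>s. (crd c x, s)) has_derivative (\<lambda>b. (0, b))) (at a)"
    by (intro has_derivative_Pair has_derivative_const has_derivative_ident)
  ultimately have "((\<lambda>s. ?\<tau> (crd c x, s)) has_derivative
      (\<lambda>b. frechet_derivative ?\<tau> (at (crd c x, a)) (0, b))) (at a)"
    using has_derivative_compose by blast
  moreover have "?\<tau> (crd c x, s) = ((crd d \<circ> cinv c) (crd c x), ?L s)" for s
    by (rule tangent_trans[OF saA]) (use assms in auto)
  moreover have "((\<lambda>s. ((crd d \<circ> cinv c) (crd c x), ?L s)) has_derivative (\<lambda>b. (0, ?L b))) (at a)"
    by (intro has_derivative_Pair has_derivative_const linear_imp_has_derivative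
        trans_has_derivative(2)[OF saA assms])
  ultimately have "(\<lambda>b. frechet_derivative ?\<tau> (at (crd c x, a)) (0, b)) = (\<lambda>b. (0, ?L b))"
    using has_derivative_unique by simp
  then show ?thesis by metis
qed

lemma vertical_lift_eq:
  assumes c: "c \<in> A" "x \<in> cdom c" and v: "v \<in> tspace A x" and w: "w \<in> tspace A x"
  shows "vertical_lift A (x, v) w = tvec_of (tangent_atlas A) (tangent_chart A c) (x, v) (0, w c)"
proof
  fix C'
  \<comment> \<open>\<open>velocity\<close> refers to the curve at time 0, which is literally
    \<open>v + tscale 0 w\<close>.\<close>
  have v0: "v + tscale 0 w = v" by (rule ext) simp
  show "vertical_lift A (x, v) w C' = tvec_of (tangent_atlas A) (tangent_chart A c) (x, v) (0, w c) C'"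
  proof (cases "C' \<in> tangent_atlas A \<and> (x, v) \<in> cdom C'")
    case True
    then obtain c' where c': "c' \<in> A" "x \<in> cdom c'" and C': "C' = tangent_chart A c'"
      by (auto simp: tangent_atlas_def in_cdom_tangent_chart)
    have "((\<lambda>t::real. (crd c' x, v c' + t *\<^sub>R w c')) has_vector_derivative (0, w c')) (at 0)"
      by (auto simp: has_vector_derivative_def intro!: derivative_eq_intros)
    then have "vector_derivative (\<lambda>t. crd C' (x, v + tscale t w)) (at 0) = (0, w c')"
      by (simp add: C' crd_tangent_chart vector_derivative_at)
    moreover have "w c' = frechet_derivative (crd c' \<circ> cinv c) (at (crd c x)) (w c)"
      by (rule tspace_trans[OF saA w c(1) c'(1) c(2) c'(2)])
    ultimately show ?thesis
      using True tangent_trans_vertical[OF c(1) c'(1) c(2) c'(2), of "v c" "w c"] v0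
      by (simp add: vertical_lift_def velocity_def tvec_of_def C' crd_tangent_chart)
  next
    case False
    then show ?thesis using v0 by (auto simp: vertical_lift_def velocity_def tvec_of_def)
  qed
qed

text \<open>In charts \<open>fst\<close> is the first projection, whose differential kills
  \<open>(0, w c)\<close>.\<close>

lemma vertical_lift_vertical:
  assumes x: "x \<in> carrier A" and v: "v \<in> tspace A x" and w: "w \<in> tspace A x"
  shows "vertical_lift A (x, v) w \<in> vertical A (x, v)"
proof -
  obtain c where c: "c \<in> A" "x \<in> cdom c" using x by (rule carrierE[OF saA])
  let ?C = "tangent_chart A c"
  let ?\<xi> = "vertical_lift A (x, v) w"
  have p: "(x, v) \<in> cdom ?C" using c v by (simp add: in_cdom_tangent_chart)
  have \<xi>: "?\<xi> \<in> tspace (tangent_atlas A) (x, v)" "?\<xi> ?C = (0, w c)"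
    unfolding vertical_lift_eq[OF c v w]
    using tvec_of_tspace[OF smooth_tangent_atlas[OF saA] tangent_chart_in[OF c(1)] p]
      tvec_of_self[OF smooth_tangent_atlas[OF saA] tangent_chart_in[OF c(1)] p] by auto
  have "tmap (tangent_atlas A) A fst (x, v) ?\<xi> = 0"
  proof
    fix d
    show "tmap (tangent_atlas A) A fst (x, v) ?\<xi> d = 0 d"
    proof (cases "d \<in> A \<and> x \<in> cdom d")
      case True
      let ?L = "frechet_derivative (crd d \<circ> cinv c) (at (crd c x))"
      have 1: "((\<lambda>q. (crd d \<circ> cinv c) (fst q)) has_derivative (\<lambda>q. ?L (fst q))) (at (crd c x, v c))"
        by (rule has_derivative_compose[OF has_derivative_fst[OF has_derivative_ident]])
          (use trans_has_derivative(1)[OF saA c(1) conjunct1[OF True] c(2) conjunct2[OF True]] in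
            \<open>simp only: fst_conv\<close>)
      have "((\<lambda>q. crd d (fst (cinv ?C q))) has_derivative (\<lambda>q. ?L (fst q))) (at (crd ?C (x, v)))"
      proof (rule has_derivative_transform_within_open)
        show "((\<lambda>q. (crd d \<circ> cinv c) (fst q)) has_derivative (\<lambda>q. ?L (fst q))) (at (crd ?C (x, v)))"
          using 1 by (simp add: crd_tangent_chart)
        show "open ((crd c ` cdom c) \<times> (UNIV :: 'e set))"
          by (rule open_Times[OF atlas_open_dom[OF saA c(1)] open_UNIV])
        show "crd ?C (x, v) \<in> (crd c ` cdom c) \<times> UNIV" using c by (simp add: crd_tangent_chart)
        fix q assume "q \<in> (crd c ` cdom c) \<times> (UNIV :: 'e set)"
        then show "(crd d \<circ> cinv c) (fst q) = crd d (fst (cinv ?C q))"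
          using cinv_tangent_chart[OF saA c(1), of "fst q" "snd q"] by (simp add: mem_Times_iff)
      qed
      from tmap_eq[OF smooth_tangent_atlas[OF saA] tangent_chart_in[OF c(1)] p \<xi>(1) _ _ this, of A] True
      have "tmap (tangent_atlas A) A fst (x, v) ?\<xi> d = ?L 0"
        by (simp add: \<xi>(2))
      then show ?thesis
        using linear_0[OF trans_has_derivative(2)[OF saA c(1) conjunct1[OF True] c(2) conjunct2[OF True]]] by simp
    qed (auto simp: tmap_def)
  qed
  then show ?thesis using \<xi>(1) by (simp add: vertical_def)
qed

context
  fixes g D
  assumes g: "riemannian_metric A g" and lc: "levi_civita A g D"
begin

text \<open>The definition of \<open>horizontal\<close> asks for an actual vector field that is
  parallel at \<open>x\<close>; one is constructed for every base direction
  \<open>a\<close>.\<close>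

lemma horizontal_coord:
  assumes c: "c \<in> A" "x \<in> cdom c" and v: "v \<in> tspace A x"
  shows "tvec_of (tangent_atlas A) (tangent_chart A c) (x, v)
    (a, - christoffel A A (\<lambda>x. x) D c c (crd c x) a (v c)) \<in> horizontal A D (x, v)"
proof -
  let ?z = "crd c x"
  let ?\<Gamma> = "christoffel A A (\<lambda>x. x) D c c"
  let ?C = "tangent_chart A c"
  define L where "L a = ?\<Gamma> ?z a (v c)" for a
  \<comment> \<open>The coordinates are affine with slope \<open>- L\<close>, so that their
    derivative cancels the Christoffel term at \<open>x\<close>.\<close>
  define W where "W z = v c - L (z - ?z)" for z
  define Y where "Y y = tvec_of A c y (W (crd c y))" for y
  let ?u = "tvec_of A c x a"
  note U = openin_cdom[OF saA c(1)] and conn = lc_conn[OF saA g lc]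
  have L: "linear L"
    unfolding L_def by (rule symbol_onD(3)[OF christoffel_symbol_self[OF saA conn c(1), of 0]]) (use c in auto)
  have bL: "bounded_linear L" by (rule linear_conv_bounded_linear[THEN iffD1, OF L])
  have oc: "open (crd c ` cdom c)" by (rule atlas_open_dom[OF saA c(1)])
  have W: "smooth_on (crd c ` cdom c) W"
    unfolding smooth_on_def W_def
    by (intro allI Ck_on_minus[OF oc] Ck_on_const Ck_on_linear_comp[OF bL oc] Ck_on_ident)
  have dW: "(W has_derivative (\<lambda>a. - L a)) (at ?z)"
  proof -
    have "((\<lambda>z. L (z - ?z)) has_derivative (\<lambda>a. L (a - 0))) (at ?z)"
      by (intro bounded_linear.has_derivative[OF bL] has_derivative_diff has_derivative_ident has_derivative_const)
    from has_derivative_diff[OF has_derivative_const this, of "v c"] show ?thesis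
      by (simp add: W_def[abs_def])
  qed
  have Y: "Y \<in> vector_fields A (cdom c)"
    using coord_field[OF saA c(1) U subset_refl W] by (simp add: Y_def[abs_def])
  have Yx: "Y x = v"
    using tspace_eq_tvec_of[OF saA v c] linear_0[OF L] by (simp add: Y_def W_def)
  have u: "?u \<in> tspace A x" by (rule tvec_of_tspace[OF saA c])
  have "((\<lambda>z. Y (cinv c z) c) has_derivative (\<lambda>a. - L a)) (at ?z)"
    by (rule has_derivative_transform_within_open[OF dW oc])
      (use c cinv_crd[OF saA c(1)] tvec_of_self[OF saA c(1)] in \<open>auto simp: Y_def\<close>)
  from frechet_derivative_at[OF this, symmetric]
  have "D x ?u Y c = 0"
    using field_coord(3)[OF saA conn U c(2) Y c u] tvec_of_self[OF saA c]
    by (simp add: Yx L_def)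
  then have DY: "D x ?u Y = 0"
    by (intro tspace_eqI[OF saA field_coord(4)[OF saA conn U c(2) Y c u] tspace_0[OF saA] c]) simp
  have p: "(x, v) \<in> cdom ?C" using c v by (simp add: in_cdom_tangent_chart)
  have "tmap A (tangent_atlas A) (\<lambda>y. (y, Y y)) x ?u = tvec_of (tangent_atlas A) ?C (x, v) (a, - L a)"
  proof
    fix C'
    show "tmap A (tangent_atlas A) (\<lambda>y. (y, Y y)) x ?u C' = tvec_of (tangent_atlas A) ?C (x, v) (a, - L a) C'"
    proof (cases "C' \<in> tangent_atlas A \<and> (x, v) \<in> cdom C'")
      case True
      let ?T = "frechet_derivative (crd C' \<circ> cinv ?C) (at (crd ?C (x, v)))"
      have W0: "(?z, W ?z) = crd ?C (x, v)"
        using linear_0[OF L] by (simp add: crd_tangent_chart W_def)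
      have "((\<lambda>z. (crd C' \<circ> cinv ?C) (z, W z)) has_derivative (\<lambda>a. ?T (a, - L a))) (at ?z)"
        by (rule has_derivative_compose[OF has_derivative_Pair[OF has_derivative_ident dW]])
          (use trans_has_derivative(1)[OF smooth_tangent_atlas[OF saA] tangent_chart_in[OF c(1)]
              conjunct1[OF True] p conjunct2[OF True]] in \<open>simp only: W0\<close>)
      then have "((\<lambda>z. crd C' (cinv c z, Y (cinv c z))) has_derivative (\<lambda>a. ?T (a, - L a))) (at ?z)"
      proof (rule has_derivative_transform_within_open[OF _ oc])
        fix z assume z: "z \<in> crd c ` cdom c"
        then have "crd c (cinv c z) = z" using cinv_crd[OF saA c(1)] by auto
        then show "(crd C' \<circ> cinv ?C) (z, W z) = crd C' (cinv c z, Y (cinv c z))"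
          using cinv_tangent_chart[OF saA c(1) z] by (simp add: Y_def)
      qed (use c in auto)
      from tmap_eq[OF saA c u _ _ this, of "tangent_atlas A"] True Yx
      show ?thesis by (simp add: tvec_of_def[of "tangent_atlas A"] tvec_of_self[OF saA c])
    next
      case False
      then show ?thesis using Yx by (auto simp: tmap_def tvec_of_def)
    qed
  qed
  then show ?thesis
    unfolding horizontal_def L_def[symmetric]
    using U c(2) Y Yx u DY by (auto intro!: exI[of _ "cdom c"] exI[of _ Y] exI[of _ ?u])
qed

section \<open>The Sasaki metric and its Christoffel symbols in charts\<close>

context
  fixes G DT
  assumes sasaki: "sasaki_metric A g D G" and lcT: "levi_civita (tangent_atlas A) G DT"
begin

lemma sasaki_riemannian: "riemannian_metric (tangent_atlas A) G"
  using sasaki unfolding sasaki_metric_def by (rule conjunct1)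

lemma sasaki_at:
  assumes "x \<in> carrier A" "v \<in> tspace A x"
  shows "\<xi> \<in> vertical A (x, v) \<Longrightarrow> \<eta> \<in> horizontal A D (x, v) \<Longrightarrow> G (x, v) \<xi> \<eta> = 0"
    "u \<in> tspace A x \<Longrightarrow> w \<in> tspace A x \<Longrightarrow>
      G (x, v) (vertical_lift A (x, v) u) (vertical_lift A (x, v) w) = g x u w"
proof -
  have "(x, v) \<in> tangent_bundle A" using assms by (simp add: tangent_bundle_def)
  note s = bspec[OF conjunct2[OF sasaki[unfolded sasaki_metric_def]] this]
  show "\<xi> \<in> vertical A (x, v) \<Longrightarrow> \<eta> \<in> horizontal A D (x, v) \<Longrightarrow> G (x, v) \<xi> \<eta> = 0"
    using bspec[OF bspec[OF conjunct1[OF s]]] .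
  show "u \<in> tspace A x \<Longrightarrow> w \<in> tspace A x \<Longrightarrow>
      G (x, v) (vertical_lift A (x, v) u) (vertical_lift A (x, v) w) = g x u w"
    using bspec[OF bspec[OF conjunct1[OF conjunct2[OF s]]]] by simp
qed

text \<open>The vector \<open>(b, e)\<close> splits into the horizontal
  \<open>(b, - \<Gamma>(b, v))\<close> and the vertical \<open>(0, e + \<Gamma>(b, v))\<close>.
  Against a vertical vector only the second part counts, and there the metric is
  \<open>g\<close>.\<close>

lemma sasaki_coord:
  assumes c: "c \<in> A" and z: "z \<in> crd c ` cdom c"
  shows "metric_coord (tangent_atlas A) G (tangent_chart A c) (z, v) (0, a) (b, e) =
    metric_coord A g c z a (e + christoffel A A (\<lambda>x. x) D c c z b v)"
proof -
  let ?TA = "tangent_atlas A" and ?C = "tangent_chart A c"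
  define x where "x = cinv c z"
  have x: "x \<in> cdom c" "crd c x = z" "x \<in> carrier A"
    using z c cinv_crd[OF saA c] by (auto simp: x_def carrier_def)
  let ?v = "tvec_of A c x v"
  have v: "?v \<in> tspace A x" "?v c = v" using tvec_of_tspace[OF saA c x(1)] tvec_of_self[OF saA c x(1)] by auto
  have p: "cinv ?C (z, v) = (x, ?v)" using cinv_tangent_chart[OF saA c z] by (simp add: x_def)
  have pC: "(x, ?v) \<in> cdom ?C" using x v by (simp add: in_cdom_tangent_chart)
  have pT: "(x, ?v) \<in> carrier ?TA" using pC tangent_chart_in[OF c] by (auto simp: carrier_def)
  let ?t = "tvec_of ?TA ?C (x, ?v)"
  have t: "?t w \<in> tspace ?TA (x, ?v)" for w
    by (rule tvec_of_tspace[OF smooth_tangent_atlas[OF saA] tangent_chart_in[OF c] pC])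
  let ?k = "christoffel A A (\<lambda>x. x) D c c z b v"
  let ?h = "?t (b, - ?k)" and ?w = "?t (0, e + ?k)"
  have split: "?t (b, e) = ?h + ?w"
    using tvec_of_linear(1)[OF smooth_tangent_atlas[OF saA] tangent_chart_in[OF c] pC, of "(b, - ?k)" "(0, e + ?k)"]
    by simp
  have lift: "?t (0, s) = vertical_lift A (x, ?v) (tvec_of A c x s)" for s
    using vertical_lift_eq[OF c x(1) v(1) tvec_of_tspace[OF saA c x(1)], of s] tvec_of_self[OF saA c x(1)] by simp
  have vt: "?t (0, s) \<in> vertical A (x, ?v)" for s
    unfolding lift by (rule vertical_lift_vertical[OF x(3) v(1) tvec_of_tspace[OF saA c x(1)]])
  have hz: "?h \<in> horizontal A D (x, ?v)"
    using horizontal_coord[OF c x(1) v(1), of b] by (simp add: v(2) x(2))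
  note m = metric_at[OF smooth_tangent_atlas[OF saA] sasaki_riemannian pT]
  have "G (x, ?v) (?t (0, a)) (?t (b, e)) = G (x, ?v) ?h (?t (0, a)) + G (x, ?v) ?w (?t (0, a))"
    unfolding m(3)[OF t t t, of "(0, a)" "(b, e)"] unfolding split by (rule m(1)[OF t t t])
  also have "G (x, ?v) ?h (?t (0, a)) = 0"
    unfolding m(3)[OF t t t, of "(b, - ?k)" "(0, a)"] by (rule sasaki_at(1)[OF x(3) v(1) vt hz])
  also have "G (x, ?v) ?w (?t (0, a)) = g x (tvec_of A c x (e + ?k)) (tvec_of A c x a)"
    unfolding lift by (rule sasaki_at(2)[OF x(3) v(1)]) (rule tvec_of_tspace[OF saA c x(1)])+
  also have "\<dots> = g x (tvec_of A c x a) (tvec_of A c x (e + ?k))"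
    by (rule metric_at(3)[OF saA g x(3)]) (rule tvec_of_tspace[OF saA c x(1)])+
  finally show ?thesis
    by (simp add: metric_coord_def p x_def)
qed

text \<open>The fibres of the tangent bundle are flat and totally geodesic for the Sasaki metric.\<close>

lemma christoffel_vertical:
  assumes c: "c \<in> A" "x \<in> cdom c"
  shows "christoffel (tangent_atlas A) (tangent_atlas A) (\<lambda>x. x) DT (tangent_chart A c) (tangent_chart A c)
    (crd c x, v) (0, a) (0, b) = 0"
proof -
  let ?TA = "tangent_atlas A" and ?C = "tangent_chart A c"
  let ?z = "crd c x"
  let ?P = "(?z, v)"
  let ?\<Gamma> = "christoffel A A (\<lambda>x. x) D c c ?z"
  let ?K = "christoffel ?TA ?TA (\<lambda>x. x) DT ?C ?C ?P"
  let ?m = "metric_coord A g c" and ?M = "metric_coord ?TA G ?C"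
  note saT = smooth_tangent_atlas[OF saA] and C = tangent_chart_in[OF c(1)]
  note conn = lc_conn[OF saA g lc]
  define p where "p = cinv ?C ?P"
  have z: "?z \<in> crd c ` cdom c" using c by auto
  have PC: "?P \<in> crd ?C ` cdom ?C" using z by (simp add: tangent_chart_image_dom[OF c(1)])
  then have p: "p \<in> cdom ?C" "crd ?C p = ?P" using cinv_crd[OF saT C] by (auto simp: p_def)
  note dM = metric_coord_has_derivative[OF saT sasaki_riemannian lcT C p(1), unfolded p(2)]
  note sym = christoffel_symmetric[OF saT sasaki_riemannian lcT C p(1), unfolded p(2)]
  note bil = metric_coord_bilinear[OF saT sasaki_riemannian C PC]
  note multilinear = metric_coord_linear[OF saA g c(1) z]
  have \<Gamma>: "linear (?\<Gamma> b)" for b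
    by (rule symbol_onD(2)[OF christoffel_symbol_self[OF saA conn c(1), of 0] z])
  \<comment> \<open>The derivative along the fibre of the product of \<open>(0, b)\<close> and
    \<open>(e, w)\<close>: metric compatibility gives the left side, and
    \<open>sasaki_coord\<close>, which is affine in the fibre point, gives the right side.\<close>
  have vert: "?M ?P (?K (0, a) (0, b)) (e, w) + ?M ?P (0, b) (?K (0, a) (e, w)) = ?m ?z b (?\<Gamma> e a)" for a b e w
  proof -
    have d1: "((\<lambda>s. ?M (?z, s) (0, b) (e, w)) has_derivative
      (\<lambda>a. ?M ?P (?K (0, a) (0, b)) (e, w) + ?M ?P (0, b) (?K (0, a) (e, w)))) (at v)"
      using has_derivative_compose[OF has_derivative_Pair[OF has_derivative_const has_derivative_ident] dM] by simp
    have "((\<lambda>s. ?m ?z b (w + ?\<Gamma> e s)) has_derivative (\<lambda>a. ?m ?z b (0 + ?\<Gamma> e a))) (at v)"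
      by (intro bounded_linear.has_derivative[OF linear_conv_bounded_linear[THEN iffD1, OF multilinear(1)]]
          has_derivative_add has_derivative_const linear_imp_has_derivative \<Gamma>)
    then have "((\<lambda>s. ?M (?z, s) (0, b) (e, w)) has_derivative (\<lambda>a. ?m ?z b (0 + ?\<Gamma> e a))) (at v)"
      by (simp only: sasaki_coord[OF c(1) z])
    from fun_cong[OF has_derivative_unique[OF d1 this], of a] show ?thesis by simp
  qed
  \<comment> \<open>The product of two vertical vectors is the one of \<open>g\<close> at the base
    point, so its derivative sees only the base component of the direction.\<close>
  have base: "?M ?P (?K (e, w) (0, a)) (0, b) + ?M ?P (0, a) (?K (e, w) (0, b)) =
      ?m ?z (?\<Gamma> e a) b + ?m ?z a (?\<Gamma> e b)" for a b e w
  proof -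
    have "((\<lambda>q. ?m (fst q) a b) has_derivative
      (\<lambda>q. ?m ?z (?\<Gamma> (fst q) a) b + ?m ?z a (?\<Gamma> (fst q) b))) (at ?P)"
      by (rule has_derivative_compose[OF has_derivative_fst[OF has_derivative_ident]])
        (simp add: metric_coord_has_derivative[OF saA g lc c])
    then have "((\<lambda>q. ?M q (0, a) (0, b)) has_derivative
      (\<lambda>q. ?m ?z (?\<Gamma> (fst q) a) b + ?m ?z a (?\<Gamma> (fst q) b))) (at ?P)"
    proof (rule has_derivative_transform_within_open)
      show "open ((crd c ` cdom c) \<times> (UNIV :: 'e set))"
        by (rule open_Times[OF atlas_open_dom[OF saA c(1)] open_UNIV])
      fix q assume q: "q \<in> (crd c ` cdom c) \<times> (UNIV :: 'e set)"
      then have "fst q \<in> crd c ` cdom c" by (simp add: mem_Times_iff)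
      then have "christoffel A A (\<lambda>x. x) D c c (fst q) 0 (snd q) = 0"
        using linear_0[OF symbol_onD(3)[OF christoffel_symbol_self[OF saA conn c(1), of 0]]] by blast
      then show "?m (fst q) a b = ?M q (0, a) (0, b)"
        using sasaki_coord[OF c(1) \<open>fst q \<in> _\<close>, of "snd q" a 0 b] by simp
    qed (use z in simp)
    from fun_cong[OF has_derivative_unique[OF this dM], of "(e, w)"]
    show ?thesis by simp
  qed
  \<comment> \<open>Koszul: in the sum of the two fibre identities minus the base identity, symmetry
    cancels everything but twice this product.\<close>
  have "?M ?P (?K (0, a) (0, b)) (e, w) = 0" for e w
    using vert[of a b e w] vert[of b a e w] base[of e w a b] sym[of "(0, a)" "(e, w)"]
      sym[of "(0, b)" "(e, w)"] sym[of "(0, a)" "(0, b)"] bil(3)[of "(0, b)"] bil(3)[of "(0, a)"]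
      metric_coord_bilinear(3)[OF saA g c(1) z] by simp
  \<comment> \<open>The symbol is paired with itself, so that positive definiteness applies.\<close>
  then have "?M ?P (?K (0, a) (0, b)) (?K (0, a) (0, b)) = 0" by (metis prod.collapse)
  then show ?thesis using bil(4)[of "?K (0, a) (0, b)"] by fastforce
qed

end
end
end

section \<open>The higher order chain rule\<close>

text \<open>\<open>blocks us\<close> enumerates the partitions of the list \<open>us\<close> into sublists ordered by their first
  elements: a new last entry either forms a block of its own or is appended to an existing block.\<close>

definition extend_blocks :: "'a \<Rightarrow> 'a list list \<Rightarrow> 'a list list list" where
  "extend_blocks u bs = (bs @ [[u]]) # map (\<lambda>i. bs[i := bs ! i @ [u]]) [0..<length bs]"

definition blocks :: "'a list \<Rightarrow> 'a list list list" where
  "blocks us = foldl (\<lambda>bss u. concat (map (extend_blocks u) bss)) [[]] us"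

lemma blocks_Nil [simp]: "blocks [] = [[]]"
  by (simp add: blocks_def)

lemma blocks_snoc: "blocks (us @ [u]) = concat (map (extend_blocks u) (blocks us))"
  by (simp add: blocks_def)

lemma sum_list_concat_map: "(\<Sum>y\<leftarrow>concat (map f xs). (h y :: 'b::comm_monoid_add)) = (\<Sum>x\<leftarrow>xs. \<Sum>y\<leftarrow>f x. h y)"
  by (induction xs) auto

text \<open>This recursion has the shape of the product rule: the new block \<open>[u]\<close> comes
  from differentiating the outer tensor, a lengthened block from differentiating its
  \<open>i\<close>-th argument.\<close>

lemma sum_list_blocks_snoc:
  fixes h :: "'a list list \<Rightarrow> 'b::comm_monoid_add"
  shows "(\<Sum>bs\<leftarrow>blocks (us @ [u]). h bs) =
    (\<Sum>bs\<leftarrow>blocks us. h (bs @ [[u]]) + (\<Sum>i<length bs. h (bs[i := bs ! i @ [u]])))"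
  unfolding blocks_snoc sum_list_concat_map
  by (simp add: extend_blocks_def o_def interv_sum_list_conv_sum_set_nat atLeast0LessThan)

lemma blocks_props:
  assumes "bs \<in> set (blocks us)"
  shows "length bs \<le> length us" "sum_list (map length bs) = length us"
    "us \<noteq> [] \<Longrightarrow> bs \<noteq> []" "B \<in> set bs \<Longrightarrow> B \<noteq> []" "B \<in> set bs \<Longrightarrow> length B \<le> length us"
    "B \<in> set bs \<Longrightarrow> set B \<subseteq> set us"
proof -
  have *: "bs \<in> set (blocks us) \<Longrightarrow> length bs \<le> length us \<and> sum_list (map length bs) = length us \<and>
    (us \<noteq> [] \<longrightarrow> bs \<noteq> []) \<and> (\<forall>B\<in>set bs. B \<noteq> [] \<and> set B \<subseteq> set us)" for bs
  proof (induction us arbitrary: bs rule: rev_induct)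
    case (snoc u us)
    then obtain bs' where bs': "bs' \<in> set (blocks us)" "bs \<in> set (extend_blocks u bs')"
      by (auto simp: blocks_snoc)
    note IH = snoc.IH[OF bs'(1)]
    from bs'(2) consider "bs = bs' @ [[u]]" | i where "i < length bs'" "bs = bs'[i := bs' ! i @ [u]]"
      by (auto simp: extend_blocks_def)
    then show ?case
    proof cases
      case 1
      then show ?thesis using IH by auto
    next
      case 2
      have "sum_list (map length bs) = Suc (sum_list (map length bs'))"
        using 2 by (simp add: map_update sum_list_update elem_le_sum_list)
      moreover have "B \<noteq> [] \<and> set B \<subseteq> set (us @ [u])" if "B \<in> set bs" for B
      proof -
        have "B = bs' ! i @ [u] \<or> B \<in> set bs'"
          using subsetD[OF set_update_subset_insert, of B bs' i] that 2(2) by auto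
        moreover have "set (bs' ! i) \<subseteq> set us" using IH nth_mem[OF 2(1)] by blast
        ultimately show ?thesis using IH by auto
      qed
      ultimately show ?thesis using IH 2 by auto
    qed
  qed simp
  show "length bs \<le> length us" "sum_list (map length bs) = length us"
    "us \<noteq> [] \<Longrightarrow> bs \<noteq> []" "B \<in> set bs \<Longrightarrow> B \<noteq> []" "B \<in> set bs \<Longrightarrow> set B \<subseteq> set us"
    using *[OF assms] by auto
  show "B \<in> set bs \<Longrightarrow> length B \<le> length us"
    using *[OF assms] member_le_sum_list[of "length B" "map length bs"] by auto
qed

lemma has_derivative_sum_list:
  "(\<And>x. x \<in> set xs \<Longrightarrow> (f x has_derivative f' x) F) \<Longrightarrow>
    ((\<lambda>w. \<Sum>x\<leftarrow>xs. f x w) has_derivative (\<lambda>u. \<Sum>x\<leftarrow>xs. f' x u)) F"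
  by (induction xs) (auto intro!: has_derivative_add)

text \<open>The sum of Faa di Bruno's formula: \<open>F m\<close> stands for the components of the
  \<open>m\<close>-th derivative of the outer function at \<open>\<rho> w\<close>, and
  \<open>q B\<close> for the derivative of the inner map in the directions listed in
  \<open>B\<close>.\<close>

definition chain_sum ::
  "(nat \<Rightarrow> 'f \<Rightarrow> 'f list \<Rightarrow> real) \<Rightarrow> ('e list \<Rightarrow> 'e \<Rightarrow> 'f) \<Rightarrow> ('e \<Rightarrow> 'f) \<Rightarrow> 'e list \<Rightarrow> 'e \<Rightarrow> real" where
  "chain_sum F q \<rho> us w = (\<Sum>bs\<leftarrow>blocks us. F (length bs) (\<rho> w) (map (\<lambda>B. q B w) bs))"

text \<open>The Christoffel terms cancel: \<open>F (Suc m)\<close> subtracts \<open>\<Gamma>\<close>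
  in every slot, and \<open>q (B @ [u])\<close> adds exactly that term to the derivative of
  \<open>q B\<close>. Only terms indexed by extended partitions remain.\<close>

lemma chain_sum_has_derivative:
  fixes F :: "nat \<Rightarrow> 'f::euclidean_space \<Rightarrow> 'f list \<Rightarrow> real" and q :: "'e::euclidean_space list \<Rightarrow> 'e \<Rightarrow> 'f"
  assumes N: "open N" "w \<in> N" and T: "open T" "\<rho> ` N \<subseteq> T"
    and F: "\<And>m. m \<le> n \<Longrightarrow> tensor_on (Suc 0) m T (F m)"
    and F_Suc: "\<And>m. F (Suc m) = cov_deriv_coord \<Gamma> (\<lambda>_ _ _. 0) (F m)"
    and \<rho>: "(\<rho> has_derivative (\<lambda>u. q [u] w)) (at w)"
    and q: "\<And>B. B \<noteq> [] \<Longrightarrow> length B \<le> n \<Longrightarrow> (q B has_derivative q' B) (at w)"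
    and q_snoc: "\<And>B u. B \<noteq> [] \<Longrightarrow> length B \<le> n \<Longrightarrow>
      q (B @ [u]) w = q' B u + \<Gamma> (\<rho> w) (q [u] w) (q B w)"
    and us: "length us \<le> n"
  shows "(chain_sum F q \<rho> us has_derivative (\<lambda>u. chain_sum F q \<rho> (us @ [u]) w)) (at w)"
proof -
  have y: "\<rho> w \<in> T" using N T by auto
  have "((\<lambda>w. F (length bs) (\<rho> w) (map (\<lambda>B. q B w) bs)) has_derivative
    (\<lambda>u. F (length (bs @ [[u]])) (\<rho> w) (map (\<lambda>B. q B w) (bs @ [[u]])) +
      (\<Sum>i<length bs. F (length (bs[i := bs ! i @ [u]])) (\<rho> w) (map (\<lambda>B. q B w) (bs[i := bs ! i @ [u]]))))) (at w)"
    if bs: "bs \<in> set (blocks us)" for bs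
  proof -
    let ?m = "length bs"
    note p = blocks_props[OF bs]
    have m: "?m \<le> n" using p(1) us by simp
    have bi: "bs ! i \<noteq> []" "length (bs ! i) \<le> n" if "i < ?m" for i
      using p(4,5)[OF nth_mem[OF that]] us by auto
    define as where "as = map (\<lambda>B. q B w) bs"
    have as: "length as = ?m" "as = map (\<lambda>i. q (bs ! i) w) [0..<?m]"
      by (auto simp: as_def intro: nth_equalityI)
    have ml: "multilinear ?m (F ?m (\<rho> z))" if "z \<in> N" for z
      using tensor_onD(1)[OF F[OF m]] T(2) that by auto
    have dF: "((\<lambda>w. F ?m (\<rho> w) us') has_derivative
        (\<lambda>u. frechet_derivative (\<lambda>y. F ?m y us') (at (\<rho> w)) (q [u] w))) (at w)" if "length us' = ?m" for us'
      using has_derivative_compose[OF \<rho> Ck_on_Suc_D(2)[OF tensor_onD(2)[OF F[OF m] that] y]] .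
    have dq: "(q (bs ! i) has_derivative q' (bs ! i)) (at w)" if "i < ?m" for i
      by (rule q[OF bi[OF that]])
    have "((\<lambda>z. F ?m (\<rho> z) (map (\<lambda>i. q (bs ! i) z) [0..<?m])) has_derivative
        (\<lambda>u. frechet_derivative (\<lambda>y. F ?m y as) (at (\<rho> w)) (q [u] w) +
          (\<Sum>i<?m. F ?m (\<rho> w) (as[i := q' (bs ! i) u])))) (at w)"
      unfolding as(2) by (rule tensor_fields_has_derivative[OF N ml dF dq])
    moreover have "map (\<lambda>i. q (bs ! i) z) [0..<?m] = map (\<lambda>B. q B z) bs" for z
      by (auto intro: nth_equalityI)
    moreover have "frechet_derivative (\<lambda>y. F ?m y as) (at (\<rho> w)) (q [u] w) +
          (\<Sum>i<?m. F ?m (\<rho> w) (as[i := q' (bs ! i) u])) =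
        F (Suc ?m) (\<rho> w) (as @ [q [u] w]) + (\<Sum>i<?m. F ?m (\<rho> w) (as[i := q (bs ! i @ [u]) w]))" for u
    proof -
      have "F ?m (\<rho> w) (as[i := q (bs ! i @ [u]) w]) =
          F ?m (\<rho> w) (as[i := q' (bs ! i) u]) + F ?m (\<rho> w) (as[i := \<Gamma> (\<rho> w) (q [u] w) (as ! i)])"
        if i: "i < ?m" for i
        using q_snoc[OF bi[OF i], of u] linear_add[OF multilinearD[OF ml[OF N(2)] as(1) i]] i by (simp add: as_def)
      then show ?thesis
        by (simp add: F_Suc cov_deriv_coord_snoc as(1) sum.distrib)
    qed
    ultimately show ?thesis by (simp add: as_def map_update)
  qed
  then show ?thesis
    unfolding chain_sum_def[abs_def] sum_list_blocks_snoc by (rule has_derivative_sum_list)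
qed

text \<open>Ordering the blocks and the entries of each block turns a partition into a permutation
  of \<open>k + 1\<close> entries cut into \<open>j + 1\<close> nonempty runs, whence
  \<open>fact (Suc k) * (k choose j)\<close>. The induction appends one entry instead, and
  \<open>\<phi>\<close> is arbitrary because this step replaces it by
  \<open>?\<psi>\<close>.\<close>

lemma sum_list_fact_blocks:
  fixes \<phi> :: "nat \<Rightarrow> 'b::comm_semiring_1"
  assumes "length us = Suc k"
  shows "(\<Sum>bs\<leftarrow>blocks us. of_nat (fact (length bs) * (\<Prod>B\<leftarrow>bs. fact (length B))) * \<phi> (length bs)) =
    (\<Sum>j\<le>k. of_nat (fact (Suc k) * (k choose j)) * \<phi> (Suc j))"
  using assms
proof (induction k arbitrary: us \<phi>)
  case 0
  then obtain u where "us = [u]" by (cases us) auto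
  then show ?case
    using sum_list_blocks_snoc[of "\<lambda>bs. of_nat (fact (length bs) * (\<Prod>B\<leftarrow>bs. fact (length B))) * \<phi> (length bs)" "[]" u]
    by simp
next
  case (Suc k)
  then obtain us' u where us: "us = us' @ [u]" "length us' = Suc k" by (metis length_Suc_conv_rev)
  let ?w = "\<lambda>bs :: 'a list list. fact (length bs) * (\<Prod>B\<leftarrow>bs. fact (length B)) :: nat"
  \<comment> \<open>With \<open>m\<close> blocks, a new block multiplies the weight by
    \<open>m + 1\<close>. Lengthening a block multiplies it by the new length, and these factors add
    up to \<open>Suc k + m\<close>.\<close>
  let ?\<psi> = "\<lambda>m. of_nat (Suc m) * \<phi> (Suc m) + of_nat (Suc k + m) * \<phi> m"
  have "of_nat (?w (bs @ [[u]])) * \<phi> (length (bs @ [[u]])) +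
      (\<Sum>i<length bs. of_nat (?w (bs[i := bs ! i @ [u]])) * \<phi> (length (bs[i := bs ! i @ [u]]))) =
      of_nat (?w bs) * ?\<psi> (length bs)" if bs: "bs \<in> set (blocks us')" for bs
  proof -
    have upd: "(\<Prod>B\<leftarrow>bs[i := bs ! i @ [u]]. fact (length B)) = Suc (length (bs ! i)) * (\<Prod>B\<leftarrow>bs. fact (length B) :: nat)"
      if "i < length bs" for i
    proof -
      have "(\<Prod>B\<leftarrow>bs. fact (length B)) = (\<Prod>B\<leftarrow>take i bs. fact (length B)) * (fact (length (bs ! i)) * (\<Prod>B\<leftarrow>drop (Suc i) bs. fact (length B) :: nat))"
        by (subst id_take_nth_drop[OF that]) simp
      then show ?thesis using that by (simp add: upd_conv_take_nth_drop algebra_simps)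
    qed
    have "(\<Sum>i<length bs. Suc (length (bs ! i))) = Suc k + length bs"
      using blocks_props(2)[OF bs] us(2)
      by (simp add: sum_Suc sum_list_sum_nth atLeast0LessThan)
    moreover have "(\<Sum>i<length bs. ?w (bs[i := bs ! i @ [u]])) = (\<Sum>i<length bs. Suc (length (bs ! i)) * ?w bs)"
      by (rule sum.cong) (simp_all add: upd algebra_simps)
    ultimately have "(\<Sum>i<length bs. ?w (bs[i := bs ! i @ [u]])) = (Suc k + length bs) * ?w bs"
      by (simp only: sum_distrib_right[symmetric])
    then have step: "(\<Sum>i<length bs. of_nat (?w (bs[i := bs ! i @ [u]])) * \<phi> (length bs)) =
        of_nat ((Suc k + length bs) * ?w bs) * \<phi> (length bs)"
      by (simp only: sum_distrib_right[symmetric] of_nat_sum[symmetric])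
    have "?w (bs @ [[u]]) = Suc (length bs) * ?w bs" by (simp add: algebra_simps)
    then have "of_nat (?w (bs @ [[u]])) * \<phi> (Suc (length bs)) = of_nat (?w bs) * (of_nat (Suc (length bs)) * \<phi> (Suc (length bs)))"
      by (simp only: of_nat_mult mult.assoc mult.left_commute)
    moreover have "of_nat ((Suc k + length bs) * ?w bs) * \<phi> (length bs) =
        of_nat (?w bs) * (of_nat (Suc k + length bs) * \<phi> (length bs))"
      by (simp only: of_nat_mult mult.assoc mult.left_commute)
    ultimately show ?thesis
      using step by (simp only: length_list_update length_append_singleton distrib_left)
  qed
  then have "(\<Sum>bs\<leftarrow>blocks us. of_nat (?w bs) * \<phi> (length bs)) =
      (\<Sum>bs\<leftarrow>blocks us'. of_nat (?w bs) * ?\<psi> (length bs))"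
    unfolding us(1) sum_list_blocks_snoc by (intro arg_cong[where f = sum_list] map_cong) auto
  also have "\<dots> = (\<Sum>j\<le>k. of_nat (fact (Suc k) * (k choose j)) * ?\<psi> (Suc j))"
    by (rule Suc.IH[OF us(2)])
  also have "\<dots> = (\<Sum>j\<le>k. of_nat (fact (Suc k) * (k choose j) * (j + 2)) * \<phi> (Suc (Suc j))) +
      (\<Sum>j\<le>k. of_nat (fact (Suc k) * (k choose j) * (k + j + 2)) * \<phi> (Suc j))"
    by (simp add: sum.distrib[symmetric] algebra_simps)
  also have "\<dots> = (\<Sum>j\<le>Suc k. of_nat (fact (Suc (Suc k)) * (Suc k choose j)) * \<phi> (Suc j))"
  proof -
    \<comment> \<open>The coefficients of the first sum after shifting its index by one;
      \<open>j = 0\<close> receives nothing.\<close>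
    let ?a = "\<lambda>j. (case j of 0 \<Rightarrow> 0 | Suc i \<Rightarrow> (fact (Suc k) * (k choose i) * (i + 2) :: nat))"
    have "(\<Sum>j\<le>k. of_nat (fact (Suc k) * (k choose j) * (j + 2)) * \<phi> (Suc (Suc j))) =
        (\<Sum>j\<le>Suc k. of_nat (?a j) * \<phi> (Suc j))"
      by (simp add: sum.atMost_Suc_shift del: sum.atMost_Suc)
    \<comment> \<open>The range can be extended because \<open>k choose Suc k\<close> is
      zero.\<close>
    moreover have "(\<Sum>j\<le>k. of_nat (fact (Suc k) * (k choose j) * (k + j + 2)) * \<phi> (Suc j)) =
        (\<Sum>j\<le>Suc k. of_nat (fact (Suc k) * (k choose j) * (k + j + 2)) * \<phi> (Suc j))"
      by (simp only: sum.atMost_Suc binomial_eq_0[OF lessI] mult_0_right mult_0 of_nat_0 mult_zero_left add_0_right)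
    moreover have "?a j + fact (Suc k) * (k choose j) * (k + j + 2) = fact (Suc (Suc k)) * (Suc k choose j)"
      if "j \<le> Suc k" for j
    proof (cases j)
      case (Suc i)
      from that Suc have "i \<le> k" by simp
      \<comment> \<open>Writing \<open>k = i + d\<close> keeps the absorption identities free of
        subtraction on natural numbers.\<close>
      then obtain d where d: "k = i + d" using le_Suc_ex by blast
      have "Suc i * (k choose Suc i) = d * (k choose i)"
        using binomial_absorption[of i k] binomial_absorb_comp[of k i] by (simp add: d)
      then have "(k choose i) * (i + 2) + (k choose Suc i) * (k + i + 3) = (k + 2) * (Suc k choose Suc i)"
        by (simp add: d algebra_simps)
      then have "fact (Suc k) * ((k choose i) * (i + 2) + (k choose Suc i) * (k + i + 3)) =
          fact (Suc k) * (k + 2) * (Suc k choose Suc i)"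
        by (simp only: mult.assoc)
      moreover have "fact (Suc (Suc k)) = fact (Suc k) * (k + 2)"
        by (simp add: fact_Suc[of "Suc k"] mult.commute del: fact_Suc)
      ultimately show ?thesis
        unfolding Suc by (simp only: nat.case distrib_left mult.assoc) (simp add: algebra_simps del: fact_Suc)
    qed simp
    ultimately show ?thesis
      by (simp only: sum.distrib[symmetric] distrib_right[symmetric] of_nat_add[symmetric]) (intro sum.cong; simp)
  qed
  finally show ?case .
qed

section \<open>Derivatives on a tangent space\<close>

text \<open>\<open>space_deriv\<close> is a choice that is determined on \<open>W\<close> only.
  There, \<open>w\<close> is scaled into both neighbourhoods, and dividing by the factor bounds the
  difference by any \<open>e\<close>.\<close>

lemma has_space_deriv_unique:
  assumes scale: "\<And>r w. w \<in> W \<Longrightarrow> tscale r w \<in> W" "\<And>r w. w \<in> W \<Longrightarrow> N (tscale r w) = \<bar>r\<bar> * N w"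
    and L: "has_space_deriv W N h v L" and L': "has_space_deriv W N h v L'" and w: "w \<in> W" "N w \<ge> 0"
  shows "L w = L' w"
proof -
  have "\<bar>L w - L' w\<bar> \<le> e" if e: "e > 0" for e
  proof -
    \<comment> \<open>The summand 1, here and in \<open>s\<close>, keeps the denominator positive
      when \<open>N w\<close> is zero.\<close>
    define \<epsilon> where "\<epsilon> = e / (2 * (N w + 1))"
    have \<epsilon>: "\<epsilon> > 0" using e w by (simp add: \<epsilon>_def)
    have "\<exists>\<delta>>0. \<forall>w\<in>W. N w < \<delta> \<longrightarrow> \<bar>h (v + w) - h v - L w\<bar> \<le> \<epsilon> * N w"
      using L \<epsilon> unfolding has_space_deriv_def by blast
    then obtain \<delta> where \<delta>: "\<delta> > 0" "\<And>w. w \<in> W \<Longrightarrow> N w < \<delta> \<Longrightarrow> \<bar>h (v + w) - h v - L w\<bar> \<le> \<epsilon> * N w"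
      by blast
    have "\<exists>\<delta>>0. \<forall>w\<in>W. N w < \<delta> \<longrightarrow> \<bar>h (v + w) - h v - L' w\<bar> \<le> \<epsilon> * N w"
      using L' \<epsilon> unfolding has_space_deriv_def by blast
    then obtain \<delta>' where \<delta>': "\<delta>' > 0" "\<And>w. w \<in> W \<Longrightarrow> N w < \<delta>' \<Longrightarrow> \<bar>h (v + w) - h v - L' w\<bar> \<le> \<epsilon> * N w"
      by blast
    define s where "s = min \<delta> \<delta>' / (N w + 1)"
    have s: "s > 0" using \<delta>(1) \<delta>'(1) w by (simp add: s_def)
    have "s * N w < s * (N w + 1)" using s by simp
    also have "\<dots> = min \<delta> \<delta>'" using w by (simp add: s_def)
    finally have sm: "N (tscale s w) < \<delta>" "N (tscale s w) < \<delta>'" using scale(2)[OF w(1)] s by auto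
    have "L (tscale s w) = s * L w" "L' (tscale s w) = s * L' w"
      using L L' w unfolding has_space_deriv_def by blast+
    then have "s * \<bar>L w - L' w\<bar> = \<bar>L (tscale s w) - L' (tscale s w)\<bar>"
      using s by (simp add: abs_mult right_diff_distrib[symmetric])
    also have "\<dots> \<le> 2 * (\<epsilon> * N (tscale s w))"
      using \<delta>(2)[OF scale(1)[OF w(1)] sm(1)] \<delta>'(2)[OF scale(1)[OF w(1)] sm(2)] by linarith
    also have "\<dots> = s * (2 * \<epsilon> * N w)" using scale(2)[OF w(1)] s by simp
    finally have "\<bar>L w - L' w\<bar> \<le> 2 * \<epsilon> * N w" using s by simp
    also have "\<dots> \<le> 2 * \<epsilon> * (N w + 1)" using \<epsilon> by simp
    also have "\<dots> = e" using w by (simp add: \<epsilon>_def field_simps)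
    finally show ?thesis .
  qed
  then have "\<bar>L w - L' w\<bar> \<le> 0" by (rule field_le_epsilon) simp
  then show ?thesis by simp
qed

section \<open>Derivatives on a tangent space computed in a chart\<close>

context
  fixes A :: "('m, 'e::euclidean_space) chart set" and g
  assumes saA: "smooth_atlas A" and g: "riemannian_metric A g"
begin

lemma metric_norm_scale:
  assumes "x \<in> carrier A" "w \<in> tspace A x"
  shows "metric_norm g x (tscale r w) = \<bar>r\<bar> * metric_norm g x w"
proof -
  note s = tspace_scale[OF saA assms(2)]
  have "g x (tscale r w) (tscale r w) = r * g x w (tscale r w)"
    by (rule metric_at(2)[OF saA g assms(1,2,2) s])
  also have "g x w (tscale r w) = g x (tscale r w) w" by (rule metric_at(3)[OF saA g assms(1,2) s assms(2)])
  also have "\<dots> = r * g x w w" by (rule metric_at(2)[OF saA g assms(1,2,2,2)])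
  finally have "g x (tscale r w) (tscale r w) = r\<^sup>2 * g x w w" by (simp only: power2_eq_square mult.assoc)
  then show ?thesis by (simp only: metric_norm_def real_sqrt_mult real_sqrt_abs)
qed

lemma metric_norm_pos:
  assumes "x \<in> carrier A" "w \<in> tspace A x"
  shows "w \<noteq> 0 \<Longrightarrow> metric_norm g x w > 0" "metric_norm g x w \<ge> 0"
proof -
  show "w \<noteq> 0 \<Longrightarrow> metric_norm g x w > 0"
    using metric_at(4)[OF saA g assms(1,2,2,2)] by (simp add: metric_norm_def)
  moreover have "metric_norm g x 0 \<ge> 0"
    using metric_norm_scale[OF assms(1) tspace_0[OF saA], of "- 1"]
      metric_norm_scale[OF assms(1) tspace_0[OF saA], of 0] by (simp add: tscale_def zero_fun_def)
  ultimately show "metric_norm g x w \<ge> 0" by (cases "w = 0") auto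
qed

text \<open>Comparison of norms by compactness: \<open>1 / K\<close> is the square root of the
  minimum of the metric on the Euclidean unit sphere.\<close>

lemma norm_le_metric_norm:
  assumes c: "c \<in> A" "x \<in> cdom c"
  obtains K where "K > 0" "\<And>w. w \<in> tspace A x \<Longrightarrow> norm (w c) \<le> K * metric_norm g x w"
proof -
  let ?m = "metric_coord A g c (crd c x)"
  have z: "crd c x \<in> crd c ` cdom c" using c by auto
  have xc: "x \<in> carrier A" using c by (auto simp: carrier_def)
  note lin = metric_coord_linear[OF saA g c(1) z]
  \<comment> \<open>In the basis the form is a polynomial in the coordinates, hence
    continuous.\<close>
  have "?m a a = (\<Sum>i\<in>Basis. (a \<bullet> i) *\<^sub>R (\<Sum>j\<in>Basis. (a \<bullet> j) *\<^sub>R ?m i j))" for a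
    using linear_euclidean_expand[OF lin(2), of a] linear_euclidean_expand[OF lin(1)] by (metis (no_types, lifting) sum.cong)
  then have cont: "continuous_on (sphere 0 1) (\<lambda>a. ?m a a)"
    by (simp only:) (intro continuous_intros)
  have ne: "sphere (0::'e) 1 \<noteq> {}" by simp
  from continuous_attains_inf[OF compact_sphere ne cont]
  obtain b where b: "b \<in> sphere 0 1" "\<And>a. a \<in> sphere 0 1 \<Longrightarrow> ?m b b \<le> ?m a a" by blast
  then have "b \<noteq> 0" by auto
  then have pos: "?m b b > 0" by (rule metric_coord_bilinear(4)[OF saA g c(1) z])
  show ?thesis
  proof
    show "1 / sqrt (?m b b) > 0" using pos by simp
    fix w assume w: "w \<in> tspace A x"
    let ?a = "w c"
    have mn: "metric_norm g x w = sqrt (?m ?a ?a)"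
      by (simp add: metric_norm_def metric_coord_def cinv_crd[OF saA c] tspace_eq_tvec_of[OF saA w c])
    show "norm (w c) \<le> 1 / sqrt (?m b b) * metric_norm g x w"
    proof (cases "?a = 0")
      case True
      then show ?thesis using metric_norm_pos(2)[OF xc w] pos by simp
    next
      case False
      let ?u = "(1 / norm ?a) *\<^sub>R ?a"
      have "?m b b \<le> ?m ?u ?u" by (rule b(2)) (use False in simp)
      also have "\<dots> = (1 / norm ?a)\<^sup>2 * ?m ?a ?a"
        using linear_scale[OF lin(1)] linear_scale[OF lin(2)] by (simp add: power2_eq_square)
      finally have "(norm ?a)\<^sup>2 * ?m b b \<le> ?m ?a ?a"
        using False by (simp add: field_simps power2_eq_square)
      then have "sqrt ((norm ?a)\<^sup>2 * ?m b b) \<le> sqrt (?m ?a ?a)" by (rule real_sqrt_le_mono)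
      then show ?thesis using pos by (simp add: mn real_sqrt_mult field_simps)
    qed
  qed
qed

text \<open>\<open>has_derivative\<close> measures with the Euclidean norm,
  \<open>has_space_deriv\<close> with the one of the metric. The constant \<open>K\<close> is spent
  twice, on the error and on the radius, hence \<open>e / K\<close> and
  \<open>\<delta> / K\<close>.\<close>

lemma space_deriv_coord:
  assumes c: "c \<in> A" "x \<in> cdom c"
    and L: "((\<lambda>a. h (tvec_of A c x a)) has_derivative L) (at w)"
  shows "space_deriv (tspace A x) (metric_norm g x) h (tvec_of A c x w) (tvec_of A c x u) = L u"
proof -
  let ?W = "tspace A x" and ?N = "metric_norm g x" and ?t = "tvec_of A c x"
  have xc: "x \<in> carrier A" using c by (auto simp: carrier_def)
  have lin: "linear L" using L has_derivative_linear by blast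
  obtain K where K: "K > 0" "\<And>w. w \<in> ?W \<Longrightarrow> norm (w c) \<le> K * ?N w"
    using norm_le_metric_norm[OF c] by blast
  have "has_space_deriv ?W ?N h (?t w) (\<lambda>v. L (v c))"
    unfolding has_space_deriv_def
  proof (intro conjI ballI allI impI)
    show "L ((v + v') c) = L (v c) + L (v' c)" for v v' using linear_add[OF lin] by simp
    show "L (tscale r v c) = r * L (v c)" for r v using linear_scale[OF lin] by simp
    fix e :: real assume e: "e > 0"
    then have "e / K > 0" using K by simp
    then obtain \<delta> where \<delta>: "\<delta> > 0" "\<And>y. norm (y - w) < \<delta> \<Longrightarrow>
        norm (h (?t y) - h (?t w) - L (y - w)) \<le> e / K * norm (y - w)"
      using L unfolding has_derivative_at_alt by blast
    show "\<exists>\<delta>>0. \<forall>v\<in>?W. ?N v < \<delta> \<longrightarrow> \<bar>h (?t w + v) - h (?t w) - L (v c)\<bar> \<le> e * ?N v"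
    proof (intro exI conjI ballI impI)
      show "\<delta> / K > 0" using \<delta> K by simp
      fix v assume v: "v \<in> ?W" "?N v < \<delta> / K"
      have tv: "?t w + v = ?t (w + v c)"
        using tvec_of_linear(1)[OF saA c, of w "v c"] tspace_eq_tvec_of[OF saA v(1) c] by simp
      have "norm (v c) < \<delta>" using K(2)[OF v(1)] v(2) K(1) by (simp add: field_simps)
      then have "\<bar>h (?t w + v) - h (?t w) - L (v c)\<bar> \<le> e / K * norm (v c)"
        using \<delta>(2)[of "w + v c"] by (simp add: tv)
      also have "\<dots> \<le> e / K * (K * ?N v)" using K e v by (intro mult_left_mono) auto
      also have "\<dots> = e * ?N v" using K by simp
      finally show "\<bar>h (?t w + v) - h (?t w) - L (v c)\<bar> \<le> e * ?N v" .
    qed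
  qed
  moreover from this have "has_space_deriv ?W ?N h (?t w) (space_deriv ?W ?N h (?t w))"
    unfolding space_deriv_def by (rule someI[where P = "has_space_deriv ?W ?N h (?t w)"])
  ultimately have "space_deriv ?W ?N h (?t w) (?t u) = L (?t u c)"
    by (intro has_space_deriv_unique[of ?W ?N, OF tspace_scale[OF saA] metric_norm_scale[OF xc] _ _
          tvec_of_tspace[OF saA c] metric_norm_pos(2)[OF xc tvec_of_tspace[OF saA c]]])
  then show ?thesis by (simp add: tvec_of_self[OF saA c])
qed

end

section \<open>The chain rule on the fibres\<close>

text \<open>The pullback connection is prescribed on fields composed with \<open>R\<close>, and the
  frame along \<open>R\<close> consists of such fields. So its symbols are those of \<open>D\<close>
  at the image point, in the direction of the differential of \<open>R\<close>.\<close>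

lemma christoffel_pullback:
  assumes saT: "smooth_atlas T" and saA: "smooth_atlas A" and sm: "smooth_map T A R"
    and pb: "pullback_connection T A R D DR"
    and C: "C \<in> T" "P \<in> cdom C" and d: "d \<in> A" "R P \<in> cdom d"
  shows "christoffel T A R DR C d (crd C P) a w = christoffel A A (\<lambda>x. x) D d d (crd d (R P))
    (frechet_derivative (\<lambda>q. crd d (R (cinv C q))) (at (crd C P)) a) w"
proof -
  let ?a = "frechet_derivative (\<lambda>q. crd d (R (cinv C q))) (at (crd C P)) a"
  note t = tvec_of_tspace[OF saT C]
  have "tmap T A R P (tvec_of T C P a) = tvec_of A d (R P) ?a"
    by (rule tspace_eqI[OF saA tmap_tspace[OF saT saA sm C t] tvec_of_tspace[OF saA d] d])
      (simp add: tmap_coord[OF saT saA sm C(1) d(1) C(2) d(2) t] tvec_of_self[OF saT C] tvec_of_self[OF saA d])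
  moreover have "DR P (tvec_of T C P a) ((\<lambda>y. tvec_of A d y b) \<circ> R) =
      D (R P) (tmap T A R P (tvec_of T C P a)) (\<lambda>y. tvec_of A d y b)" for b
  proof -
    have "P \<in> carrier T" using C by (auto simp: carrier_def)
    from bspec[OF bspec[OF mp[OF spec[OF conjunct2[OF pb[unfolded pullback_connection_def]]]
          openin_cdom[OF saA d(1)]] const_field[OF saA d(1) openin_cdom[OF saA d(1)] subset_refl]] this]
    show ?thesis using d(2) t by blast
  qed
  ultimately show ?thesis
    unfolding christoffel_def by (simp add: cinv_crd[OF saT C] cinv_crd[OF saA d] o_def)
qed

lemma multilinear_scale:
  assumes T: "multilinear n T"
  shows "T (map (\<lambda>i. r i *\<^sub>R a i) [0..<n]) = (\<Prod>i<n. r i) *\<^sub>R T (map a [0..<n])"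
proof -
  let ?M = "\<lambda>j. mixed n j (\<lambda>i _. r i *\<^sub>R a i) (map a [0..<n]) ()"
  have "T (?M j) = (\<Prod>i<j. r i) *\<^sub>R T (map a [0..<n])" if "j \<le> n" for j
    using that
  proof (induction j)
    case 0
    then show ?case by (simp add: mixed_0)
  next
    case (Suc j)
    then have j: "j < n" by simp
    have "(?M j)[j := a j] = ?M j" using j by (auto simp: mixed_def intro!: nth_equalityI simp: nth_list_update)
    then show ?case
      using Suc linear_scale[OF multilinearD[OF T _ j, of "?M j"], of "r j" "a j"]
      by (simp add: mixed_Suc mult.commute)
  qed
  from this[of n] show ?thesis by (simp add: mixed_full)
qed

context
  fixes A :: "('m, 'e::euclidean_space) chart set" and g D G DT f R DR K
  assumes saA: "smooth_atlas A" and g: "riemannian_metric A g" and lc: "levi_civita A g D"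
    and sasaki: "sasaki_metric A g D G" and lcT: "levi_civita (tangent_atlas A) G DT"
    and f: "Ck_fun A K (carrier A) f" and sm: "smooth_map (tangent_atlas A) A R"
    and pb: "pullback_connection (tangent_atlas A) A R D DR"
begin

lemmas conn = lc_conn[OF saA g lc]
lemmas saT = smooth_tangent_atlas[OF saA]
lemmas connT = lc_conn[OF saT sasaki_riemannian[OF saA g lc sasaki lcT] lcT]
lemmas connR = conjunct1[OF pb[unfolded pullback_connection_def]]
lemmas map_rep_R = cov_deriv_map_coord[OF saT connT saA sm connR]

text \<open>The operator norm sees unit vectors only, so the arguments are normalised and the
  factors recovered by multilinearity of the components. A zero argument cannot be normalised, but
  it makes the value zero.\<close>

lemma op_norm_fun_bound:
  assumes m: "m \<le> K" and y: "y \<in> carrier A" and Qs: "length Qs = m" "set Qs \<subseteq> tspace A y"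
  shows "ennreal \<bar>cov_deriv_fun A D f m y Qs\<bar> \<le>
    op_norm m (tspace A y) (metric_norm g y) abs (cov_deriv_fun A D f m y) *
    (\<Prod>Q\<leftarrow>Qs. ennreal (metric_norm g y Q))"
proof -
  obtain d where d: "d \<in> A" "y \<in> cdom d" using y by (rule carrierE[OF saA])
  let ?F = "fun_coord A D f d m (crd d y)"
  let ?N = "metric_norm g y"
  have ml: "multilinear m ?F" using tensor_onD(1)[OF fun_coord_tensor[OF saA conn f d(1) m]] d by auto
  note rep = cov_deriv_fun_coord[OF saA conn f d(1) m d(2)]
  have Qi: "Qs ! i \<in> tspace A y" if "i < m" for i using Qs that nth_mem by fastforce
  show ?thesis
  proof (cases "0 \<in> set Qs")
    case True
    then obtain i where i: "i < m" "Qs ! i = 0" using Qs by (metis in_set_conv_nth)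
    have "?F ((map (\<lambda>v. v d) Qs)[i := 0]) = 0"
      using linear_0[OF multilinearD[OF ml _ i(1)]] Qs by simp
    moreover have "(map (\<lambda>v. v d) Qs)[i := 0] = map (\<lambda>v. v d) Qs"
      using i Qs by (auto simp: nth_list_update intro!: nth_equalityI)
    ultimately show ?thesis using rep[OF Qs] by simp
  next
    case False
    have Np: "?N (Qs ! i) > 0" if "i < m" for i
      using metric_norm_pos(1)[OF saA g y Qi[OF that]] False Qs that nth_mem by metis
    let ?U = "map (\<lambda>i. tscale (1 / ?N (Qs ! i)) (Qs ! i)) [0..<m]"
    have U: "length ?U = m" "set ?U \<subseteq> tspace A y" "\<forall>w\<in>set ?U. w \<in> tspace A y \<and> ?N w = 1"
      using tspace_scale[OF saA Qi] metric_norm_scale[OF saA g y Qi] Np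
      by (auto simp: less_imp_le order_less_imp_not_eq2)
    have "map (\<lambda>i. ?N (Qs ! i) *\<^sub>R (1 / ?N (Qs ! i)) *\<^sub>R (Qs ! i) d) [0..<m] = map (\<lambda>v. v d) Qs"
      using Np Qs by (auto intro!: nth_equalityI simp: order_less_imp_not_eq2)
    then have "cov_deriv_fun A D f m y Qs = (\<Prod>i<m. ?N (Qs ! i)) * cov_deriv_fun A D f m y ?U"
      using multilinear_scale[OF ml, of "\<lambda>i. ?N (Qs ! i)" "\<lambda>i. (1 / ?N (Qs ! i)) *\<^sub>R (Qs ! i) d"]
      by (simp add: rep[OF Qs] rep[OF U(1,2)] o_def)
    moreover have "(\<Prod>i<m. ?N (Qs ! i)) \<ge> 0" by (intro prod_nonneg) (use Np in \<open>auto intro: less_imp_le\<close>)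
    ultimately have "ennreal \<bar>cov_deriv_fun A D f m y Qs\<bar> =
        ennreal \<bar>cov_deriv_fun A D f m y ?U\<bar> * ennreal (\<Prod>i<m. ?N (Qs ! i))"
      by (simp add: abs_mult ennreal_mult'' mult.commute)
    also have "ennreal (\<Prod>i<m. ?N (Qs ! i)) = (\<Prod>i<m. ennreal (?N (Qs ! i)))"
      by (rule prod_ennreal[symmetric]) (use Np in \<open>auto intro: less_imp_le\<close>)
    also have "\<dots> = (\<Prod>Q\<leftarrow>Qs. ennreal (?N Q))"
      using Qs by (simp add: prod.list_conv_set_nth atLeast0LessThan)
    also have "ennreal \<bar>cov_deriv_fun A D f m y ?U\<bar> \<le> op_norm m (tspace A y) ?N abs (cov_deriv_fun A D f m y)"
      unfolding op_norm_def by (rule SUP_upper) (use U in blast)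
    finally show ?thesis by (simp add: mult_right_mono)
  qed
qed

context
  fixes c d x w0
  assumes c: "c \<in> A" "x \<in> cdom c" and d: "d \<in> A" "R (x, tvec_of A c x w0) \<in> cdom d"
begin

text \<open>The entry at \<open>d\<close> of the covariant derivative of \<open>R\<close> on
  vertical lifts, as a function of the fibre point \<open>a\<close>: \<open>Pair 0\<close> yields
  the coordinates of a vertical lift.\<close>

definition fibre_coord :: "'e list \<Rightarrow> 'e \<Rightarrow> 'e" where
  "fibre_coord B a = map_coord (tangent_atlas A) DT A R DR (length B) (tangent_chart A c) d
    (crd c x, a) (map (Pair 0) B)"

definition fibre_map :: "'e \<Rightarrow> 'e" where
  "fibre_map a = crd d (R (x, tvec_of A c x a))"

definition fibre_dom :: "'e set" where
  "fibre_dom = {a. R (x, tvec_of A c x a) \<in> cdom d}"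

lemma fibre_chart:
  "(x, tvec_of A c x a) \<in> cdom (tangent_chart A c)"
  "crd (tangent_chart A c) (x, tvec_of A c x a) = (crd c x, a)"
  "cinv (tangent_chart A c) (crd c x, a) = (x, tvec_of A c x a)"
proof -
  show *: "(x, tvec_of A c x a) \<in> cdom (tangent_chart A c)"
    "crd (tangent_chart A c) (x, tvec_of A c x a) = (crd c x, a)"
    using c tvec_of_tspace[OF saA c] tvec_of_self[OF saA c]
    by (simp_all add: cdom_tangent_chart crd_tangent_chart)
  show "cinv (tangent_chart A c) (crd c x, a) = (x, tvec_of A c x a)"
    using cinv_crd[OF saT tangent_chart_in[OF saA c(1)] *(1)] *(2) by metis
qed

lemma fibre_dom_iff: "a \<in> fibre_dom \<longleftrightarrow>
  (crd c x, a) \<in> crd (tangent_chart A c) ` {q \<in> cdom (tangent_chart A c). R q \<in> cdom d}"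
proof
  assume "a \<in> fibre_dom"
  then have "(x, tvec_of A c x a) \<in> {q \<in> cdom (tangent_chart A c). R q \<in> cdom d}"
    using fibre_chart(1)[of a] by (simp add: fibre_dom_def)
  from imageI[OF this, of "crd (tangent_chart A c)"]
  show "(crd c x, a) \<in> crd (tangent_chart A c) ` {q \<in> cdom (tangent_chart A c). R q \<in> cdom d}"
    unfolding fibre_chart(2) .
next
  assume "(crd c x, a) \<in> crd (tangent_chart A c) ` {q \<in> cdom (tangent_chart A c). R q \<in> cdom d}"
  then obtain q where q0: "(crd c x, a) = crd (tangent_chart A c) q"
    "q \<in> {q \<in> cdom (tangent_chart A c). R q \<in> cdom d}" by (rule imageE)
  then have q: "q \<in> cdom (tangent_chart A c)" "R q \<in> cdom d" by simp_all
  have "q = (x, tvec_of A c x a)"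
    using cinv_crd[OF saT tangent_chart_in[OF saA c(1)] q(1)] fibre_chart(3)[of a] q0(1) by simp
  then show "a \<in> fibre_dom" using q by (simp add: fibre_dom_def)
qed

lemma open_fibre_dom: "open fibre_dom"
proof -
  have "fibre_dom = Pair (crd c x) -` (crd (tangent_chart A c) ` {q \<in> cdom (tangent_chart A c). R q \<in> cdom d})"
    using fibre_dom_iff by auto
  then show ?thesis
    using continuous_open_vimage[OF open_preimage_dom[OF saT saA sm tangent_chart_in[OF saA c(1)] d(1)],
      of "Pair (crd c x)"] by (simp add: continuous_intros)
qed

lemma fibre_has_derivative:
  assumes "(h has_derivative L) (at (crd c x, a))"
  shows "((\<lambda>a. h (crd c x, a)) has_derivative (\<lambda>u. L (0, u))) (at a)"
  by (rule has_derivative_compose[OF has_derivative_Pair[OF has_derivative_const has_derivative_ident] assms])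

text \<open>What has to be supplied to the abstract chain rule is the recursion for
  \<open>fibre_coord (B @ [u])\<close>: an ordinary derivative along the fibre plus one term with
  the symbols of the base manifold.\<close>

lemma fibre_chain_sum_has_derivative:
  assumes w: "w \<in> fibre_dom" and us: "length us < K"
  shows "(chain_sum (fun_coord A D f d) fibre_coord fibre_map us has_derivative
    (\<lambda>u. chain_sum (fun_coord A D f d) fibre_coord fibre_map (us @ [u]) w)) (at w)"
proof -
  let ?C = "tangent_chart A c"
  let ?P = "(crd c x, w)"
  let ?S = "crd ?C ` {q \<in> cdom ?C. R q \<in> cdom d}"
  let ?mc = "\<lambda>k. map_coord (tangent_atlas A) DT A R DR k ?C d"
  let ?r = "\<lambda>q. crd d (R (cinv ?C q))"
  let ?\<Gamma>T = "christoffel (tangent_atlas A) (tangent_atlas A) (\<lambda>x. x) DT ?C ?C"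
  let ?\<Lambda> = "christoffel (tangent_atlas A) A R DR ?C d"
  let ?\<Gamma> = "christoffel A A (\<lambda>x. x) D d d"
  note C = tangent_chart_in[OF saA c(1)]
  have P: "?P \<in> ?S" using w fibre_dom_iff by blast
  have Rw: "R (x, tvec_of A c x w) \<in> cdom d" using w by (simp add: fibre_dom_def)
  have dr: "(?r has_derivative frechet_derivative ?r (at ?P)) (at ?P)"
    by (rule smooth_on_diff(2)[OF smooth_map_rep[OF saT saA sm C d(1)] P])
  have q1: "fibre_coord [u] w = frechet_derivative ?r (at ?P) (0, u)" for u
    by (simp add: fibre_coord_def map_coord_def[OF saT connT saA sm connR])
  have fm: "fibre_map a = ?r (crd c x, a)" for a
    by (simp add: fibre_map_def fibre_chart(3))
  have tens: "tensor_on k (length B) ?S (?mc (length B))" if "B \<noteq> []" for B :: "'e list" and k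
  proof -
    obtain l where l: "length B = Suc l" using \<open>B \<noteq> []\<close> by (cases B) auto
    show ?thesis unfolding l by (rule map_repD(2)[OF saT connT saA sm connR map_rep_R C d(1)])
  qed
  let ?q' = "\<lambda>B u. frechet_derivative (\<lambda>q. ?mc (length B) q (map (Pair 0) B)) (at ?P) (0, u)"
  have q': "(fibre_coord B has_derivative ?q' B) (at w)" if "B \<noteq> []" for B
  proof -
    have "((\<lambda>q. ?mc (length B) q (map (Pair 0) B)) has_derivative
        frechet_derivative (\<lambda>q. ?mc (length B) q (map (Pair 0) B)) (at ?P)) (at ?P)"
      by (rule Ck_on_Suc_D(2)[OF tensor_onD(2)[OF tens[OF that]] P]) simp
    from fibre_has_derivative[OF this] show ?thesis by (simp add: fibre_coord_def[abs_def])
  qed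
  have q_snoc: "fibre_coord (B @ [u]) w = ?q' B u + ?\<Gamma> (fibre_map w) (fibre_coord [u] w) (fibre_coord B w)"
    if B: "B \<noteq> []" for B u
  proof -
    obtain l where l: "length B = Suc l" using B by (cases B) auto
    have "fibre_coord (B @ [u]) w = cov_deriv_coord ?\<Gamma>T ?\<Lambda> (?mc (length B)) ?P (map (Pair 0) B @ [(0, u)])"
      by (simp add: fibre_coord_def l map_coord_def[OF saT connT saA sm connR])
    also have "\<dots> = ?q' B u + ?\<Lambda> ?P (0, u) (fibre_coord B w)
        - (\<Sum>i<length B. ?mc (length B) ?P ((map (Pair 0) B)[i := ?\<Gamma>T ?P (0, u) (map (Pair 0) B ! i)]))"
      by (simp add: cov_deriv_coord_snoc fibre_coord_def)
    \<comment> \<open>The corrections on the argument side vanish together with the Christoffel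
      symbols on vertical pairs; otherwise arguments that are not vertical lifts could
      enter.\<close>
    also have "(\<Sum>i<length B. ?mc (length B) ?P ((map (Pair 0) B)[i := ?\<Gamma>T ?P (0, u) (map (Pair 0) B ! i)])) = 0"
    proof (intro sum.neutral ballI)
      fix i assume "i \<in> {..<length B}"
      then have i: "i < length B" by simp
      have "?\<Gamma>T ?P (0, u) (map (Pair 0) B ! i) = 0"
        using christoffel_vertical[OF saA g lc sasaki lcT c] i by simp
      then show "?mc (length B) ?P ((map (Pair 0) B)[i := ?\<Gamma>T ?P (0, u) (map (Pair 0) B ! i)]) = 0"
        using linear_0[OF multilinearD[OF tensor_onD(1)[OF tens[OF B] P] _ i], of "map (Pair 0) B"] by simp
    qed
    \<comment> \<open>On the value side the pullback formula yields the very
      \<open>?\<Gamma>\<close> that \<open>fun_coord\<close> subtracts, at the image point and in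
      the direction \<open>fibre_coord [u] w\<close>.\<close>
    also have "?\<Lambda> ?P (0, u) (fibre_coord B w) = ?\<Gamma> (fibre_map w) (fibre_coord [u] w) (fibre_coord B w)"
      using christoffel_pullback[OF saT saA sm pb C fibre_chart(1) d(1) Rw] q1
      by (simp add: fibre_chart(2) fibre_map_def)
    finally show ?thesis by simp
  qed
  show ?thesis
  \<comment> \<open>Only tensors of order at most \<open>K - 1\<close> are differentiated, and each
    still has one derivative left.\<close>
  proof (rule chain_sum_has_derivative[where n = "K - 1" and N = fibre_dom and T = "crd d ` cdom d"
        and \<Gamma> = ?\<Gamma> and q' = ?q'])
    show "open fibre_dom" by (rule open_fibre_dom)
    show "open (crd d ` cdom d)" by (rule atlas_open_dom[OF saA d(1)])
    show "fibre_map ` fibre_dom \<subseteq> crd d ` cdom d" by (auto simp: fibre_map_def fibre_dom_def)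
    show "tensor_on (Suc 0) m (crd d ` cdom d) (fun_coord A D f d m)" if "m \<le> K - 1" for m
      by (rule tensor_on_le[OF fun_coord_tensor[OF saA conn f d(1)]]) (use that us in auto)
    show "fun_coord A D f d (Suc m) = cov_deriv_coord ?\<Gamma> (\<lambda>_ _ _. 0) (fun_coord A D f d m)" for m
      by (simp add: fun_coord_def[OF saA conn])
    show "(fibre_map has_derivative (\<lambda>u. fibre_coord [u] w)) (at w)"
      using fibre_has_derivative[OF dr] by (simp add: q1 fm[abs_def])
  qed (use w q' q_snoc us in auto)
qed

text \<open>The identity is needed on all of the open set \<open>fibre_dom\<close>, not just at
  \<open>w0\<close>, because the next derivative is taken of both sides as functions of
  \<open>w\<close>.\<close>

lemma space_nderiv_chain_sum:
  assumes "k \<le> K" "length us = k" "w \<in> fibre_dom"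
  shows "space_nderiv (tspace A x) (metric_norm g x) k (pullback_fun f R x) (tvec_of A c x w)
      (map (tvec_of A c x) us) = chain_sum (fun_coord A D f d) fibre_coord fibre_map us w"
  using assms
proof (induction k arbitrary: us w)
  case 0
  then have "R (x, tvec_of A c x w) \<in> cdom d" by (simp add: fibre_dom_def)
  then show ?case
    using 0 cinv_crd[OF saA d(1)]
    by (simp add: pullback_fun_def chain_sum_def fun_coord_def[OF saA conn] fibre_map_def)
next
  case (Suc k)
  then obtain us' u where us: "us = us' @ [u]" "length us' = k" by (metis length_Suc_conv_rev)
  let ?h = "\<lambda>v. space_nderiv (tspace A x) (metric_norm g x) k (pullback_fun f R x) v (map (tvec_of A c x) us')"
  have "((\<lambda>a. ?h (tvec_of A c x a)) has_derivative
      (\<lambda>u. chain_sum (fun_coord A D f d) fibre_coord fibre_map (us' @ [u]) w)) (at w)"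
    by (rule has_derivative_transform_within_open[OF
          fibre_chain_sum_has_derivative[OF Suc.prems(3)] open_fibre_dom Suc.prems(3)])
      (use Suc us in auto)
  from space_deriv_coord[OF saA g c this, of u] show ?case by (simp add: us)
qed

text \<open>Components in \<open>c\<close> and \<open>d\<close> carry no invariant norm. Each term
  at \<open>w0\<close> is therefore read back as a covariant derivative of \<open>f\<close> applied
  to covariant derivatives of \<open>R\<close> on vertical lifts.\<close>

lemma chain_sum_term:
  assumes bs: "length bs \<le> K" "\<And>B. B \<in> set bs \<Longrightarrow> B \<noteq> []"
  defines "v \<equiv> (x, tvec_of A c x w0)"
  defines "Q \<equiv> \<lambda>B. cov_deriv_map (tangent_atlas A) A DT DR R (length B) v
      (map (\<lambda>u. vertical_lift A v (tvec_of A c x u)) B)"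
  shows "fun_coord A D f d (length bs) (fibre_map w0) (map (\<lambda>B. fibre_coord B w0) bs) =
      cov_deriv_fun A D f (length bs) (R v) (map Q bs)"
    and "B \<in> set bs \<Longrightarrow> Q B \<in> tspace A (R v)"
proof -
  let ?C = "tangent_chart A c"
  note C = tangent_chart_in[OF saA c(1)]
  have lift: "vertical_lift A v (tvec_of A c x u) = tvec_of (tangent_atlas A) ?C v (0, u)" for u
    using vertical_lift_eq[OF saA c tvec_of_tspace[OF saA c] tvec_of_tspace[OF saA c], of w0 u]
    by (simp add: v_def tvec_of_self[OF saA c])
  have vC: "v \<in> cdom ?C" "crd ?C v = (crd c x, w0)" using fibre_chart by (simp_all add: v_def)
  have l: "set (map (\<lambda>u. vertical_lift A v (tvec_of A c x u)) B) \<subseteq> tspace (tangent_atlas A) v"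
    "map (\<lambda>v. v ?C) (map (\<lambda>u. vertical_lift A v (tvec_of A c x u)) B) = map (Pair 0) B" for B
    using tvec_of_tspace[OF saT C vC(1)] tvec_of_self[OF saT C vC(1)] by (auto simp: lift)
  have Q: "Q B \<in> tspace A (R v)" "Q B d = fibre_coord B w0" if "B \<in> set bs" for B
  proof -
    obtain k where k: "length B = Suc k" using bs(2)[OF \<open>B \<in> set bs\<close>] by (cases B) auto
    note r = map_repD[OF saT connT saA sm connR map_rep_R[of k]]
    show "Q B \<in> tspace A (R v)"
      unfolding Q_def k by (rule r(1)[OF C vC(1) _ l(1)]) (simp add: k)
    show "Q B d = fibre_coord B w0"
      using r(3)[OF C d(1) vC(1) d(2)[folded v_def] _ l(1), of B] k
      unfolding Q_def fibre_coord_def l(2) vC(2) by simp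
  qed
  show "B \<in> set bs \<Longrightarrow> Q B \<in> tspace A (R v)" by (rule Q(1))
  have "cov_deriv_fun A D f (length bs) (R v) (map Q bs) =
      fun_coord A D f d (length bs) (crd d (R v)) (map (\<lambda>v. v d) (map Q bs))"
    by (rule cov_deriv_fun_coord[OF saA conn f d(1) bs(1) d(2)[folded v_def]]) (use Q(1) in auto)
  moreover have "map (\<lambda>v. v d) (map Q bs) = map (\<lambda>B. fibre_coord B w0) bs" using Q(2) by simp
  ultimately show "fun_coord A D f d (length bs) (fibre_map w0) (map (\<lambda>B. fibre_coord B w0) bs) =
      cov_deriv_fun A D f (length bs) (R v) (map Q bs)"
    by (simp only: fibre_map_def v_def)
qed

end
end

section \<open>Estimates in the extended nonnegative reals and the conclusion\<close>

lemma ennreal_abs_sum_list: "ennreal \<bar>\<Sum>x\<leftarrow>xs. h x\<bar> \<le> (\<Sum>x\<leftarrow>xs. ennreal \<bar>h x :: real\<bar>)"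
proof (induction xs)
  case (Cons a xs)
  have "ennreal \<bar>h a + (\<Sum>x\<leftarrow>xs. h x)\<bar> \<le> ennreal (\<bar>h a\<bar> + \<bar>\<Sum>x\<leftarrow>xs. h x\<bar>)"
    by (rule ennreal_leI) (rule abs_triangle_ineq)
  also have "\<dots> = ennreal \<bar>h a\<bar> + ennreal \<bar>\<Sum>x\<leftarrow>xs. h x\<bar>" by simp
  also have "\<dots> \<le> ennreal \<bar>h a\<bar> + (\<Sum>x\<leftarrow>xs. ennreal \<bar>h x\<bar>)" by (rule add_left_mono) (rule Cons)
  finally show ?case by simp
qed simp

lemma prod_list_mono_ennreal:
  "(\<And>x. x \<in> set xs \<Longrightarrow> a x \<le> (b x :: ennreal)) \<Longrightarrow> (\<Prod>x\<leftarrow>xs. a x) \<le> (\<Prod>x\<leftarrow>xs. b x)"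
  by (induction xs) (auto intro!: mult_mono)

text \<open>Undoes the division by \<open>fact i\<close> inside the norms; cancelling in
  \<open>ennreal\<close> requires a factor that is neither zero nor infinite.\<close>

lemma le_fact_mult_MAX:
  fixes h :: "nat \<Rightarrow> 'a \<Rightarrow> ennreal"
  assumes "i \<in> {1..k}" "x \<in> S"
  shows "h i x \<le> fact i * (MAX i\<in>{1..k}. SUP x\<in>S. h i x / fact i)"
proof -
  have fn: "(fact i :: ennreal) = ennreal (fact i)"
    by (metis ennreal_of_nat_eq_real_of_nat of_nat_fact)
  then have f: "(fact i :: ennreal) \<noteq> 0" "(fact i :: ennreal) \<noteq> top" by auto
  have "h i x = fact i * (h i x / fact i)"
    unfolding ennreal_times_divide mult.commute[of "fact i"] using f
    by (simp add: mult_divide_eq_ennreal)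
  also have "h i x / fact i \<le> (SUP x\<in>S. h i x / fact i)" by (rule SUP_upper[OF assms(2)])
  also have "\<dots> \<le> (MAX i\<in>{1..k}. SUP x\<in>S. h i x / fact i)"
    using assms(1) by (intro Max_ge) auto
  finally show ?thesis by (simp add: mult_left_mono)
qed

lemma prod_list_fact_mult:
  fixes r :: ennreal
  shows "(\<Prod>B\<leftarrow>bs. fact (length B) * r) = of_nat (\<Prod>B\<leftarrow>bs. fact (length B)) * r ^ length bs"
  by (induction bs) (simp_all add: algebra_simps)

theorem corollary4p8:
  fixes A :: "('m, 'e::euclidean_space) chart set"
    and g :: "'m \<Rightarrow> ('m, 'e) tvec \<Rightarrow> ('m, 'e) tvec \<Rightarrow> real"
    and D :: "'m \<Rightarrow> ('m, 'e) tvec \<Rightarrow> ('m \<Rightarrow> ('m, 'e) tvec) \<Rightarrow> ('m, 'e) tvec"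
    and R :: "'m \<times> ('m, 'e) tvec \<Rightarrow> 'm"
    and f :: "'m \<Rightarrow> real"
    and p :: nat
  assumes "1 \<le> p"
    and "riemannian_manifold A g"
    and "levi_civita A g D"
    and "sasaki_metric A g D G"
    and "levi_civita (tangent_atlas A) G DT"
    and "Ck_fun A (p + 1) (carrier A) f"
    and "manifold_retraction A R"
    and "pullback_connection (tangent_atlas A) A R D DR"
    and "V \<subseteq> tangent_bundle A"
  shows "(SUP v\<in>V. op_norm (p + 1) (tspace A (fst v)) (metric_norm g (fst v)) abs
            (space_nderiv (tspace A (fst v)) (metric_norm g (fst v)) (p + 1)
               (pullback_fun f R (fst v)) (snd v)))
         \<le> fact (p + 1) * fun_norm A g D f (p + 1) (R ` V)
             * map_norm (tangent_atlas A) A G g DT DR R (p + 1) V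
             * (1 + map_norm (tangent_atlas A) A G g DT DR R (p + 1) V) ^ p"
    (is "?L \<le> fact (p + 1) * ?\<phi> * ?\<rho> * (1 + ?\<rho>) ^ p")
proof -
  have saA: "smooth_atlas A" and g: "riemannian_metric A g"
    using assms(2) by (auto simp: riemannian_manifold_def smooth_manifold_def)
  have sm: "smooth_map (tangent_atlas A) A R"
    using assms(7) by (simp add: manifold_retraction_def)
  note ctx = saA g assms(3,4,5,6) sm assms(8)
  note saT = smooth_tangent_atlas[OF saA]
  \<comment> \<open>A bound for a single list of unit vectors suffices, because the left-hand side
    is an iterated supremum over such lists.\<close>
  have main: "ennreal \<bar>space_nderiv (tspace A x) (metric_norm g x) (p + 1) (pullback_fun f R x) v0 ws\<bar>
      \<le> fact (p + 1) * ?\<phi> * ?\<rho> * (1 + ?\<rho>) ^ p"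
    if v: "(x, v0) \<in> V" and ws: "length ws = p + 1" "\<forall>w\<in>set ws. w \<in> tspace A x \<and> metric_norm g x w = 1"
    for x v0 ws
  proof -
    have xv: "x \<in> carrier A" "v0 \<in> tspace A x" using v assms(9) by (auto simp: tangent_bundle_def)
    obtain c where c: "c \<in> A" "x \<in> cdom c" using xv(1) by (rule carrierE[OF saA])
    let ?t = "tvec_of A c x"
    let ?w0 = "v0 c"
    have tv: "?t ?w0 = v0" by (rule tspace_eq_tvec_of[OF saA xv(2) c])
    have "(x, v0) \<in> cdom (tangent_chart A c)" using c xv by (simp add: cdom_tangent_chart)
    then have Rc: "R (x, v0) \<in> carrier A"
      by (rule smooth_map_carrier[OF saT saA sm tangent_chart_in[OF saA c(1)]])
    then obtain d where d: "d \<in> A" "R (x, v0) \<in> cdom d" by (rule carrierE[OF saA])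
    then have d': "R (x, ?t ?w0) \<in> cdom d" by (simp add: tv)
    define us where "us = map (\<lambda>w. w c) ws"
    have us: "length us = p + 1" "map ?t us = ws"
      using ws tspace_eq_tvec_of[OF saA _ c] by (auto simp: us_def intro!: map_idI)
    have un: "metric_norm g x (?t u) = 1" if "u \<in> set us" for u
      using that ws(2) us(2) by (metis imageI list.set_map)
    let ?q = "fibre_coord A DT R DR c d x" and ?r = "fibre_map A R c d x"
    let ?F = "fun_coord A D f d"
    let ?lift = "\<lambda>u. vertical_lift A (x, v0) (?t u)"
    let ?Q = "\<lambda>B. cov_deriv_map (tangent_atlas A) A DT DR R (length B) (x, v0) (map ?lift B)"
    have fd: "?w0 \<in> fibre_dom A R c d x"
      using d' by (simp add: fibre_dom_def[OF ctx c d(1) d'])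
    have "space_nderiv (tspace A x) (metric_norm g x) (p + 1) (pullback_fun f R x) v0 ws =
        chain_sum ?F ?q ?r us ?w0"
      using space_nderiv_chain_sum[OF ctx c d(1) d' le_refl us(1) fd] by (simp only: tv us(2))
    also have "ennreal \<bar>\<dots>\<bar> \<le> (\<Sum>bs\<leftarrow>blocks us. ennreal \<bar>?F (length bs) (?r ?w0) (map (\<lambda>B. ?q B ?w0) bs)\<bar>)"
      unfolding chain_sum_def by (rule ennreal_abs_sum_list)
    also have "\<dots> \<le> (\<Sum>bs\<leftarrow>blocks us. of_nat (fact (length bs) * (\<Prod>B\<leftarrow>bs. fact (length B))) * (?\<phi> * ?\<rho> ^ length bs))"
    proof (rule sum_list_mono)
      fix bs assume bs: "bs \<in> set (blocks us)"
      note pr = blocks_props[OF bs]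
      let ?m = "length bs"
      have "us \<noteq> []" using us(1) by auto
      \<comment> \<open>The norms take maxima over orders from 1 on, so the empty partition must be
        excluded, as must empty blocks below.\<close>
      then have "?m \<noteq> 0" using pr(3) by simp
      then have m: "?m \<le> p + 1" "?m \<in> {1..p + 1}" using pr(1) us(1) by (simp_all add: Suc_le_eq)
      have Q: "?Q B \<in> tspace A (R (x, v0))" if "B \<in> set bs" for B
        using chain_sum_term(2)[OF ctx c d(1) d' m(1) pr(4) that] by (simp only: tv)
      have QN: "ennreal (metric_norm g (R (x, v0)) (?Q B)) \<le> fact (length B) * ?\<rho>" if B: "B \<in> set bs" for B
      proof -
        let ?op = "\<lambda>i v. op_norm i (tspace (tangent_atlas A) v) (metric_norm G v) (metric_norm g (R v))
          (cov_deriv_map (tangent_atlas A) A DT DR R i v)"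
        \<comment> \<open>Vertical lifting is an isometry for the Sasaki metric, so unit vectors at
          \<open>x\<close> lift to admissible arguments for the operator norm of the derivatives of
          \<open>R\<close>.\<close>
        have "?lift u \<in> tspace (tangent_atlas A) (x, v0) \<and> metric_norm G (x, v0) (?lift u) = 1"
          if "u \<in> set B" for u
        proof
          note tu = tvec_of_tspace[OF saA c, of u]
          show "?lift u \<in> tspace (tangent_atlas A) (x, v0)"
            using vertical_lift_vertical[OF saA xv tu] by (simp add: vertical_def)
          have "u \<in> set us" using pr(6)[OF B] that by blast
          then show "metric_norm G (x, v0) (?lift u) = 1"
            using sasaki_at(2)[OF saA g assms(3,4,5) xv tu tu] un by (simp add: metric_norm_def)
        qed
        then have "ennreal (metric_norm g (R (x, v0)) (?Q B)) \<le> ?op (length B) (x, v0)"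
          unfolding op_norm_def by (intro SUP_upper) auto
        also have "length B \<in> {1..p + 1}" using pr(4,5)[OF B] us(1) by (simp add: Suc_le_eq)
        from le_fact_mult_MAX[OF this v, of ?op] have "?op (length B) (x, v0) \<le> fact (length B) * ?\<rho>"
          unfolding map_norm_def .
        finally show ?thesis .
      qed
      let ?opf = "\<lambda>i x. op_norm i (tspace A x) (metric_norm g x) abs (cov_deriv_fun A D f i x)"
      have "?F ?m (?r ?w0) (map (\<lambda>B. ?q B ?w0) bs) = cov_deriv_fun A D f ?m (R (x, v0)) (map ?Q bs)"
        using chain_sum_term(1)[OF ctx c d(1) d' m(1) pr(4)] by (simp only: tv)
      then have "ennreal \<bar>?F ?m (?r ?w0) (map (\<lambda>B. ?q B ?w0) bs)\<bar> \<le>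
          ?opf ?m (R (x, v0)) * (\<Prod>Q\<leftarrow>map ?Q bs. ennreal (metric_norm g (R (x, v0)) Q))"
        using op_norm_fun_bound[OF ctx m(1) Rc, of "map ?Q bs"] Q by auto
      also have "\<dots> \<le> (fact ?m * ?\<phi>) * (\<Prod>B\<leftarrow>bs. fact (length B) * ?\<rho>)"
      proof (rule mult_mono)
        show "?opf ?m (R (x, v0)) \<le> fact ?m * ?\<phi>"
          using le_fact_mult_MAX[OF m(2) imageI[OF v], of ?opf R] unfolding fun_norm_def .
        show "(\<Prod>Q\<leftarrow>map ?Q bs. ennreal (metric_norm g (R (x, v0)) Q)) \<le> (\<Prod>B\<leftarrow>bs. fact (length B) * ?\<rho>)"
          unfolding map_map o_def by (rule prod_list_mono_ennreal) (rule QN)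
      qed auto
      also have "\<dots> = of_nat (fact ?m * (\<Prod>B\<leftarrow>bs. fact (length B))) * (?\<phi> * ?\<rho> ^ ?m)"
        by (simp add: prod_list_fact_mult mult_ac)
      finally show "ennreal \<bar>?F ?m (?r ?w0) (map (\<lambda>B. ?q B ?w0) bs)\<bar> \<le> \<dots>" .
    qed
    \<comment> \<open>The counting lemma is applied to the function
      \<open>m \<mapsto> ?\<phi> * ?\<rho> ^ m\<close> of the number of blocks, which is
      \<open>Suc j\<close>.\<close>
    also have "\<dots> = (\<Sum>j\<le>p. of_nat (fact (Suc p) * (p choose j)) * (?\<phi> * ?\<rho> ^ Suc j))"
      by (rule sum_list_fact_blocks) (simp add: us(1))
    \<comment> \<open>Every partition has at least one block, so one factor \<open>?\<rho>\<close>
      splits off and a binomial sum of degree \<open>p\<close> is left.\<close>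
    also have "\<dots> = fact (p + 1) * ?\<phi> * ?\<rho> * (\<Sum>j\<le>p. of_nat (p choose j) * ?\<rho> ^ j * 1 ^ (p - j))"
      unfolding sum_distrib_left by (intro sum.cong) (simp_all add: mult_ac del: fact_Suc)
    also have "(\<Sum>j\<le>p. of_nat (p choose j) * ?\<rho> ^ j * 1 ^ (p - j)) = (1 + ?\<rho>) ^ p"
      by (simp only: binomial_ring[symmetric] add.commute)
    finally show ?thesis .
  qed
  show ?thesis
    unfolding op_norm_def
    by (intro SUP_least) (use main in auto)
qed

end
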